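(* Let $\kappa>0$, let $\mathcal U\subset\mathbb R^3$ be an exterior region, and let $\psi$ be a radiation solution of the Helmholtz equation $-\Delta\psi=\kappa^2\psi$ in $\mathcal U$. Let $X$ be a two-dimensional (affine) plane in $\mathbb R^3$ such that $X\subset\mathcal U$, and let $\mathcal D$ be an arbitrary non-empty open domain of $X$. Then $\operatorname{Im}\psi$ on $\mathcal D$ uniquely determines $\psi$ in the entire region $\mathcal U$. That is, if $\psi_1,\psi_2$ are two radiation solutions in $\mathcal U$ (for the same $\kappa$) and $\operatorname{Im}\psi_1=\operatorname{Im}\psi_2$ on $\mathcal D$, then $\psi_1=\psi_2$ on $\mathcal U$.
   Context: An exterior region $\mathcal U$ in $\mathbb R^3$ is an open unbounded connected set consisting of all points in the exterior of a closed bounded regular surface $S$. A radiation solution in $\mathcal U$ is a complex-valued function $\psi$, of class $C^2$ in the closure of $\mathcal U$, satisfying $-\Delta\psi(x)=\kappa^2\psi(x)$ for $x\in\mathcal U$ and the Sommerfeld radiation condition $|x|\left(\frac{\partial}{\partial|x|}-i\kappa\right)\psi(x)\to0$ as $|x|\to+\infty$, uniformly in $x/|x|$. "Open domain of $X$" means open in the relative topology of $X$. *)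

theory Defs
  imports "HOL-Analysis.Analysis"
begin

(* Two-dimensional embedded submanifolds of R^3 of class C^1, given by local parametrizations.
   C^1 is the weakest usual regularity; smoother surfaces are included. *)
definition regular_surface :: "(real ^ 3) set \<Rightarrow> bool" where
  "regular_surface S \<longleftrightarrow>
    (\<forall>p\<in>S. \<exists>V W (f :: real ^ 2 \<Rightarrow> real ^ 3) g (f' :: real ^ 2 \<Rightarrow> (real ^ 2) \<Rightarrow>\<^sub>L (real ^ 3)).
       open V \<and> p \<in> V \<and> open W \<and> homeomorphism W (S \<inter> V) f g \<and>
       (\<forall>u\<in>W. (f has_derivative blinfun_apply (f' u)) (at u) \<and> inj (blinfun_apply (f' u))) \<and>
       continuous_on W f')"

(* "outside S" is the union of the unbounded components of the complement of S.
   A closed surface is understood to be one connected surface: for two disjoint spheres that are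
   mirror images in a plane X, the difference of the fundamental solutions centred at the two
   centres is a nonzero radiation solution vanishing on X. *)
definition exterior_region :: "(real ^ 3) set \<Rightarrow> bool" where
  "exterior_region U \<longleftrightarrow> open U \<and> connected U \<and> \<not> bounded U \<and>
    (\<exists>S. regular_surface S \<and> S \<noteq> {} \<and> connected S \<and> closed S \<and> bounded S \<and> U = outside S)"

(* Class C^2 in the closure of the open set U: twice continuously differentiable in U, and the
   function and its derivatives of order 1 and 2 extend continuously to the closure. *)
definition C2_on_closure ::
    "('a::real_normed_vector \<Rightarrow> 'b::real_normed_vector) \<Rightarrow> 'a set \<Rightarrow> bool" where
  "C2_on_closure f U \<longleftrightarrow>
    (\<exists>(f' :: 'a \<Rightarrow> 'a \<Rightarrow>\<^sub>L 'b) (f'' :: 'a \<Rightarrow> 'a \<Rightarrow>\<^sub>L ('a \<Rightarrow>\<^sub>L 'b)).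
       (\<forall>x\<in>U. (f has_derivative blinfun_apply (f' x)) (at x) \<and>
              (f' has_derivative blinfun_apply (f'' x)) (at x)) \<and>
       continuous_on (closure U) f \<and> continuous_on (closure U) f' \<and>
       continuous_on (closure U) f'')"

definition partial_deriv ::
    "'a::real_normed_vector \<Rightarrow> ('a \<Rightarrow> 'b::real_normed_vector) \<Rightarrow> 'a \<Rightarrow> 'b" where
  "partial_deriv b f x = vector_derivative (\<lambda>t. f (x + t *\<^sub>R b)) (at 0)"

definition laplacian ::
    "('a::euclidean_space \<Rightarrow> 'b::real_normed_vector) \<Rightarrow> 'a \<Rightarrow> 'b" where
  "laplacian f x = (\<Sum>b\<in>Basis. partial_deriv b (partial_deriv b f) x)"

(* Polar form x = r *\<^sub>R \<theta> with r = |x| and \<theta> = x/|x|. *)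
definition sommerfeld_radiation :: "real \<Rightarrow> (real ^ 3 \<Rightarrow> complex) \<Rightarrow> bool" where
  "sommerfeld_radiation \<kappa> \<psi> \<longleftrightarrow>
    uniform_limit (sphere 0 1)
      (\<lambda>r \<theta>. of_real r *
         (vector_derivative (\<lambda>s. \<psi> (s *\<^sub>R \<theta>)) (at r) - \<i> * of_real \<kappa> * \<psi> (r *\<^sub>R \<theta>)))
      (\<lambda>_. 0) at_top"

definition radiation_solution :: "real \<Rightarrow> (real ^ 3) set \<Rightarrow> (real ^ 3 \<Rightarrow> complex) \<Rightarrow> bool" where
  "radiation_solution \<kappa> U \<psi> \<longleftrightarrow>
    C2_on_closure \<psi> U \<and>
    (\<forall>x\<in>U. - laplacian \<psi> x = of_real (\<kappa>\<^sup>2) * \<psi> x) \<and>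
    sommerfeld_radiation \<kappa> \<psi>"

end

theory Submission
  imports Defs "HOL-Complex_Analysis.Complex_Analysis"
begin

text \<open>Let \<open>u = \<psi>\<^sub>1 - \<psi>\<^sub>2\<close>. All uses of Green's identity are in the form
  \<open>\<integral> \<nabla>\<phi> \<bullet> (v \<nabla>u - u \<nabla>v) = 0\<close> with a compactly supported cutoff \<open>\<phi>\<close>; taking for \<open>v\<close> the fundamental
  solution \<open>e\<^sup>i\<^sup>\<kappa>\<^sup>r / r\<close> it represents \<open>u\<close> locally and, by the radiation condition, also near infinity.
  Complexifying the argument of the fundamental solution shows that \<open>u\<close> is analytic along lines and that
  \<open>u (p + t \<theta>) = exp (\<i> \<kappa> t) * H (1 / t)\<close> for large \<open>t\<close> with \<open>H\<close> holomorphic at \<open>0\<close>. Take \<open>p \<in> D\<close> and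
  \<open>\<theta>\<close> parallel to \<open>X\<close>. Analyticity propagates \<open>Im u = 0\<close> to the whole line, so \<open>exp (\<i> \<kappa> t) * H (1 / t)\<close> is
  real for real \<open>t\<close>, which forces \<open>H\<close> to vanish to infinite order at \<open>0\<close>. Hence \<open>u = 0\<close> on \<open>X\<close>. The connected
  surface lies on one side of \<open>X\<close>; on the other side the half-space Green's function gives \<open>u = 0\<close>,
  and unique continuation gives \<open>u = 0\<close> on \<open>U\<close>.\<close>

section \<open>Integrals of compactly supported functions\<close>

text \<open>The obstacle is that \<open>Im u\<close> is not a radiation solution: it mixes the
  outgoing wave \<open>u\<close> with its incoming conjugate. On a line the two carry the phases
  \<open>exp (\<i> \<kappa> t)\<close> and \<open>exp (- \<i> \<kappa> t)\<close>. Their ratio has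
  an essential singularity at \<open>1 / t = 0\<close>, where both amplitudes are holomorphic, and
  this separates them. The lines in \<open>X\<close> through one point of \<open>D\<close> cover
  \<open>X\<close>, so a small \<open>D\<close> is as good as the whole plane. Vanishing on
  \<open>X\<close> is Dirichlet data without the normal derivative, so it does not allow
  continuation across \<open>X\<close> by itself. On a half-space free of the surface it suffices,
  because a reflected fundamental solution removes the unknown normal derivative from Green's
  identity. The gradient of a cutoff acts as a smeared normal: spheres become shells and the plane
  becomes a thin layer, and the same volume identity serves around a pole, near infinity and along
  \<open>X\<close>.\<close>

lemma integrable_compact_support:
  fixes f :: "'a::euclidean_space \<Rightarrow> 'b::{banach, second_countable_topology}"
  assumes "continuous_on S f" "compact K" "K \<subseteq> S" "\<And>x. x \<notin> K \<Longrightarrow> f x = 0"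
  shows "integrable lborel f"
proof -
  have "integrable lborel (\<lambda>x. indicator K x *\<^sub>R f x)"
    by (intro borel_integrable_compact assms(2) continuous_on_subset[OF assms(1) assms(3)])
  moreover have "(\<lambda>x. indicator K x *\<^sub>R f x) = f"
    by (rule ext) (simp add: indicator_def assms(4))
  ultimately show ?thesis by simp
qed

lemma bounded_compact_support:
  fixes f :: "'a::euclidean_space \<Rightarrow> 'b::real_normed_vector"
  assumes "continuous_on S f" "compact K" "K \<subseteq> S" "\<And>x. x \<notin> K \<Longrightarrow> f x = 0"
  obtains M where "M > 0" "\<And>x. norm (f x) \<le> M"
proof -
  have "bounded (f ` K)"
    using assms by (meson compact_continuous_image compact_imp_bounded continuous_on_subset)
  then obtain M where "M > 0" "\<forall>y\<in>f ` K. norm y \<le> M"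
    by (auto simp: bounded_pos)
  then have "norm (f x) \<le> M" for x
    using assms(4)[of x] by (cases "x \<in> K") auto
  then show ?thesis using \<open>M > 0\<close> that by blast
qed

lemma has_derivative_outside_support:
  fixes f :: "'a::real_normed_vector \<Rightarrow> 'b::real_normed_vector"
  assumes "closed K" "\<And>x. x \<notin> K \<Longrightarrow> f x = 0" "x \<notin> K"
  shows "(f has_derivative (\<lambda>h. 0)) (at x)"
  by (rule has_derivative_transform_within_open[of "\<lambda>x. 0" _ _ _ "- K"]) (use assms in auto)

text \<open>A solution is an arbitrary total function off its domain. Multiplied by a factor
  supported in a closed subset of the domain it becomes continuous everywhere, which supplies
  measurability.\<close>

lemma continuous_on_UNIV_by_support:
  fixes f :: "'a::euclidean_space \<Rightarrow> 'b::real_normed_vector"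
  assumes "continuous_on S f" "open S" "closed K" "K \<subseteq> S" "\<And>x. x \<notin> K \<Longrightarrow> f x = 0"
  shows "continuous_on UNIV f"
proof -
  have "continuous_on (- K) f"
    using assms(5) by (subst continuous_on_cong[OF refl, of _ _ "\<lambda>x. 0"]) auto
  then have "continuous_on (S \<union> - K) f"
    using assms by (intro continuous_on_open_Un) auto
  moreover have "S \<union> - K = UNIV" using assms by auto
  ultimately show ?thesis by simp
qed

lemma lborel_integral_translate:
  fixes f :: "'a::euclidean_space \<Rightarrow> 'b::{banach, second_countable_topology}"
  assumes "f \<in> borel_measurable borel"
  shows "(\<integral>x. f (a + x) \<partial>lborel) = (\<integral>x. f x \<partial>lborel)"
proof -
  have "(\<integral>x. f x \<partial>lborel) = (\<integral>x. f x \<partial>(distr lborel borel ((+) a)))"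
    by (simp add: lborel_distr_plus)
  also have "\<dots> = (\<integral>x. f (a + x) \<partial>lborel)"
    using assms by (subst integral_distr) auto
  finally show ?thesis by simp
qed

lemma lborel_integral_affine:
  fixes f :: "'a::euclidean_space \<Rightarrow> 'b::{banach, second_countable_topology}"
  assumes "f \<in> borel_measurable borel" "c > 0"
  shows "(\<integral>x. f x \<partial>lborel) = c ^ DIM('a) *\<^sub>R (\<integral>x. f (a + c *\<^sub>R x) \<partial>lborel)"
proof -
  have "(\<integral>x. f x \<partial>lborel) =
     (\<integral>x. f x \<partial>(density (distr lborel borel (\<lambda>x. a + c *\<^sub>R x)) (\<lambda>_. ennreal (\<bar>c\<bar>^DIM('a)))))"
    using lborel_affine[of c a] assms by (simp add: ennreal_power)
  also have "\<dots> = (\<integral>x. \<bar>c\<bar>^DIM('a) *\<^sub>R f x \<partial>(distr lborel borel (\<lambda>x. a + c *\<^sub>R x)))"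
    using assms by (subst integral_density) auto
  also have "\<dots> = (\<integral>x. \<bar>c\<bar>^DIM('a) *\<^sub>R f (a + c *\<^sub>R x) \<partial>lborel)"
    using assms by (subst integral_distr) auto
  also have "\<dots> = c ^ DIM('a) *\<^sub>R (\<integral>x. f (a + c *\<^sub>R x) \<partial>lborel)"
    using assms by simp
  finally show ?thesis .
qed

lemma has_vector_derivative_quotient_tendsto:
  fixes f :: "real \<Rightarrow> 'b::real_normed_vector"
  assumes "(f has_vector_derivative D) (at 0)"
  shows "((\<lambda>t. (f t - f 0) /\<^sub>R t) \<longlongrightarrow> D) (at 0)"
proof -
  have "((\<lambda>t. (1 / norm t) *\<^sub>R (f t - (f 0 + t *\<^sub>R D))) \<longlongrightarrow> 0) (at 0)"
    using assms unfolding has_vector_derivative_def has_derivative_within by simp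
  then have "((\<lambda>t. norm ((1 / norm t) *\<^sub>R (f t - (f 0 + t *\<^sub>R D)))) \<longlongrightarrow> 0) (at 0)"
    by (rule tendsto_norm_zero)
  moreover have "\<forall>\<^sub>F t in at 0. norm ((1 / norm t) *\<^sub>R (f t - (f 0 + t *\<^sub>R D)))
      = norm ((f t - f 0) /\<^sub>R t - D)"
  proof (unfold eventually_at_topological, intro exI[of _ UNIV] conjI ballI impI)
    fix t :: real assume "t \<noteq> 0"
    then have "(f t - f 0) /\<^sub>R t - D = (1 / t) *\<^sub>R (f t - (f 0 + t *\<^sub>R D))"
      by (simp add: algebra_simps divide_inverse)
    then show "norm ((1 / norm t) *\<^sub>R (f t - (f 0 + t *\<^sub>R D))) = norm ((f t - f 0) /\<^sub>R t - D)"
      by simp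
  qed auto
  ultimately have "((\<lambda>t. norm ((f t - f 0) /\<^sub>R t - D)) \<longlongrightarrow> 0) (at 0)"
    by (rule Lim_transform_eventually)
  then show ?thesis
    by (rule LIM_zero_cancel[OF tendsto_norm_zero_cancel])
qed

text \<open>The integral of the difference quotients vanishes by translation invariance.\<close>

lemma integral_derivative_compact_support:
  fixes g :: "'a::euclidean_space \<Rightarrow> 'b::euclidean_space"
  assumes der: "\<And>x. (g has_derivative g' x) (at x)"
    and cont: "continuous_on UNIV (\<lambda>x. g' x b)"
    and K: "compact K" "\<And>x. x \<notin> K \<Longrightarrow> g x = 0"
  shows "(\<integral>x. g' x b \<partial>lborel) = 0"
proof -
  have g'0: "g' x b = 0" if "x \<notin> K" for x
    using has_derivative_unique[OF der has_derivative_outside_support[OF compact_imp_closed[OF K(1)] K(2) that]]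
    by simp
  have contg: "continuous_on UNIV g"
    by (intro continuous_at_imp_continuous_on ballI has_derivative_continuous[OF der])
  have intg: "integrable lborel g"
    using integrable_compact_support[OF contg K(1) _ K(2)] by simp
  obtain M where M: "M > 0" "\<And>x. norm (g' x b) \<le> M"
    using bounded_compact_support[OF cont K(1)] g'0 by blast
  obtain N where N: "K \<subseteq> cball 0 N"
    using compact_imp_bounded[OF K(1)] unfolding bounded_iff by (auto simp: subset_iff)
  define s where "s n = inverse (real (Suc n))" for n
  have s: "s n > 0" "s n \<le> 1" for n by (auto simp: s_def field_simps)
  have s0: "s \<longlonglongrightarrow> 0" unfolding s_def by (rule LIMSEQ_inverse_real_of_nat)
  define q where "q n x = (g (s n *\<^sub>R b + x) - g x) /\<^sub>R s n" for n x
  have path: "((\<lambda>t. g (t *\<^sub>R b + x)) has_vector_derivative g' (t *\<^sub>R b + x) b) (at t within S)" for t x S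
  proof -
    have "((\<lambda>t. t *\<^sub>R b + x) has_derivative (\<lambda>t. t *\<^sub>R b)) (at t within S)"
      by (auto intro!: derivative_eq_intros)
    from has_derivative_compose[OF this der]
    show ?thesis unfolding has_vector_derivative_def
      by (simp add: linear_scale[OF has_derivative_linear[OF der]])
  qed
  have qb: "norm (q n x) \<le> M" for n x
  proof -
    have "norm (g (s n *\<^sub>R b + x) - g (0 *\<^sub>R b + x)) \<le> M * norm (s n - 0)"
    proof (rule differentiable_bound[where S="{0..s n}" and f="\<lambda>t. g (t *\<^sub>R b + x)"
          and f'="\<lambda>t h. h *\<^sub>R g' (t *\<^sub>R b + x) b"])
      show "((\<lambda>t. g (t *\<^sub>R b + x)) has_derivative (\<lambda>h. h *\<^sub>R g' (t *\<^sub>R b + x) b)) (at t within {0..s n})" for t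
        using path unfolding has_vector_derivative_def .
      show "onorm (\<lambda>h. h *\<^sub>R g' (t *\<^sub>R b + x) b) \<le> M" for t
        using M by (intro onorm_bound) (auto simp: mult.commute[of M] intro!: mult_left_mono)
    qed (use s[of n] in auto)
    then show ?thesis using s[of n] unfolding q_def norm_scaleR by (simp add: field_simps)
  qed
  \<comment> \<open>Since \<open>s n \<le> 1\<close>, a translation by
    \<open>s n *\<^sub>R b\<close> moves the support by at most \<open>norm b\<close>. One ball
    therefore serves for all \<open>n\<close> and, with the bound \<open>qb\<close>, gives the
    dominating function.\<close>
  have q0: "q n x = 0" if "x \<notin> cball 0 (N + norm b)" for n x
  proof -
    have "norm x \<le> norm (s n *\<^sub>R b + x) + norm (s n *\<^sub>R b)"
      using norm_triangle_ineq4[of "s n *\<^sub>R b + x" "s n *\<^sub>R b"] by simp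
    moreover have "norm (s n *\<^sub>R b) \<le> norm b" using s[of n] by (simp add: mult_left_le_one_le)
    moreover have "norm x > N + norm b" using that by simp
    ultimately have "norm (s n *\<^sub>R b + x) > N" "norm x > N" using norm_ge_zero[of b] by linarith+
    then have "s n *\<^sub>R b + x \<notin> K" "x \<notin> K" using N by (auto simp: subset_iff dest!: leD)
    then show ?thesis using K by (simp add: q_def)
  qed
  have lim: "(\<lambda>n. q n x) \<longlonglongrightarrow> g' x b" for x
  proof -
    have "((\<lambda>t. g (t *\<^sub>R b + x)) has_vector_derivative g' (0 *\<^sub>R b + x) b) (at 0)" by (rule path)
    from has_vector_derivative_quotient_tendsto[OF this]
    have "((\<lambda>t. (g (t *\<^sub>R b + x) - g x) /\<^sub>R t) \<longlongrightarrow> g' x b) (at 0)" by simp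
    moreover have "filterlim s (at 0) sequentially"
      using s0 s by (auto simp: filterlim_at less_le)
    ultimately show ?thesis unfolding q_def by (rule filterlim_compose)
  qed
  have meas: "g \<in> borel_measurable borel" using contg borel_measurable_continuous_onI by blast
  have shift: "integrable lborel (\<lambda>x. g (a + x))" "(\<integral>x. g (a + x) \<partial>lborel) = (\<integral>x. g x \<partial>lborel)" for a
  proof -
    show "integrable lborel (\<lambda>x. g (a + x))"
      using integrable_distr[of "(+) a" lborel borel g] intg lborel_distr_plus[of a] by simp
  qed (rule lborel_integral_translate[OF meas])
  have "(\<lambda>n. \<integral>x. q n x \<partial>lborel) \<longlonglongrightarrow> (\<integral>x. g' x b \<partial>lborel)"
  proof (rule integral_dominated_convergence[where w="\<lambda>x. indicator (cball 0 (N + norm b)) x *\<^sub>R M"])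
    show "(\<lambda>x. g' x b) \<in> borel_measurable lborel"
      using cont borel_measurable_continuous_onI by auto
    show "q n \<in> borel_measurable lborel" for n
      unfolding q_def using shift(1)[of "s n *\<^sub>R b"] intg by auto
    show "integrable lborel (\<lambda>x::'a. indicator (cball 0 (N + norm b)) x *\<^sub>R M)"
      by (rule borel_integrable_compact) auto
    show "AE x in lborel. norm (q n x) \<le> indicator (cball 0 (N + norm b)) x *\<^sub>R M" for n
    proof (rule AE_I2)
      show "norm (q n x) \<le> indicator (cball 0 (N + norm b)) x *\<^sub>R M" for x
        using qb[of n x] q0[of x n] by (cases "x \<in> cball 0 (N + norm b)") auto
    qed
  qed (use lim in auto)
  moreover have "(\<integral>x. q n x \<partial>lborel) = 0" for n
    unfolding q_def using shift[of "s n *\<^sub>R b"] intg by simp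
  ultimately show ?thesis by (simp add: LIMSEQ_const_iff)
qed

section \<open>Cutoff functions and Green's identity\<close>

text \<open>A step of class C^1, matching the single derivative of the cutoff in Green's identity.
  The break points 1 and 4 are squares: in \<open>cutoff\<close> the argument is a squared norm
  divided by \<open>R\<^sup>2\<close>, so the transition takes place for radii between
  \<open>R\<close> and \<open>2 * R\<close>.\<close>

definition smooth_step :: "real \<Rightarrow> real" where
  "smooth_step s = (max 0 (s - 1))\<^sup>2 / ((max 0 (s - 1))\<^sup>2 + (max 0 (4 - s))\<^sup>2)"

definition step_deriv :: "real \<Rightarrow> real" where
  "step_deriv s = 2 * max 0 (s - 1) * max 0 (4 - s) * (max 0 (s - 1) + max 0 (4 - s))
     / ((max 0 (s - 1))\<^sup>2 + (max 0 (4 - s))\<^sup>2)\<^sup>2"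

lemma has_real_derivative_max_0_square:
  "((\<lambda>s::real. (max 0 s)\<^sup>2) has_real_derivative 2 * max 0 s) (at s)"
proof -
  consider "s > 0" | "s < 0" | "s = 0" by linarith
  then show ?thesis
  proof cases
    case 1
    have "((\<lambda>s::real. s\<^sup>2) has_real_derivative 2 * s) (at s)"
      by (auto intro!: derivative_eq_intros)
    then have "((\<lambda>s::real. (max 0 s)\<^sup>2) has_real_derivative 2 * s) (at s)"
      by (rule DERIV_cong_ev[THEN iffD1, rotated 3])
         (use 1 eventually_nhds_in_open[of "{0<..}" s] in \<open>auto elim!: eventually_mono\<close>)
    with 1 show ?thesis by simp
  next
    case 2
    have "((\<lambda>s::real. (max 0 s)\<^sup>2) has_real_derivative 0) (at s)"
      by (rule DERIV_cong_ev[THEN iffD1, rotated 3, OF DERIV_const[of 0]])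
         (use 2 eventually_nhds_in_open[of "{..<0}" s] in \<open>auto elim!: eventually_mono\<close>)
    with 2 show ?thesis by simp
  next
    case 3
    have "((\<lambda>h. (max 0 h)\<^sup>2 / h) \<longlongrightarrow> 0) (at (0::real))"
      by (rule Lim_null_comparison[of _ "\<lambda>h. \<bar>h\<bar>"])
         (auto intro!: always_eventually tendsto_eq_intros simp: max_def power2_eq_square)
    with 3 show ?thesis by (simp add: DERIV_def)
  qed
qed

lemma smooth_step_denom_pos: "(max 0 (s - 1))\<^sup>2 + (max 0 (4 - s))\<^sup>2 > (0::real)"
proof (cases "s > 1")
  case True
  then show ?thesis by (intro add_pos_nonneg) auto
next
  case False
  then show ?thesis by (intro add_nonneg_pos) auto
qed

lemma smooth_step_deriv: "(smooth_step has_real_derivative step_deriv s) (at s)"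
proof -
  define m1 m2 where "m1 = max 0 (s - 1)" and "m2 = max 0 (4 - s)"
  have "((\<lambda>s. s - 1) has_real_derivative 1) (at s)" by (auto intro!: derivative_eq_intros)
  from DERIV_chain2[where f="\<lambda>s. (max 0 s)\<^sup>2" and g="\<lambda>s. s - 1", OF has_real_derivative_max_0_square this]
  have d1: "((\<lambda>s. (max 0 (s - 1))\<^sup>2) has_real_derivative 2 * m1) (at s)"
    by (simp add: m1_def)
  have "((\<lambda>s. 4 - s) has_real_derivative -1) (at s)" by (auto intro!: derivative_eq_intros)
  from DERIV_chain2[where f="\<lambda>s. (max 0 s)\<^sup>2" and g="\<lambda>s. 4 - s", OF has_real_derivative_max_0_square this]
  have d2: "((\<lambda>s. (max 0 (4 - s))\<^sup>2) has_real_derivative - 2 * m2) (at s)"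
    by (simp add: m2_def)
  have "(smooth_step has_real_derivative
      (2 * m1 * (m1\<^sup>2 + m2\<^sup>2) - m1\<^sup>2 * (2 * m1 + - 2 * m2)) / ((m1\<^sup>2 + m2\<^sup>2) * (m1\<^sup>2 + m2\<^sup>2))) (at s)"
    unfolding smooth_step_def[abs_def]
    using DERIV_divide[OF d1 DERIV_add[OF d1 d2] less_imp_neq[OF smooth_step_denom_pos, symmetric]]
    by (simp add: m1_def m2_def)
  moreover have "(2 * m1 * (m1\<^sup>2 + m2\<^sup>2) - m1\<^sup>2 * (2 * m1 + - 2 * m2)) / ((m1\<^sup>2 + m2\<^sup>2) * (m1\<^sup>2 + m2\<^sup>2))
      = step_deriv s"
    unfolding step_deriv_def m1_def[symmetric] m2_def[symmetric]
    by (simp add: power2_eq_square algebra_simps)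
  ultimately show ?thesis by simp
qed

lemma smooth_step_simps:
  "s \<le> 1 \<Longrightarrow> smooth_step s = 0" "s \<ge> 4 \<Longrightarrow> smooth_step s = 1"
  "s \<le> 1 \<Longrightarrow> step_deriv s = 0" "s \<ge> 4 \<Longrightarrow> step_deriv s = 0"
  by (auto simp: smooth_step_def step_deriv_def max_def)

lemma smooth_step_bounds: "0 \<le> smooth_step s" "smooth_step s \<le> 1" "0 \<le> step_deriv s"
  using smooth_step_denom_pos[of s] by (auto simp: smooth_step_def step_deriv_def)

lemma step_deriv_pos: "1 < s \<Longrightarrow> s < 4 \<Longrightarrow> step_deriv s > 0"
  using smooth_step_denom_pos[of s] unfolding step_deriv_def
  by (intro divide_pos_pos mult_pos_pos add_pos_pos) auto

lemma continuous_step_deriv [continuous_intros]: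
  "continuous_on S f \<Longrightarrow> continuous_on S (\<lambda>x. step_deriv (f x))"
  using less_imp_neq[OF smooth_step_denom_pos, symmetric]
  unfolding step_deriv_def by (intro continuous_intros) auto

text \<open>The orientation is opposite to that of a bump: 0 near \<open>p\<close> and 1 far away.
  Bumps appear as \<open>1 - cutoff\<close>, shells as differences of two cutoffs. The squared norm
  keeps it differentiable at \<open>p\<close>.\<close>

definition cutoff :: "'a::euclidean_space \<Rightarrow> real \<Rightarrow> 'a \<Rightarrow> real" where
  "cutoff p R y = smooth_step ((norm (y - p))\<^sup>2 / R\<^sup>2)"

text \<open>The gradient of \<open>cutoff p R\<close> is this weight times \<open>y - p\<close>. The
  weight lives on the shell between the radii \<open>R\<close> and \<open>2 * R\<close> and plays
  the role of a surface measure on a sphere.\<close>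

definition cutoff_weight :: "'a::euclidean_space \<Rightarrow> real \<Rightarrow> 'a \<Rightarrow> real" where
  "cutoff_weight p R y = 2 / R\<^sup>2 * step_deriv ((norm (y - p))\<^sup>2 / R\<^sup>2)"

lemma cutoff_has_derivative:
  "(cutoff p R has_derivative (\<lambda>h. cutoff_weight p R y * ((y - p) \<bullet> h))) (at y)"
proof -
  have "((\<lambda>y. ((y - p) \<bullet> (y - p)) / R\<^sup>2) has_derivative (\<lambda>h. (2 / R\<^sup>2) * ((y - p) \<bullet> h))) (at y)"
    by (auto intro!: derivative_eq_intros simp: inner_commute divide_inverse algebra_simps)
  from has_derivative_compose[OF this smooth_step_deriv[unfolded has_field_derivative_def]]
  show ?thesis
    unfolding cutoff_def[abs_def] cutoff_weight_def power2_norm_eq_inner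
    by (simp add: mult_ac)
qed

lemma continuous_cutoff_weight: "continuous_on S (cutoff_weight p R)"
  unfolding cutoff_weight_def divide_inverse by (intro continuous_intros)

lemma cutoff_inside:
  assumes "R > 0" "norm (y - p) \<le> R"
  shows "cutoff p R y = 0" "cutoff_weight p R y = 0"
proof -
  have "(norm (y - p))\<^sup>2 / R\<^sup>2 \<le> 1" using assms by (simp add: power_mono)
  then show "cutoff p R y = 0" "cutoff_weight p R y = 0"
    by (simp_all add: cutoff_def cutoff_weight_def smooth_step_simps)
qed

lemma cutoff_outside:
  assumes "R > 0" "norm (y - p) \<ge> 2 * R"
  shows "cutoff p R y = 1" "cutoff_weight p R y = 0"
proof -
  have "(2 * R)\<^sup>2 \<le> (norm (y - p))\<^sup>2" using assms by (intro power_mono) auto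
  then have "(norm (y - p))\<^sup>2 / R\<^sup>2 \<ge> 4" using assms by (simp add: power_mult_distrib field_simps)
  then show "cutoff p R y = 1" "cutoff_weight p R y = 0"
    by (simp_all add: cutoff_def cutoff_weight_def smooth_step_simps)
qed

lemma cutoff_bounds: "0 \<le> cutoff p R y" "cutoff p R y \<le> 1" "0 \<le> cutoff_weight p R y"
  using smooth_step_bounds by (auto simp: cutoff_def cutoff_weight_def)

text \<open>The gradient \<open>u'\<close> is carried along because the Wronskian needs its values,
  while the second derivatives stay hidden. Continuity is asked of the pure second derivatives,
  which are the ones in the divergence of the Wronskian.\<close>

definition helmholtz :: "real \<Rightarrow> 'a::euclidean_space set \<Rightarrow> ('a \<Rightarrow> complex) \<Rightarrow> ('a \<Rightarrow> 'a \<Rightarrow> complex) \<Rightarrow> bool" where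
  "helmholtz \<kappa> \<Omega> u u' \<longleftrightarrow>
    (\<exists>u''. (\<forall>x\<in>\<Omega>. (u has_derivative u' x) (at x) \<and>
        (\<forall>b\<in>Basis. ((\<lambda>y. u' y b) has_derivative u'' b x) (at x)) \<and>
        (\<Sum>b\<in>Basis. u'' b x b) = - of_real (\<kappa>\<^sup>2) * u x) \<and>
      (\<forall>b\<in>Basis. continuous_on \<Omega> (\<lambda>x. u'' b x b)))"

text \<open>The vector field \<open>v \<nabla>u - u \<nabla>v\<close> of Green's second identity,
  paired with a direction \<open>h\<close>. It is divergence free when both functions solve the
  equation for the same \<open>\<kappa>\<close>.\<close>

definition wronskian ::
  "('a \<Rightarrow> complex) \<Rightarrow> ('a \<Rightarrow> 'a \<Rightarrow> complex) \<Rightarrow> ('a \<Rightarrow> complex) \<Rightarrow> ('a \<Rightarrow> 'a \<Rightarrow> complex) \<Rightarrow> 'a \<Rightarrow> 'a \<Rightarrow> complex" where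
  "wronskian u u' v v' y h = v y * u' y h - u y * v' y h"

lemma helmholtz_derivative: "helmholtz \<kappa> \<Omega> u u' \<Longrightarrow> x \<in> \<Omega> \<Longrightarrow> (u has_derivative u' x) (at x)"
  by (auto simp: helmholtz_def)

lemma helmholtz_linear: "helmholtz \<kappa> \<Omega> u u' \<Longrightarrow> x \<in> \<Omega> \<Longrightarrow> linear (u' x)"
  using helmholtz_derivative has_derivative_linear by blast

lemma helmholtz_continuous: "helmholtz \<kappa> \<Omega> u u' \<Longrightarrow> continuous_on \<Omega> u"
  by (intro continuous_at_imp_continuous_on ballI has_derivative_continuous[OF helmholtz_derivative])

lemma helmholtz_continuous_deriv_Basis:
  assumes "helmholtz \<kappa> \<Omega> u u'" "b \<in> Basis"
  shows "continuous_on \<Omega> (\<lambda>x. u' x b)"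
proof (intro continuous_at_imp_continuous_on ballI)
  fix x assume "x \<in> \<Omega>"
  with assms obtain D where "((\<lambda>y. u' y b) has_derivative D) (at x)"
    unfolding helmholtz_def by blast
  then show "isCont (\<lambda>x. u' x b) x" by (rule has_derivative_continuous)
qed

lemma linear_Basis_expansion:
  fixes f :: "'a::euclidean_space \<Rightarrow> 'b::real_vector"
  assumes "linear f"
  shows "(\<Sum>b\<in>Basis. (h \<bullet> b) *\<^sub>R f b) = f h"
proof -
  have "f h = f (\<Sum>b\<in>Basis. (h \<bullet> b) *\<^sub>R b)" by (simp add: euclidean_representation)
  also have "\<dots> = (\<Sum>b\<in>Basis. (h \<bullet> b) *\<^sub>R f b)"
    using assms by (simp add: linear_sum linear_scale)
  finally show ?thesis by simp
qed

lemma helmholtz_continuous_deriv: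
  assumes "helmholtz \<kappa> \<Omega> u u'" "continuous_on S p" "continuous_on S h" "\<And>s. s \<in> S \<Longrightarrow> p s \<in> \<Omega>"
  shows "continuous_on S (\<lambda>s. u' (p s) (h s))"
proof -
  have "continuous_on S (\<lambda>s. \<Sum>b\<in>Basis. (h s \<bullet> b) *\<^sub>R u' (p s) b)"
    using assms
    by (intro continuous_intros continuous_on_compose2[OF helmholtz_continuous_deriv_Basis[OF assms(1)] assms(2)]) auto
  then show ?thesis
    by (rule continuous_on_eq) (use linear_Basis_expansion[OF helmholtz_linear] assms in blast)
qed

lemma helmholtz_subset: "helmholtz \<kappa> \<Omega> u u' \<Longrightarrow> \<Omega>' \<subseteq> \<Omega> \<Longrightarrow> helmholtz \<kappa> \<Omega>' u u'"
  unfolding helmholtz_def by (elim exE, rule exI) (auto intro: continuous_on_subset)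

lemma helmholtz_cnj:
  assumes "helmholtz \<kappa> \<Omega> u u'"
  shows "helmholtz \<kappa> \<Omega> (\<lambda>x. cnj (u x)) (\<lambda>x h. cnj (u' x h))"
proof -
  obtain u'' where u'': "\<And>x. x \<in> \<Omega> \<Longrightarrow> (u has_derivative u' x) (at x)"
      "\<And>x b. x \<in> \<Omega> \<Longrightarrow> b \<in> Basis \<Longrightarrow> ((\<lambda>y. u' y b) has_derivative u'' b x) (at x)"
      "\<And>x. x \<in> \<Omega> \<Longrightarrow> (\<Sum>b\<in>Basis. u'' b x b) = - of_real (\<kappa>\<^sup>2) * u x"
      "\<And>b. b \<in> Basis \<Longrightarrow> continuous_on \<Omega> (\<lambda>x. u'' b x b)"
    using assms unfolding helmholtz_def by blast
  have "(\<Sum>b\<in>Basis. cnj (u'' b x b)) = - of_real (\<kappa>\<^sup>2) * cnj (u x)" if "x \<in> \<Omega>" for x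
    using arg_cong[OF u''(3)[OF that], of cnj] by simp
  then show ?thesis
    unfolding helmholtz_def
    by (intro exI[of _ "\<lambda>b x h. cnj (u'' b x h)"])
       (auto intro!: has_derivative_cnj continuous_on_cnj u'')
qed

lemma helmholtz_diff:
  assumes "helmholtz \<kappa> \<Omega> u u'" "helmholtz \<kappa> \<Omega> v v'"
  shows "helmholtz \<kappa> \<Omega> (\<lambda>x. u x - v x) (\<lambda>x h. u' x h - v' x h)"
proof -
  obtain u'' where u'': "\<And>x. x \<in> \<Omega> \<Longrightarrow> (u has_derivative u' x) (at x)"
      "\<And>x b. x \<in> \<Omega> \<Longrightarrow> b \<in> Basis \<Longrightarrow> ((\<lambda>y. u' y b) has_derivative u'' b x) (at x)"
      "\<And>x. x \<in> \<Omega> \<Longrightarrow> (\<Sum>b\<in>Basis. u'' b x b) = - of_real (\<kappa>\<^sup>2) * u x"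
      "\<And>b. b \<in> Basis \<Longrightarrow> continuous_on \<Omega> (\<lambda>x. u'' b x b)"
    using assms(1) unfolding helmholtz_def by blast
  obtain v'' where v'': "\<And>x. x \<in> \<Omega> \<Longrightarrow> (v has_derivative v' x) (at x)"
      "\<And>x b. x \<in> \<Omega> \<Longrightarrow> b \<in> Basis \<Longrightarrow> ((\<lambda>y. v' y b) has_derivative v'' b x) (at x)"
      "\<And>x. x \<in> \<Omega> \<Longrightarrow> (\<Sum>b\<in>Basis. v'' b x b) = - of_real (\<kappa>\<^sup>2) * v x"
      "\<And>b. b \<in> Basis \<Longrightarrow> continuous_on \<Omega> (\<lambda>x. v'' b x b)"
    using assms(2) unfolding helmholtz_def by blast
  show ?thesis
    unfolding helmholtz_def
    by (intro exI[of _ "\<lambda>b x h. u'' b x h - v'' b x h"])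
       (auto intro!: has_derivative_diff continuous_on_diff u'' v'' simp: sum_subtractf u'' v'' algebra_simps)
qed

lemma wronskian_linear:
  assumes "helmholtz \<kappa> \<Omega> u u'" "helmholtz \<kappa> \<Omega> v v'" "y \<in> \<Omega>"
  shows "linear (wronskian u u' v v' y)"
  using helmholtz_linear[OF assms(1,3)] helmholtz_linear[OF assms(2,3)]
  unfolding wronskian_def[abs_def]
  by (auto intro!: linearI simp: linear_add linear_scale algebra_simps scaleR_conv_of_real)

lemma wronskian_continuous:
  assumes "helmholtz \<kappa> \<Omega> u u'" "helmholtz \<kappa> \<Omega> v v'" "continuous_on S h" "S \<subseteq> \<Omega>"
  shows "continuous_on S (\<lambda>y. wronskian u u' v v' y (h y))"
  unfolding wronskian_def using assms
  by (intro continuous_intros helmholtz_continuous_deriv[of \<kappa> \<Omega>]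
      continuous_on_subset[OF helmholtz_continuous]) auto

lemma gradient_zero_off_support:
  fixes \<phi> :: "'a::real_normed_vector \<Rightarrow> real"
  assumes "(\<phi> has_derivative \<phi>' x) (at x)" "compact K" "\<And>x. x \<notin> K \<Longrightarrow> \<phi> x = 0" "x \<notin> K"
  shows "\<phi>' x h = 0"
  using has_derivative_unique[OF assms(1) has_derivative_outside_support[OF compact_imp_closed[OF assms(2)] assms(3,4)]]
  by simp

text \<open>The gradient of a cutoff is radial, so the sum over coordinates in Green's identity
  collapses to the Wronskian in the direction \<open>y - p\<close>.\<close>

lemma cutoff_pairing:
  assumes "linear W"
  shows "(\<Sum>b\<in>Basis. (w * ((y - p) \<bullet> b)) *\<^sub>R W b) = (w::real) *\<^sub>R W (y - p)"
  using linear_Basis_expansion[OF assms, of "y - p"]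
  by (simp add: scaleR_sum_right[symmetric] flip: scaleR_scaleR)

text \<open>Green's second identity; with a cutoff in place of the boundary it needs no surface integrals.\<close>

lemma green:
  fixes u v :: "'a::euclidean_space \<Rightarrow> complex"
  assumes "open \<Omega>" and u: "helmholtz \<kappa> \<Omega> u u'" and v: "helmholtz \<kappa> \<Omega> v v'"
    and \<phi>: "\<And>x. (\<phi> has_derivative \<phi>' x) (at x)" "\<And>b. b \<in> Basis \<Longrightarrow> continuous_on UNIV (\<lambda>x. \<phi>' x b)"
    and K: "compact K" "K \<subseteq> \<Omega>" "\<And>x. x \<notin> K \<Longrightarrow> \<phi> x = (0::real)"
  shows "(\<integral>x. (\<Sum>b\<in>Basis. \<phi>' x b *\<^sub>R wronskian u u' v v' x b) \<partial>lborel) = 0"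
proof -
  obtain u'' where u'': "\<And>x. x \<in> \<Omega> \<Longrightarrow> (u has_derivative u' x) (at x)"
      "\<And>x b. x \<in> \<Omega> \<Longrightarrow> b \<in> Basis \<Longrightarrow> ((\<lambda>y. u' y b) has_derivative u'' b x) (at x)"
      "\<And>x. x \<in> \<Omega> \<Longrightarrow> (\<Sum>b\<in>Basis. u'' b x b) = - of_real (\<kappa>\<^sup>2) * u x"
      "\<And>b. b \<in> Basis \<Longrightarrow> continuous_on \<Omega> (\<lambda>x. u'' b x b)"
    using u unfolding helmholtz_def by blast
  obtain v'' where v'': "\<And>x. x \<in> \<Omega> \<Longrightarrow> (v has_derivative v' x) (at x)"
      "\<And>x b. x \<in> \<Omega> \<Longrightarrow> b \<in> Basis \<Longrightarrow> ((\<lambda>y. v' y b) has_derivative v'' b x) (at x)"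
      "\<And>x. x \<in> \<Omega> \<Longrightarrow> (\<Sum>b\<in>Basis. v'' b x b) = - of_real (\<kappa>\<^sup>2) * v x"
      "\<And>b. b \<in> Basis \<Longrightarrow> continuous_on \<Omega> (\<lambda>x. v'' b x b)"
    using v unfolding helmholtz_def by blast
  have \<phi>'0: "\<phi>' x h = 0" if "x \<notin> K" for x h
    using gradient_zero_off_support[of \<phi> \<phi>' x K h] \<phi>(1) K(1,3) that by blast
  define W where "W = wronskian u u' v v'"
  define W' where "W' b x h = v' x h * u' x b + v x * u'' b x h - (u' x h * v' x b + u x * v'' b x h)" for b x h
  define g where "g b x = \<phi> x *\<^sub>R W x b" for b x
  \<comment> \<open>Off \<open>\<Omega>\<close> the derivatives of \<open>u\<close> and
    \<open>v\<close> carry no information, so the default 0 is put there. It is the true derivative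
    because \<open>\<phi>\<close> vanishes near such points.\<close>
  define g' where "g' b x h = (if x \<in> \<Omega> then \<phi> x *\<^sub>R W' b x h + \<phi>' x h *\<^sub>R W x b else 0)" for b x h
  have g0: "g b x = 0" if "x \<notin> K" for b x using K(3)[OF that] by (simp add: g_def)
  have g'0: "g' b x h = 0" if "x \<notin> K" for b x h using K(3)[OF that] \<phi>'0[OF that] by (simp add: g'_def)
  have der: "(g b has_derivative g' b x) (at x)" if b: "b \<in> Basis" for b x
  proof (cases "x \<in> \<Omega>")
    case True
    have "((\<lambda>x. W x b) has_derivative W' b x) (at x)"
      unfolding W_def wronskian_def W'_def
      using has_derivative_diff[OF
          has_derivative_mult[OF v''(1)[OF True] u''(2)[OF True b]]
          has_derivative_mult[OF u''(1)[OF True] v''(2)[OF True b]]]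
      by (simp add: algebra_simps)
    from has_derivative_scaleR[OF \<phi>(1) this]
    show ?thesis using True unfolding g_def g'_def by simp
  next
    case False
    then have "x \<notin> K" using K by auto
    then have "g' b x = (\<lambda>h. 0)" using g'0 by blast
    moreover have "(g b has_derivative (\<lambda>h. 0)) (at x)"
      by (rule has_derivative_outside_support[OF compact_imp_closed[OF K(1)] g0 \<open>x \<notin> K\<close>])
    ultimately show ?thesis by simp
  qed
  have cont\<Omega>: "continuous_on \<Omega> (\<lambda>x. g' b x b)" if b: "b \<in> Basis" for b
  proof -
    have "continuous_on \<Omega> (\<lambda>x. \<phi> x *\<^sub>R W' b x b + \<phi>' x b *\<^sub>R W x b)"
      unfolding W_def W'_def
      using \<phi>(2)[OF b] continuous_at_imp_continuous_on[of UNIV \<phi>] has_derivative_continuous[OF \<phi>(1)]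
      by (intro continuous_intros wronskian_continuous[OF u v] helmholtz_continuous[OF u]
          helmholtz_continuous[OF v] u''(4) v''(4) b
          helmholtz_continuous_deriv_Basis[OF u b] helmholtz_continuous_deriv_Basis[OF v b])
         (auto elim: continuous_on_subset)
    then show ?thesis by (rule continuous_on_eq) (simp add: g'_def)
  qed
  have cont: "continuous_on UNIV (\<lambda>x. g' b x b)" if "b \<in> Basis" for b
    by (rule continuous_on_UNIV_by_support[OF cont\<Omega>[OF that] \<open>open \<Omega>\<close> compact_imp_closed[OF K(1)] K(2) g'0])
  have int: "integrable lborel (\<lambda>x. g' b x b)" if "b \<in> Basis" for b
    by (rule integrable_compact_support[OF cont\<Omega>[OF that] K(1) K(2) g'0])
  have "0 = (\<Sum>b\<in>Basis. \<integral>x. g' b x b \<partial>lborel)"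
    using integral_derivative_compact_support[OF der cont K(1) g0] by simp
  also have "\<dots> = (\<integral>x. (\<Sum>b\<in>Basis. g' b x b) \<partial>lborel)"
    using int by (simp add: Bochner_Integration.integral_sum)
  also have "(\<lambda>x. \<Sum>b\<in>Basis. g' b x b) = (\<lambda>x. \<Sum>b\<in>Basis. \<phi>' x b *\<^sub>R W x b)"
  proof (rule ext)
    fix x
    show "(\<Sum>b\<in>Basis. g' b x b) = (\<Sum>b\<in>Basis. \<phi>' x b *\<^sub>R W x b)"
    proof (cases "x \<in> \<Omega>")
      case True
      \<comment> \<open>The products of first derivatives cancel, and the two Laplacian terms cancel
        because \<open>u\<close> and \<open>v\<close> belong to the same
        \<open>\<kappa>\<close>.\<close>
      have "(\<Sum>b\<in>Basis. W' b x b) = v x * (\<Sum>b\<in>Basis. u'' b x b) - u x * (\<Sum>b\<in>Basis. v'' b x b)"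
        unfolding W'_def by (simp add: sum_subtractf sum_distrib_left sum.distrib algebra_simps)
      also have "\<dots> = 0" unfolding u''(3)[OF True] v''(3)[OF True] by simp
      finally have "(\<Sum>b\<in>Basis. \<phi> x *\<^sub>R W' b x b) = 0" by (simp flip: scaleR_sum_right)
      then show ?thesis using True by (simp add: g'_def sum.distrib)
    next
      case False
      then have "x \<notin> K" using K by auto
      then show ?thesis using g'0 \<phi>'0 by simp
    qed
  qed
  finally show ?thesis by (simp add: W_def)
qed

section \<open>Representation by the fundamental solution\<close>

definition wave0 :: "real \<Rightarrow> complex \<Rightarrow> complex" where
  "wave0 \<kappa> z = exp (\<i> * of_real \<kappa> * z) / z"

text \<open>\<open>wave1\<close> is \<open>wave0' z / z\<close>, so that the gradient of \<open>wave0 \<bar>x\<bar>\<close> is \<open>wave1 \<bar>x\<bar> * x\<close>.\<close>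

definition wave1 :: "real \<Rightarrow> complex \<Rightarrow> complex" where
  "wave1 \<kappa> z = exp (\<i> * of_real \<kappa> * z) * (\<i> * of_real \<kappa> / z\<^sup>2 - 1 / z ^ 3)"

definition fund :: "real \<Rightarrow> real ^ 3 \<Rightarrow> real ^ 3 \<Rightarrow> complex" where
  "fund \<kappa> x y = wave0 \<kappa> (of_real (norm (y - x)))"

definition fund_deriv :: "real \<Rightarrow> real ^ 3 \<Rightarrow> real ^ 3 \<Rightarrow> real ^ 3 \<Rightarrow> complex" where
  "fund_deriv \<kappa> x y h = wave1 \<kappa> (of_real (norm (y - x))) * of_real ((y - x) \<bullet> h)"

lemma wave0_deriv: "z \<noteq> 0 \<Longrightarrow> (wave0 \<kappa> has_field_derivative z * wave1 \<kappa> z) (at z)"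
  unfolding wave0_def[abs_def] wave1_def
  by (auto intro!: derivative_eq_intros simp: field_simps power2_eq_square power3_eq_cube)

lemma wave1_deriv:
  "z \<noteq> 0 \<Longrightarrow> (wave1 \<kappa> has_field_derivative
      exp (\<i> * of_real \<kappa> * z) * (- of_real (\<kappa>\<^sup>2) / z\<^sup>2 - 3 * \<i> * of_real \<kappa> / z ^ 3 + 3 / z ^ 4)) (at z)"
proof -
  assume z: "z \<noteq> 0"
  define c where "c = \<i> * complex_of_real \<kappa>"
  define w where "w = inverse z"
  have c3: "3 * \<i> * complex_of_real \<kappa> = 3 * c" by (simp add: c_def)
  have cc: "c * c = - of_real (\<kappa>\<^sup>2)" by (simp add: c_def power2_eq_square mult_ac)
  have 1: "((\<lambda>z. exp (c * z)) has_field_derivative c * exp (c * z)) (at z)"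
    by (auto intro!: derivative_eq_intros)
  have 2: "((\<lambda>z. c * inverse z ^ 2 - inverse z ^ 3) has_field_derivative - 2 * c * w ^ 3 + 3 * w ^ 4) (at z)"
    using z by (auto intro!: derivative_eq_intros simp: w_def power2_eq_square power3_eq_cube power4_eq_xxxx)
  have "exp (c * z) * (- of_real (\<kappa>\<^sup>2) / z\<^sup>2 - 3 * c / z ^ 3 + 3 / z ^ 4)
      = c * exp (c * z) * (c * w ^ 2 - w ^ 3) + (- 2 * c * w ^ 3 + 3 * w ^ 4) * exp (c * z)"
    unfolding divide_inverse power_inverse[symmetric] w_def[symmetric] cc[symmetric] by (simp add: algebra_simps power2_eq_square)
  with DERIV_mult[OF 1 2] show ?thesis
    unfolding wave1_def[abs_def] c3 c_def[symmetric]
    by (simp add: w_def divide_inverse power_inverse mult_ac)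
qed

lemma norm_diff_has_derivative:
  fixes x y :: "'a::real_inner"
  assumes "y \<noteq> x"
  shows "((\<lambda>y. norm (y - x)) has_derivative (\<lambda>h. ((y - x) \<bullet> h) / norm (y - x))) (at y)"
proof -
  have "((\<lambda>y. y - x) has_derivative (\<lambda>h. h)) (at y)" by (auto intro!: derivative_eq_intros)
  from has_derivative_compose[OF this has_derivative_norm[of "y - x"]] assms
  show ?thesis by (simp add: sgn_div_norm inner_commute divide_inverse mult_ac)
qed

lemma radial_has_derivative:
  fixes x y :: "'a::real_inner"
  assumes "y \<noteq> x" "(f has_field_derivative D) (at (of_real (norm (y - x))))"
  shows "((\<lambda>y. f (of_real (norm (y - x)))) has_derivative
      (\<lambda>h. of_real (((y - x) \<bullet> h) / norm (y - x)) * D)) (at y)"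
proof -
  have "((\<lambda>t. f (of_real t)) has_vector_derivative D) (at (norm (y - x)))"
    by (rule has_vector_derivative_real_field[OF assms(2)])
  from has_derivative_compose[OF norm_diff_has_derivative[OF assms(1)] this[unfolded has_vector_derivative_def]]
  show ?thesis by (simp add: scaleR_conv_of_real)
qed

lemma helmholtz_fund: "helmholtz \<kappa> (- {x}) (fund \<kappa> x) (fund_deriv \<kappa> x)"
proof -
  define w2 where "w2 z = exp (\<i> * of_real \<kappa> * z) * (- of_real (\<kappa>\<^sup>2) / z\<^sup>2 - 3 * \<i> * of_real \<kappa> / z ^ 3 + 3 / z ^ 4)" for z
  define D where "D b y h = of_real (((y - x) \<bullet> h) / norm (y - x)) * w2 (of_real (norm (y - x))) * of_real ((y - x) \<bullet> b)
      + wave1 \<kappa> (of_real (norm (y - x))) * of_real (h \<bullet> b)" for b y h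
  have 1: "(fund \<kappa> x has_derivative fund_deriv \<kappa> x y) (at y)" if "y \<noteq> x" for y
  proof -
    have "of_real (norm (y - x)) \<noteq> (0::complex)" using that by simp
    from radial_has_derivative[OF that wave0_deriv[OF this]]
    show ?thesis using that unfolding fund_def[abs_def] fund_deriv_def[abs_def]
      by (simp add: field_simps)
  qed
  have 2: "((\<lambda>y. fund_deriv \<kappa> x y b) has_derivative D b y) (at y)" if "y \<noteq> x" for y b
  proof -
    have "of_real (norm (y - x)) \<noteq> (0::complex)" using that by simp
    from wave1_deriv[OF this] have "(wave1 \<kappa> has_field_derivative w2 (of_real (norm (y - x)))) (at (of_real (norm (y - x))))"
      by (simp add: w2_def)
    note radial_has_derivative[OF that this]
    moreover have "((\<lambda>y. complex_of_real ((y - x) \<bullet> b)) has_derivative (\<lambda>h. of_real (h \<bullet> b))) (at y)"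
      by (auto intro!: derivative_eq_intros)
    ultimately show ?thesis unfolding fund_deriv_def
      by (rule has_derivative_eq_rhs[OF has_derivative_mult]) (intro ext, simp only: D_def add.commute)
  qed
  have 3: "(\<Sum>b\<in>Basis. D b y b) = - of_real (\<kappa>\<^sup>2) * fund \<kappa> x y" if "y \<noteq> x" for y
  proof -
    define r where "r = norm (y - x)"
    have r: "r > 0" using that by (simp add: r_def)
    \<comment> \<open>The gradient field is \<open>wave1\<close> times \<open>y - x\<close>, so its
      divergence is \<open>r\<close> times the derivative \<open>w2\<close> of \<open>wave1\<close>,
      plus one copy of \<open>wave1\<close> for each of the three coordinates.\<close>
    have "(\<Sum>b\<in>Basis. D b y b) = (\<Sum>b\<in>Basis. of_real (((y - x) \<bullet> b) * ((y - x) \<bullet> b)) * (w2 (of_real r) / of_real r)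
        + wave1 \<kappa> (of_real r))"
      unfolding D_def r_def by (rule sum.cong) (auto simp: mult_ac)
    also have "\<dots> = of_real (\<Sum>b\<in>Basis. ((y - x) \<bullet> b) * ((y - x) \<bullet> b)) * (w2 (of_real r) / of_real r) + 3 * wave1 \<kappa> (of_real r)"
      by (simp add: sum.distrib sum_distrib_right sum_divide_distrib)
    also have "(\<Sum>b\<in>Basis. ((y - x) \<bullet> b) * ((y - x) \<bullet> b)) = r\<^sup>2"
      by (simp add: r_def power2_norm_eq_inner flip: euclidean_inner)
    also have "of_real (r\<^sup>2) * (w2 (of_real r) / of_real r) + 3 * wave1 \<kappa> (of_real r) = - of_real (\<kappa>\<^sup>2) * wave0 \<kappa> (of_real r)"
    proof -
      define \<rho> where "\<rho> = complex_of_real r"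
      define w where "w = inverse \<rho>"
      define c where "c = \<i> * complex_of_real \<kappa>"
      define E where "E = exp (c * \<rho>)"
      have c3: "3 * \<i> * complex_of_real \<kappa> = 3 * c" by (simp add: c_def)
      have \<rho>: "\<rho> * w = 1" using r by (simp add: w_def \<rho>_def)
      have red: "\<rho>\<^sup>2 * w ^ 3 = w" "\<rho>\<^sup>2 * w ^ 4 = w\<^sup>2" "\<rho>\<^sup>2 * w ^ 5 = w ^ 3"
      proof -
        have "\<rho>\<^sup>2 * w ^ 3 = (\<rho> * w)\<^sup>2 * w" "\<rho>\<^sup>2 * w ^ 4 = (\<rho> * w)\<^sup>2 * w\<^sup>2"
          "\<rho>\<^sup>2 * w ^ 5 = (\<rho> * w)\<^sup>2 * w ^ 3"
          by (simp_all add: eval_nat_numeral mult_ac)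
        then show "\<rho>\<^sup>2 * w ^ 3 = w" "\<rho>\<^sup>2 * w ^ 4 = w\<^sup>2" "\<rho>\<^sup>2 * w ^ 5 = w ^ 3"
          unfolding \<rho> by simp_all
      qed
      have "\<rho>\<^sup>2 * (E * (- of_real (\<kappa>\<^sup>2) * w\<^sup>2 - 3 * c * w ^ 3 + 3 * w ^ 4) * w)
          = E * (- of_real (\<kappa>\<^sup>2) * (\<rho>\<^sup>2 * w ^ 3) - 3 * c * (\<rho>\<^sup>2 * w ^ 4) + 3 * (\<rho>\<^sup>2 * w ^ 5))"
        by (simp add: algebra_simps eval_nat_numeral)
      also have "\<dots> + 3 * (E * (c * w\<^sup>2 - w ^ 3)) = - of_real (\<kappa>\<^sup>2) * (E * w)"
        unfolding red by (simp add: algebra_simps)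
      finally show ?thesis
        unfolding w2_def wave1_def wave0_def c3 c_def[symmetric] \<rho>_def[symmetric] E_def[symmetric] of_real_power
        by (simp add: w_def divide_inverse power_inverse)
    qed
    finally show ?thesis by (simp add: fund_def r_def)
  qed
  have 4: "continuous_on (- {x}) (\<lambda>y. D b y b)" for b
    unfolding D_def w2_def wave1_def
    by (intro continuous_intros) auto
  show ?thesis unfolding helmholtz_def
    by (intro exI[of _ D]) (use 1 2 3 4 in auto)
qed

text \<open>The value is \<open>4 \<pi>\<close>, but only \<open>rep_const \<noteq> 0\<close> matters.\<close>

definition rep_const :: real where
  "rep_const = (\<integral>z. 2 * step_deriv ((norm (z :: real^3))\<^sup>2) / norm z \<partial>lborel)"

lemma continuous_rep_kernel: "continuous_on UNIV (\<lambda>z::real^3. 2 * step_deriv ((norm z)\<^sup>2) / norm z)"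
proof (rule continuous_on_UNIV_by_support[where S="- {0}" and K="- ball 0 1"])
  show "continuous_on (- {0}) (\<lambda>z::real^3. 2 * step_deriv ((norm z)\<^sup>2) / norm z)"
    by (intro continuous_intros) auto
qed (auto simp: smooth_step_simps power_le_one)

lemma rep_kernel_outside: "z \<notin> cball (0::real^3) 2 \<Longrightarrow> step_deriv ((norm z)\<^sup>2) = 0"
proof -
  assume "z \<notin> cball 0 2"
  then have "2\<^sup>2 \<le> (norm z)\<^sup>2" by (intro power_mono) auto
  then show ?thesis by (intro smooth_step_simps) simp
qed

lemma integrable_rep_kernel: "integrable lborel (\<lambda>z::real^3. 2 * step_deriv ((norm z)\<^sup>2) / norm z)"
  by (rule integrable_compact_support[OF continuous_rep_kernel compact_cball[of 0 2]]) (auto simp: rep_kernel_outside)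

text \<open>The integrand is continuous and nonnegative, so a zero integral would make the open set
  where it is positive a null set and hence empty. The radius 3/2 is strictly inside the shell where
  \<open>step_deriv\<close> is positive.\<close>

lemma rep_const_nonzero: "rep_const \<noteq> 0"
proof
  let ?f = "\<lambda>z::real^3. 2 * step_deriv ((norm z)\<^sup>2) / norm z"
  assume "rep_const = 0"
  then have "AE z in lborel. ?f z = 0"
    using integrable_rep_kernel integral_nonneg_eq_0_iff_AE[of lborel ?f] smooth_step_bounds by (auto simp: rep_const_def)
  then have "emeasure lborel {z. ?f z \<noteq> 0} = 0"
    using AE_iff_measurable[of "{z. ?f z \<noteq> 0}" lborel "\<lambda>z. ?f z = 0"]
      open_Collect_neq[OF continuous_rep_kernel continuous_on_const[of UNIV 0]] by auto
  then have "{z. ?f z \<noteq> 0} \<in> null_sets lborel"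
    using open_Collect_neq[OF continuous_rep_kernel continuous_on_const[of UNIV 0]] by auto
  then have "negligible {z. ?f z \<noteq> 0}"
    using null_sets_completionI negligible_iff_null_sets by blast
  then have "{z. ?f z \<noteq> 0} = {}"
    using open_not_negligible open_Collect_neq[OF continuous_rep_kernel continuous_on_const[of UNIV 0]] by blast
  moreover have "?f ((3/2) *\<^sub>R axis 1 1) \<noteq> 0"
    using step_deriv_pos[of "(3/2)\<^sup>2"] by (simp add: power2_eq_square norm_axis_1)
  ultimately show False by blast
qed

text \<open>Green's identity for \<open>\<phi> - 1\<close> plus a cutoff of radius \<open>d\<close> around the pole \<open>x\<close> shows that the integral around
  the pole does not depend on \<open>d\<close>; after rescaling, its integrand extends continuously to \<open>d = 0\<close>.\<close>

lemma fund_representation: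
  assumes "open \<Omega>" and u: "helmholtz \<kappa> \<Omega> u u'" and x: "x \<in> \<Omega>"
    and \<phi>: "\<And>y. (\<phi> has_derivative \<phi>' y) (at y)" "\<And>b. b \<in> Basis \<Longrightarrow> continuous_on UNIV (\<lambda>y. \<phi>' y b)"
    and K: "compact K" "K \<subseteq> \<Omega>" "\<And>y. y \<notin> K \<Longrightarrow> \<phi> y = (0::real)"
    and r: "r > 0" "\<And>y. y \<in> ball x r \<Longrightarrow> \<phi> y = 1"
  shows "(\<integral>y. (\<Sum>b\<in>Basis. \<phi>' y b *\<^sub>R wronskian u u' (fund \<kappa> x) (fund_deriv \<kappa> x) y b) \<partial>lborel)
    = - of_real rep_const * u x"
proof -
  have sc: "t *\<^sub>R w = of_real t * w" for t and w :: complex by (rule scaleR_conv_of_real)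
  define W where "W = wronskian u u' (fund \<kappa> x) (fund_deriv \<kappa> x)"
  define L where "L = (\<integral>y. (\<Sum>b\<in>Basis. \<phi>' y b *\<^sub>R W y b) \<partial>lborel)"
  define \<Omega>' where "\<Omega>' = \<Omega> - {x}"
  have open': "open \<Omega>'" using \<open>open \<Omega>\<close> by (auto simp: \<Omega>'_def)
  have u1: "helmholtz \<kappa> \<Omega>' u u'" using u by (rule helmholtz_subset) (auto simp: \<Omega>'_def)
  have v1: "helmholtz \<kappa> \<Omega>' (fund \<kappa> x) (fund_deriv \<kappa> x)"
    using helmholtz_fund by (rule helmholtz_subset) (auto simp: \<Omega>'_def)
  have \<phi>'0: "\<phi>' y h = 0" if "y \<notin> K" for y h
    using gradient_zero_off_support[of \<phi> \<phi>' y K h] \<phi>(1) K(1,3) that by blast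
  have \<phi>'1: "\<phi>' y h = 0" if "y \<in> ball x r" for y h
  proof -
    have "(\<phi> has_derivative (\<lambda>h. 0)) (at y)"
      by (rule has_derivative_transform_within_open[of "\<lambda>_. 1" _ _ _ "ball x r"]) (use that r in auto)
    then have "\<phi>' y = (\<lambda>h. 0)" using has_derivative_unique \<phi>(1) by blast
    then show ?thesis by simp
  qed
  obtain e where e: "e > 0" "cball x e \<subseteq> \<Omega>" using \<open>open \<Omega>\<close> x open_contains_cball by blast
  \<comment> \<open>For radii \<open>d\<close> up to \<open>d0\<close> the shell between
    \<open>d\<close> and \<open>2 * d\<close> stays in \<open>\<Omega>\<close> and in the ball where
    \<open>\<phi>\<close> is 1.\<close>
  define d0 where "d0 = min e r / 3"
  have d0: "d0 > 0" "2 * d0 < r" "2 * d0 \<le> e" using e r by (auto simp: d0_def)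
  have int1: "integrable lborel (\<lambda>y. \<Sum>b\<in>Basis. \<phi>' y b *\<^sub>R W y b)"
  proof (rule integrable_compact_support[of \<Omega>' _ "K - ball x r"])
    show "continuous_on \<Omega>' (\<lambda>y. \<Sum>b\<in>Basis. \<phi>' y b *\<^sub>R W y b)"
      unfolding W_def
      by (intro continuous_intros wronskian_continuous[OF u1 v1] continuous_on_subset[OF \<phi>(2)]) auto
    show "compact (K - ball x r)" using K(1) compact_diff open_ball by blast
  qed (use K r \<phi>'0 \<phi>'1 in \<open>auto simp: \<Omega>'_def\<close>)
  have weight0: "cutoff_weight x d y = 0" if "d > 0" "d \<le> d0" "y \<notin> \<Omega>'" for d y
  proof (cases "y = x")
    case True
    then show ?thesis using cutoff_inside[of d y x] that by simp
  next
    case False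
    then have "y \<notin> cball x e" using e that by (auto simp: \<Omega>'_def)
    then show ?thesis using cutoff_outside[of d y x] that d0 by (simp add: dist_norm norm_minus_commute)
  qed
  have inner: "(\<integral>y. cutoff_weight x d y *\<^sub>R W y (y - x) \<partial>lborel) = - L" if d: "d > 0" "d \<le> d0" for d
  proof -
    have int2: "integrable lborel (\<lambda>y. cutoff_weight x d y *\<^sub>R W y (y - x))"
    proof (rule integrable_compact_support[of \<Omega>' _ "cball x (2 * d) - ball x d"])
      show "continuous_on \<Omega>' (\<lambda>y. cutoff_weight x d y *\<^sub>R W y (y - x))"
        unfolding W_def by (intro continuous_intros continuous_cutoff_weight wronskian_continuous[OF u1 v1]) auto
      show "compact (cball x (2 * d) - ball x d)" by (simp add: compact_diff)
      show "cball x (2 * d) - ball x d \<subseteq> \<Omega>'" using e d d0 by (auto simp: \<Omega>'_def subset_iff)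
      show "cutoff_weight x d y *\<^sub>R W y (y - x) = 0" if "y \<notin> cball x (2 * d) - ball x d" for y
        using that cutoff_inside[OF d(1), of y x] cutoff_outside[OF d(1), of y x]
        by (auto simp: dist_norm norm_minus_commute)
    qed
    have "(\<integral>y. (\<Sum>b\<in>Basis. (\<phi>' y b + cutoff_weight x d y * ((y - x) \<bullet> b)) *\<^sub>R W y b) \<partial>lborel) = 0"
      unfolding W_def
    proof (rule green[OF open' u1 v1, where \<phi>="\<lambda>y. \<phi> y + cutoff x d y - 1" and K="(K \<union> cball x (2 * d)) - ball x d"
          and \<phi>' = "\<lambda>y h. \<phi>' y h + cutoff_weight x d y * ((y - x) \<bullet> h)"])
      show "((\<lambda>y. \<phi> y + cutoff x d y - 1) has_derivative (\<lambda>h. \<phi>' y h + cutoff_weight x d y * ((y - x) \<bullet> h))) (at y)" for y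
        using has_derivative_diff[OF has_derivative_add[OF \<phi>(1) cutoff_has_derivative[of x d]] has_derivative_const[of 1]]
        by simp
      show "continuous_on UNIV (\<lambda>y. \<phi>' y b + cutoff_weight x d y * ((y - x) \<bullet> b))" if "b \<in> Basis" for b
        using \<phi>(2)[OF that] by (intro continuous_intros continuous_cutoff_weight)
      show "compact ((K \<union> cball x (2 * d)) - ball x d)" using K(1) by (simp add: compact_diff compact_Un)
      show "(K \<union> cball x (2 * d)) - ball x d \<subseteq> \<Omega>'" using e d d0 K by (auto simp: \<Omega>'_def subset_iff)
      show "\<phi> y + cutoff x d y - 1 = 0" if y: "y \<notin> (K \<union> cball x (2 * d)) - ball x d" for y
      proof (cases "y \<in> ball x d")
        case True
        then have "y \<in> ball x r" using d d0 by auto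
        then show ?thesis using True r cutoff_inside[OF d(1), of y x] by (simp add: dist_norm norm_minus_commute)
      next
        case False
        then show ?thesis using y K(3) cutoff_outside[OF d(1), of y x] by (simp add: dist_norm norm_minus_commute)
      qed
    qed
    also have "(\<lambda>y. \<Sum>b\<in>Basis. (\<phi>' y b + cutoff_weight x d y * ((y - x) \<bullet> b)) *\<^sub>R W y b)
        = (\<lambda>y. (\<Sum>b\<in>Basis. \<phi>' y b *\<^sub>R W y b) + cutoff_weight x d y *\<^sub>R W y (y - x))"
    proof (rule ext)
      fix y
      have "(\<Sum>b\<in>Basis. (cutoff_weight x d y * ((y - x) \<bullet> b)) *\<^sub>R W y b) = cutoff_weight x d y *\<^sub>R W y (y - x)"
      proof (cases "y \<in> \<Omega>'")
        case True
        then show ?thesis unfolding W_def by (intro cutoff_pairing wronskian_linear[OF u1 v1])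
      qed (use weight0 d in auto)
      then show "(\<Sum>b\<in>Basis. (\<phi>' y b + cutoff_weight x d y * ((y - x) \<bullet> b)) *\<^sub>R W y b)
        = (\<Sum>b\<in>Basis. \<phi>' y b *\<^sub>R W y b) + cutoff_weight x d y *\<^sub>R W y (y - x)"
        by (simp add: scaleR_left_distrib sum.distrib)
    qed
    also have "(\<integral>y. (\<Sum>b\<in>Basis. \<phi>' y b *\<^sub>R W y b) + cutoff_weight x d y *\<^sub>R W y (y - x) \<partial>lborel)
        = L + (\<integral>y. cutoff_weight x d y *\<^sub>R W y (y - x) \<partial>lborel)"
      unfolding L_def using int1 int2 by (rule Bochner_Integration.integral_add)
    finally show ?thesis by (simp add: eq_neg_iff_add_eq_0 add.commute)
  qed
  define k where "k z = 2 * step_deriv ((norm z)\<^sup>2) / norm z" for z :: "real^3"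
  \<comment> \<open>With \<open>y = x + d *\<^sub>R z\<close> the volume factor
    \<open>d ^ 3\<close>, the factor \<open>1 / d\<^sup>2\<close> of the weight and the singular
    powers of the distance cancel up to \<open>1 / norm z\<close>, which goes into \<open>k\<close>.
    What remains makes sense at \<open>d = 0\<close> and equals \<open>u x\<close> there.\<close>
  define B where "B d z = exp (\<i> * of_real \<kappa> * of_real (d * norm z)) *
     (d *\<^sub>R u' (x + d *\<^sub>R z) z - u (x + d *\<^sub>R z) * (\<i> * of_real \<kappa> * of_real (d * norm z) - 1))" for d z
  have scaled: "(\<integral>z. k z *\<^sub>R B d z \<partial>lborel) = - L" if d: "d > 0" "d \<le> d0" for d
  proof -
    have "(\<integral>y. cutoff_weight x d y *\<^sub>R W y (y - x) \<partial>lborel) =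
        d ^ 3 *\<^sub>R (\<integral>z. cutoff_weight x d (x + d *\<^sub>R z) *\<^sub>R W (x + d *\<^sub>R z) (d *\<^sub>R z) \<partial>lborel)"
    proof -
      have "continuous_on UNIV (\<lambda>y. cutoff_weight x d y *\<^sub>R W y (y - x))"
      proof (rule continuous_on_UNIV_by_support[of \<Omega>' _ "cball x (2 * d) - ball x d"])
        show "continuous_on \<Omega>' (\<lambda>y. cutoff_weight x d y *\<^sub>R W y (y - x))"
          unfolding W_def by (intro continuous_intros continuous_cutoff_weight wronskian_continuous[OF u1 v1]) auto
        show "closed (cball x (2 * d) - ball x d)" by (simp add: closed_Diff)
        show "cball x (2 * d) - ball x d \<subseteq> \<Omega>'" using e d d0 by (auto simp: \<Omega>'_def subset_iff)
        show "cutoff_weight x d y *\<^sub>R W y (y - x) = 0" if "y \<notin> cball x (2 * d) - ball x d" for y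
          using that cutoff_inside[OF d(1), of y x] cutoff_outside[OF d(1), of y x]
          by (auto simp: dist_norm norm_minus_commute)
      qed (rule open')
      then have "(\<lambda>y. cutoff_weight x d y *\<^sub>R W y (y - x)) \<in> borel_measurable borel"
        by (rule borel_measurable_continuous_onI)
      from lborel_integral_affine[OF this d(1), of x] show ?thesis by simp
    qed
    also have "\<dots> = (\<integral>z. d ^ 3 *\<^sub>R cutoff_weight x d (x + d *\<^sub>R z) *\<^sub>R W (x + d *\<^sub>R z) (d *\<^sub>R z) \<partial>lborel)"
      by (simp only: integral_scaleR_right)
    also have "(\<lambda>z. d ^ 3 *\<^sub>R cutoff_weight x d (x + d *\<^sub>R z) *\<^sub>R W (x + d *\<^sub>R z) (d *\<^sub>R z)) = (\<lambda>z. k z *\<^sub>R B d z)"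
    proof (rule ext)
      fix z :: "real^3"
      show "d ^ 3 *\<^sub>R cutoff_weight x d (x + d *\<^sub>R z) *\<^sub>R W (x + d *\<^sub>R z) (d *\<^sub>R z) = k z *\<^sub>R B d z"
      proof (cases "step_deriv ((norm z)\<^sup>2) = 0")
        case True
        then show ?thesis using d by (simp add: k_def cutoff_weight_def power_mult_distrib)
      next
        case False
        then have z: "norm z \<le> 2" "z \<noteq> 0"
          using rep_kernel_outside[of z] by (auto simp: smooth_step_simps)
        have "norm (d *\<^sub>R z) \<le> e" using z d d0 mult_mono[of d d0 "norm z" 2] by simp
        then have "x + d *\<^sub>R z \<in> \<Omega>" using e by (auto simp: dist_norm subset_iff)
        then have lin: "u' (x + d *\<^sub>R z) (d *\<^sub>R z) = d *\<^sub>R u' (x + d *\<^sub>R z) z"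
          using helmholtz_linear[OF u] linear_scale by blast
        define E where "E = exp (\<i> * of_real \<kappa> * of_real (d * norm z))"
        define n where "n = complex_of_real (norm z)"
        define D where "D = complex_of_real d"
        have n0: "n \<noteq> 0" "D \<noteq> 0" using z d by (auto simp: n_def D_def)
        have nn: "complex_of_real (z \<bullet> z) = n\<^sup>2" by (simp add: n_def flip: power2_norm_eq_inner of_real_power)
        define U where "U = u' (x + d *\<^sub>R z) z"
        define V where "V = u (x + d *\<^sub>R z)"
        have nd: "norm (d *\<^sub>R z) = d * norm z" using d by simp
        have W: "W (x + d *\<^sub>R z) (d *\<^sub>R z) = E / (D * n) * (D * U) - V * (E * (\<i> * of_real \<kappa> / (D * n)\<^sup>2 - 1 / (D * n) ^ 3) * (D\<^sup>2 * n\<^sup>2))"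
          unfolding W_def wronskian_def lin fund_def fund_deriv_def wave0_def wave1_def add_diff_cancel_left' nd
          by (simp add: nn sc E_def n_def D_def U_def V_def power2_eq_square)
        have "d ^ 3 *\<^sub>R cutoff_weight x d (x + d *\<^sub>R z) *\<^sub>R W (x + d *\<^sub>R z) (d *\<^sub>R z)
            = of_real (2 * step_deriv ((norm z)\<^sup>2)) * (D * W (x + d *\<^sub>R z) (d *\<^sub>R z))"
          using d by (simp add: cutoff_weight_def power_mult_distrib sc D_def field_simps power2_eq_square power3_eq_cube)
        also have "D * W (x + d *\<^sub>R z) (d *\<^sub>R z) = E * (D * U - V * (\<i> * of_real \<kappa> * (D * n) - 1)) / n"
          unfolding W using n0 by (simp add: field_simps power2_eq_square power3_eq_cube)
        finally show ?thesis
          by (simp add: k_def B_def E_def n_def D_def U_def V_def sc)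
      qed
    qed
    finally show ?thesis using inner[OF d] by simp
  qed
  have Bcont: "continuous_on ({0..d0} \<times> cball 0 2) (\<lambda>p. k (snd p) *\<^sub>R B (fst p) (snd p))"
  proof -
    have in\<Omega>: "x + fst p *\<^sub>R snd p \<in> \<Omega>" if "p \<in> {0..d0} \<times> cball 0 2" for p
    proof -
      have "norm (fst p *\<^sub>R snd p) \<le> e" using that d0 mult_mono[of "fst p" d0 "norm (snd p)" 2] by auto
      then show ?thesis using e by (auto simp: dist_norm subset_iff)
    qed
    show ?thesis unfolding B_def k_def using in\<Omega>
      by (intro continuous_intros helmholtz_continuous_deriv[OF u]
          continuous_on_compose2[OF helmholtz_continuous[OF u]] continuous_on_compose2[OF continuous_rep_kernel]) auto
  qed
  have "bounded ((\<lambda>p. k (snd p) *\<^sub>R B (fst p) (snd p)) ` ({0..d0} \<times> cball 0 2))"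
    by (intro compact_imp_bounded compact_continuous_image[OF Bcont] compact_Times) auto
  then obtain M where M: "\<And>d z. d \<in> {0..d0} \<Longrightarrow> z \<in> cball 0 2 \<Longrightarrow> norm (k z *\<^sub>R B d z) \<le> M"
    unfolding bounded_iff by fastforce
  define s where "s n = d0 * inverse (real (Suc n))" for n
  have s: "s n \<in> {0..d0}" "s n > 0" "s n \<le> d0" for n
    using d0 by (auto simp: s_def field_simps)
  have s0: "s \<longlonglongrightarrow> 0" unfolding s_def using tendsto_mult_right_zero[OF LIMSEQ_inverse_real_of_nat] by blast
  have k0: "k z = 0" if "z \<notin> cball 0 2" for z using rep_kernel_outside[OF that] by (simp add: k_def)
  have contz: "continuous_on {0..d0} (\<lambda>d. k z *\<^sub>R B d z)" for z
  proof (cases "z \<in> cball 0 2")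
    case True
    show ?thesis
    proof -
      have a: "continuous_on {0..d0} (\<lambda>d. (d, z))" by (intro continuous_intros)
      have b: "(\<lambda>d. (d, z)) ` {0..d0} \<subseteq> {0..d0} \<times> cball 0 2" using True by auto
      from continuous_on_compose2[OF Bcont a b] show ?thesis unfolding fst_conv snd_conv .
    qed
  qed (simp add: k0)
  have meas: "(\<lambda>z. k z *\<^sub>R B d z) \<in> borel_measurable borel" if "d \<in> {0..d0}" for d
  proof -
    have "continuous_on (cball 0 2) (\<lambda>z. k z *\<^sub>R B d z)"
    proof -
      have a: "continuous_on (cball 0 2) (\<lambda>z::real^3. (d, z))" by (intro continuous_intros)
      have b: "(\<lambda>z. (d, z)) ` cball 0 2 \<subseteq> {0..d0} \<times> cball 0 2" using that by auto
      from continuous_on_compose2[OF Bcont a b] show ?thesis unfolding fst_conv snd_conv .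
    qed
    from integrable_compact_support[OF this compact_cball subset_refl] k0
    have "integrable lborel (\<lambda>z. k z *\<^sub>R B d z)" by simp
    then show ?thesis by auto
  qed
  have "(\<lambda>n. \<integral>z. k z *\<^sub>R B (s n) z \<partial>lborel) \<longlonglongrightarrow> (\<integral>z. k z *\<^sub>R B 0 z \<partial>lborel)"
  proof (rule integral_dominated_convergence[where w="\<lambda>z. indicator (cball 0 2) z *\<^sub>R M"])
    show "integrable lborel (\<lambda>z::real^3. indicator (cball 0 2) z *\<^sub>R M)"
      by (rule borel_integrable_compact) auto
    show "AE z in lborel. (\<lambda>n. k z *\<^sub>R B (s n) z) \<longlonglongrightarrow> k z *\<^sub>R B 0 z"
    proof (rule AE_I2)
      show "(\<lambda>n. k z *\<^sub>R B (s n) z) \<longlonglongrightarrow> k z *\<^sub>R B 0 z" for z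
        by (rule continuous_on_tendsto_compose[OF contz s0]) (use s d0 in auto)
    qed
    show "AE z in lborel. norm (k z *\<^sub>R B (s n) z) \<le> indicator (cball 0 2) z *\<^sub>R M" for n
    proof (rule AE_I2)
      show "norm (k z *\<^sub>R B (s n) z) \<le> indicator (cball 0 2) z *\<^sub>R M" for z
        using M[OF s(1), of z n] k0[of z] by (cases "z \<in> cball 0 2") auto
    qed
  qed (use meas[of 0] meas[OF s(1)] d0 in auto)
  then have "- L = (\<integral>z. k z *\<^sub>R B 0 z \<partial>lborel)"
    unfolding scaled[OF s(2,3)] by (simp add: LIMSEQ_const_iff)
  also have "\<dots> = (\<integral>z. k z *\<^sub>R u x \<partial>lborel)" by (simp add: B_def)
  also have "\<dots> = of_real rep_const * u x"
    unfolding sc[symmetric] rep_const_def k_def[symmetric]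
    by (rule integral_scaleR_left) (simp add: k_def integrable_rep_kernel)
  finally show ?thesis by (simp add: L_def W_def minus_equation_iff)
qed

section \<open>Radiation condition and exterior representation\<close>

text \<open>Here \<open>u' y y\<close> is \<open>\<bar>y\<bar>\<close> times the radial derivative of \<open>u\<close> at \<open>y\<close>.\<close>

definition radiating :: "real \<Rightarrow> ('a::real_normed_vector \<Rightarrow> complex) \<Rightarrow> ('a \<Rightarrow> 'a \<Rightarrow> complex) \<Rightarrow> bool" where
  "radiating \<kappa> u u' \<longleftrightarrow>
    (\<forall>e>0. \<exists>R. \<forall>y. norm y \<ge> R \<longrightarrow> norm (u' y y - \<i> * of_real (\<kappa> * norm y) * u y) \<le> e)"

lemma radiating_diff:
  assumes "radiating \<kappa> u u'" "radiating \<kappa> v v'"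
  shows "radiating \<kappa> (\<lambda>x. u x - v x) (\<lambda>x h. u' x h - v' x h)"
  unfolding radiating_def
proof (intro allI impI)
  fix e :: real assume "e > 0"
  then have "e / 2 > 0" by simp
  obtain R1 where R1: "\<And>y. norm y \<ge> R1 \<Longrightarrow> norm (u' y y - \<i> * of_real (\<kappa> * norm y) * u y) \<le> e / 2"
    using assms(1) \<open>e / 2 > 0\<close> unfolding radiating_def by blast
  obtain R2 where R2: "\<And>y. norm y \<ge> R2 \<Longrightarrow> norm (v' y y - \<i> * of_real (\<kappa> * norm y) * v y) \<le> e / 2"
    using assms(2) \<open>e / 2 > 0\<close> unfolding radiating_def by blast
  have "norm (u' y y - v' y y - \<i> * of_real (\<kappa> * norm y) * (u y - v y)) \<le> e" if "norm y \<ge> max R1 R2" for y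
  proof -
    have "u' y y - v' y y - \<i> * of_real (\<kappa> * norm y) * (u y - v y) =
      (u' y y - \<i> * of_real (\<kappa> * norm y) * u y) - (v' y y - \<i> * of_real (\<kappa> * norm y) * v y)"
      by (simp add: algebra_simps)
    also have "norm \<dots> \<le> e / 2 + e / 2"
      using R1[of y] R2[of y] that by (intro order_trans[OF norm_triangle_ineq4 add_mono]) auto
    finally show ?thesis by simp
  qed
  then show "\<exists>R. \<forall>y. R \<le> norm y \<longrightarrow> norm (u' y y - v' y y - \<i> * of_real (\<kappa> * norm y) * (u y - v y)) \<le> e"
    by blast
qed

section \<open>Fluxes through large shells\<close>

lemma cutoff_weight_annulus:
  assumes "R > 0" "cutoff_weight 0 R y \<noteq> 0"
  shows "R < norm y" "norm y < 2 * R"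
  using cutoff_inside(2)[of R y 0] cutoff_outside(2)[of R y 0] assms by force+

lemma open_exterior_ball: "open {y::'a::real_normed_vector. norm y > R}"
  by (intro open_Collect_less continuous_intros)

lemma weight_integrable:
  fixes f :: "'a::euclidean_space \<Rightarrow> 'b::{banach, second_countable_topology}"
  assumes "continuous_on {y. norm y > R0} f" "R0 > 0" "R > R0"
  shows "integrable lborel (\<lambda>y. cutoff_weight 0 R y *\<^sub>R f y)"
proof (rule integrable_compact_support[of "{y. norm y > R0}" _ "cball 0 (2 * R) - ball 0 R"])
  show "continuous_on {y. norm y > R0} (\<lambda>y. cutoff_weight 0 R y *\<^sub>R f y)"
    by (intro continuous_intros continuous_cutoff_weight assms)
  show "cutoff_weight 0 R y *\<^sub>R f y = 0" if "y \<notin> cball 0 (2 * R) - ball 0 R" for y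
    using that cutoff_weight_annulus[of R y] assms by fastforce
qed (use assms in \<open>auto simp: compact_diff\<close>)

definition weight_const :: real where
  "weight_const = (\<integral>z. 2 * step_deriv ((norm (z :: real^3))\<^sup>2) \<partial>lborel)"

lemma weight_const_nonneg: "weight_const \<ge> 0"
  unfolding weight_const_def using smooth_step_bounds by (intro Bochner_Integration.integral_nonneg) simp

text \<open>The weight is of order \<open>1 / R\<^sup>2\<close> on a shell of volume of order
  \<open>R ^ 3\<close>. This linear growth in \<open>R\<close> is what the decay of the integrands
  has to compensate.\<close>

lemma weight_integral:
  assumes "R > 0"
  shows "integrable lborel (cutoff_weight (0 :: real^3) R)"
    "(\<integral>y. cutoff_weight (0 :: real^3) R y \<partial>lborel) = R * weight_const"
proof -
  show "integrable lborel (cutoff_weight (0 :: real^3) R)"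
    using weight_integrable[of "R / 2" "\<lambda>_. 1 :: real" R] assms by simp
  have "(\<integral>y. cutoff_weight (0 :: real^3) R y \<partial>lborel)
      = R ^ 3 *\<^sub>R (\<integral>z. cutoff_weight 0 R (0 + R *\<^sub>R (z :: real^3)) \<partial>lborel)"
    using lborel_integral_affine[OF borel_measurable_continuous_onI[OF continuous_cutoff_weight[of UNIV "0 :: real^3" R]] assms,
        of 0] by simp
  also have "\<dots> = R ^ 3 *\<^sub>R (\<integral>z. (1 / R\<^sup>2) *\<^sub>R (2 * step_deriv ((norm (z :: real^3))\<^sup>2)) \<partial>lborel)"
    using assms by (simp add: cutoff_weight_def power_mult_distrib)
  also have "\<dots> = R * weight_const"
    using assms unfolding integral_scaleR_right weight_const_def[symmetric]
    by (simp add: power2_eq_square power3_eq_cube)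
  finally show "(\<integral>y. cutoff_weight (0 :: real^3) R y \<partial>lborel) = R * weight_const" .
qed

lemma cutoff_weight_pairing:
  assumes "R > R0" "R0 > 0" "helmholtz \<kappa> {y. norm y > R0} u u'" "helmholtz \<kappa> \<Omega> v v'"
    and "\<And>y. cutoff_weight 0 R y \<noteq> 0 \<Longrightarrow> y \<in> \<Omega>"
  shows "(\<Sum>b\<in>Basis. (cutoff_weight 0 R y * (y \<bullet> b)) *\<^sub>R wronskian u u' v v' y b)
    = cutoff_weight 0 R y *\<^sub>R wronskian u u' v v' y y"
proof (cases "cutoff_weight 0 R y = 0")
  case False
  then have "norm y > R0" using cutoff_weight_annulus[of R y] assms by simp
  then have "linear (wronskian u u' v v' y)"
    using False assms
    by (intro wronskian_linear[of \<kappa> "{y. norm y > R0} \<inter> \<Omega>"] helmholtz_subset[OF assms(3)] helmholtz_subset[OF assms(4)]) auto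
  from cutoff_pairing[OF this, of "cutoff_weight 0 R y" y 0] show ?thesis by simp
qed simp

lemma continuous_cutoff_gradient: "continuous_on S (\<lambda>y. cutoff_weight p R y * ((y - p) \<bullet> b))"
  by (intro continuous_intros continuous_cutoff_weight)

text \<open>The difference of the two cutoffs has compact support in the exterior of the ball, so
  Green's identity applies to it, and its gradient produces exactly the difference of the two
  fluxes.\<close>

lemma flux_constant:
  fixes u v :: "'a::euclidean_space \<Rightarrow> complex"
  assumes u: "helmholtz \<kappa> {y. norm y > R0} u u'" and v: "helmholtz \<kappa> {y. norm y > R0} v v'"
    and R: "R0 > 0" "R > R0" "R' > R0"
  shows "(\<integral>y. cutoff_weight 0 R y *\<^sub>R wronskian u u' v v' y y \<partial>lborel)
    = (\<integral>y. cutoff_weight 0 R' y *\<^sub>R wronskian u u' v v' y y \<partial>lborel)"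
proof -
  let ?W = "wronskian u u' v v'"
  have int: "integrable lborel (\<lambda>y. cutoff_weight 0 r y *\<^sub>R ?W y y)" if "r > R0" for r
    using that R by (intro weight_integrable[of R0] wronskian_continuous[OF u v] continuous_intros) auto
  have "(\<integral>y. (\<Sum>b\<in>Basis. (cutoff_weight 0 R y * ((y - 0) \<bullet> b) - cutoff_weight 0 R' y * ((y - 0) \<bullet> b)) *\<^sub>R ?W y b) \<partial>lborel) = 0"
  proof (rule green[OF open_exterior_ball u v, where \<phi>="\<lambda>y. cutoff 0 R y - cutoff 0 R' y"
        and \<phi>' = "\<lambda>y h. cutoff_weight 0 R y * ((y - 0) \<bullet> h) - cutoff_weight 0 R' y * ((y - 0) \<bullet> h)"
        and K="cball 0 (2 * max R R') - ball 0 (min R R')"])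
    show "((\<lambda>y. cutoff 0 R y - cutoff 0 R' y) has_derivative
        (\<lambda>h. cutoff_weight 0 R y * ((y - 0) \<bullet> h) - cutoff_weight 0 R' y * ((y - 0) \<bullet> h))) (at y)" for y :: 'a
      by (intro has_derivative_diff cutoff_has_derivative)
    show "continuous_on UNIV (\<lambda>y. cutoff_weight 0 R y * ((y - 0) \<bullet> b) - cutoff_weight 0 R' y * ((y - 0) \<bullet> b))" for b :: 'a
      by (intro continuous_on_diff continuous_cutoff_gradient)
    show "cutoff 0 R y - cutoff 0 R' y = 0" if "y \<notin> cball 0 (2 * max R R') - ball 0 (min R R')" for y :: 'a
      using that cutoff_inside(1)[of R y 0] cutoff_inside(1)[of R' y 0] cutoff_outside(1)[of R y 0] cutoff_outside(1)[of R' y 0] R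
      by auto
  qed (use R in \<open>auto simp: compact_diff\<close>)
  also have "(\<lambda>y. \<Sum>b\<in>Basis. (cutoff_weight 0 R y * ((y - 0) \<bullet> b) - cutoff_weight 0 R' y * ((y - 0) \<bullet> b)) *\<^sub>R ?W y b)
      = (\<lambda>y. cutoff_weight 0 R y *\<^sub>R ?W y y - cutoff_weight 0 R' y *\<^sub>R ?W y y)"
    using cutoff_weight_pairing[OF R(2,1) u v] cutoff_weight_pairing[OF R(3,1) u v]
      cutoff_weight_annulus[of R] cutoff_weight_annulus[of R'] R
    by (intro ext) (force simp: scaleR_left_diff_distrib sum_subtractf)
  finally show ?thesis
    using int R by (simp add: Bochner_Integration.integral_diff)
qed

text \<open>The flux of \<open>u\<close> is conserved, and by the radiation condition it controls the mean square of \<open>u\<close>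
  on large shells.\<close>

lemma radiating_L2_bound:
  fixes u :: "real^3 \<Rightarrow> complex"
  assumes "\<kappa> > 0" "R0 > 0" and u: "helmholtz \<kappa> {y. norm y > R0} u u'" and rad: "radiating \<kappa> u u'"
  obtains C R1 where "R1 > R0" "C \<ge> 0"
    "\<And>R. R \<ge> R1 \<Longrightarrow> (\<integral>y. cutoff_weight 0 R y *\<^sub>R (norm y * (norm (u y))\<^sup>2) \<partial>lborel) \<le> C"
proof -
  let ?W = "wronskian u u' (\<lambda>x. cnj (u x)) (\<lambda>x h. cnj (u' x h))"
  note v = helmholtz_cnj[OF u]
  define J where "J R = (\<integral>y. cutoff_weight 0 R y *\<^sub>R ?W y y \<partial>lborel)" for R
  obtain R2 where R2: "\<And>y. norm y \<ge> R2 \<Longrightarrow> norm (u' y y - \<i> * of_real (\<kappa> * norm y) * u y) \<le> 1"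
    using rad unfolding radiating_def by (meson zero_less_one)
  define R1 where "R1 = max (R0 + 1) R2"
  have R1: "R1 > R0" "R1 \<ge> R2" by (auto simp: R1_def)
  \<comment> \<open>Per unit of weight the error below costs at most
    \<open>1 / (\<kappa> * R)\<close>. Multiplied by the total weight
    \<open>R * weight_const\<close> this no longer depends on \<open>R\<close>. The outer division
    by \<open>\<kappa>\<close> undoes the factor \<open>\<kappa>\<close> on the left of
    \<open>le\<close>.\<close>
  define C where "C = (norm (J R1) + weight_const / \<kappa>) / \<kappa>"
  have "(\<integral>y. cutoff_weight 0 R y *\<^sub>R (norm y * (norm (u y))\<^sup>2) \<partial>lborel) \<le> C" if R: "R \<ge> R1" for R
  proof -
    have Rp: "R > R0" "R > 0" using R R1 assms by auto
    have cont: "continuous_on {y. norm y > R0} (\<lambda>y. ?W y y)"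
      by (intro wronskian_continuous[OF u v] continuous_intros) auto
    have intW: "integrable lborel (\<lambda>y. cutoff_weight 0 R y *\<^sub>R ?W y y)"
      by (rule weight_integrable[OF cont assms(2) Rp(1)])
    have intu: "integrable lborel (\<lambda>y. cutoff_weight 0 R y *\<^sub>R (norm y * (norm (u y))\<^sup>2))"
      by (intro weight_integrable[OF _ assms(2) Rp(1)] continuous_intros helmholtz_continuous[OF u])
    have le: "\<kappa> *\<^sub>R (cutoff_weight 0 R y *\<^sub>R (norm y * (norm (u y))\<^sup>2))
        \<le> Im (cutoff_weight 0 R y *\<^sub>R ?W y y) + (1 / (\<kappa> * R)) *\<^sub>R cutoff_weight 0 R y" for y
    proof (cases "cutoff_weight 0 R y = 0")
      case False
      have y: "norm y > R" using cutoff_weight_annulus[OF Rp(2) False] by simp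
      define e where "e = u' y y - \<i> * of_real (\<kappa> * norm y) * u y"
      have e1: "norm e \<le> 1" unfolding e_def using R2 y R R1 by simp
      define n where "n = norm y"
      have n: "n > R" "n > 0" using y Rp by (auto simp: n_def)
      \<comment> \<open>The radial derivative is replaced by
        \<open>\<i> \<kappa> \<bar>y\<bar> u + e\<close>. The main terms of \<open>u\<close> and of
        its conjugate add up, while the error enters as a quantity minus its conjugate.\<close>
      have W: "?W y y = 2 * \<i> * of_real (\<kappa> * n * (norm (u y))\<^sup>2) + (cnj (u y) * e - cnj (cnj (u y) * e))"
      proof -
        have "u y * cnj (u y) = (complex_of_real (norm (u y)))\<^sup>2"
          by (metis complex_norm_square of_real_power)
        then show ?thesis
          unfolding wronskian_def e_def n_def of_real_mult of_real_power by (simp add: algebra_simps)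
      qed
      have gen: "Im (2 * \<i> * of_real r + (z - cnj z)) = 2 * r + 2 * Im z" for r z by simp
      have "Im (?W y y) = 2 * (\<kappa> * n * (norm (u y))\<^sup>2) + 2 * Im (cnj (u y) * e)"
        unfolding W gen ..
      moreover have "\<bar>Im (cnj (u y) * e)\<bar> \<le> norm (u y) * norm e"
        using abs_Im_le_cmod[of "cnj (u y) * e"] by (simp add: norm_mult)
      \<comment> \<open>A weighted arithmetic-geometric inequality: half of the main term
        \<open>2 * (\<kappa> * n * (norm (u y))\<^sup>2)\<close> is spent to absorb the
        error.\<close>
      moreover have "2 * (norm (u y) * norm e) \<le> \<kappa> * n * (norm (u y))\<^sup>2 + (norm e)\<^sup>2 / (\<kappa> * n)"
      proof -
        have p: "\<kappa> * n > 0" using n assms by simp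
        have "0 \<le> (\<kappa> * n * norm (u y) - norm e)\<^sup>2 / (\<kappa> * n)" using p by simp
        also have "\<dots> = \<kappa> * n * (norm (u y))\<^sup>2 + (norm e)\<^sup>2 / (\<kappa> * n) - 2 * (norm (u y) * norm e)"
          using p assms n by (simp add: power2_eq_square field_simps)
        finally show ?thesis by simp
      qed
      moreover have "(norm e)\<^sup>2 / (\<kappa> * n) \<le> 1 / (\<kappa> * R)"
        using n Rp assms e1 by (intro frac_le) (auto simp: power_le_one)
      ultimately have "\<kappa> * n * (norm (u y))\<^sup>2 \<le> Im (?W y y) + 1 / (\<kappa> * R)" by linarith
      from mult_left_mono[OF this cutoff_bounds(3)[of 0 R y]]
      show ?thesis by (simp add: n_def algebra_simps)
    qed simp
    have "\<kappa> *\<^sub>R (\<integral>y. cutoff_weight 0 R y *\<^sub>R (norm y * (norm (u y))\<^sup>2) \<partial>lborel)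
        = (\<integral>y. \<kappa> *\<^sub>R (cutoff_weight 0 R y *\<^sub>R (norm y * (norm (u y))\<^sup>2)) \<partial>lborel)"
      by (simp only: integral_scaleR_right)
    also have "\<dots> \<le> (\<integral>y. Im (cutoff_weight 0 R y *\<^sub>R ?W y y) + (1 / (\<kappa> * R)) *\<^sub>R cutoff_weight 0 R y \<partial>lborel)"
      using le intW intu weight_integral(1)[OF Rp(2)]
      by (intro integral_mono Bochner_Integration.integrable_add integrable_scaleR_right integrable_Im) auto
    also have "\<dots> = Im (J R) + (1 / (\<kappa> * R)) * (R * weight_const)"
      using intW weight_integral[OF Rp(2)] unfolding J_def
      by (subst Bochner_Integration.integral_add) (auto simp: integral_Im simp del: scaleR_complex.simps)
    also have "J R = J R1"
      unfolding J_def using R R1 assms(2) by (intro flux_constant[OF u v]) auto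
    also have "Im (J R1) + (1 / (\<kappa> * R)) * (R * weight_const) \<le> \<kappa> * C"
      using abs_Im_le_cmod[of "J R1"] Rp assms by (simp add: C_def)
    finally show ?thesis using assms by simp
  qed
  moreover have "C \<ge> 0" using assms weight_const_nonneg by (simp add: C_def)
  ultimately show ?thesis using that R1 by blast
qed

text \<open>The fundamental solution is outgoing about its own pole \<open>x\<close>, but the radial
  direction is taken here from the origin. The shift changes the relevant length by at most
  \<open>2 * norm x\<close>, and the assumption on \<open>y\<close> keeps the distance to the pole
  above \<open>norm y / 2\<close>. The defect is therefore a bounded multiple of
  \<open>fund\<close>.\<close>

lemma fund_radial_defect:
  assumes "\<kappa> > 0" "norm y \<ge> 2 * norm x + 1"
  shows "norm (fund \<kappa> x y) \<le> 2 / norm y"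
    "norm (fund_deriv \<kappa> x y y - \<i> * of_real (\<kappa> * norm y) * fund \<kappa> x y) \<le> (4 * \<kappa> * norm x + 4) / norm y"
proof -
  define \<rho> where "\<rho> = norm (y - x)"
  have yp: "norm y > 0" using assms norm_ge_zero[of x] by linarith
  have diff: "\<bar>\<rho> - norm y\<bar> \<le> norm x" unfolding \<rho>_def by (metis norm_minus_commute norm_triangle_ineq3 diff_diff_eq2 add_diff_cancel_left' abs_minus_commute)
  then have \<rho>: "\<rho> \<ge> norm y / 2" "\<rho> > 0" using assms yp norm_ge_zero[of x] by linarith+
  have nF: "norm (fund \<kappa> x y) = 1 / \<rho>"
    using \<rho> by (simp add: fund_def wave0_def \<rho>_def norm_divide)
  also have "1 / \<rho> \<le> 2 / norm y" using frac_le[of 1 1 "norm y / 2" \<rho>] \<rho> yp by simp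
  finally show F: "norm (fund \<kappa> x y) \<le> 2 / norm y" .
  define s where "s = (y - x) \<bullet> y"
  have "fund_deriv \<kappa> x y y - \<i> * of_real (\<kappa> * norm y) * fund \<kappa> x y
      = fund \<kappa> x y * (\<i> * of_real (\<kappa> * (s / \<rho> - norm y)) - of_real (s / \<rho>\<^sup>2))"
    using \<rho> unfolding fund_deriv_def fund_def wave0_def wave1_def \<rho>_def[symmetric] s_def[symmetric]
    by (simp add: field_simps power2_eq_square power3_eq_cube)
  moreover have "norm (\<i> * of_real (\<kappa> * (s / \<rho> - norm y)) - complex_of_real (s / \<rho>\<^sup>2)) \<le> \<kappa> * (2 * norm x) + 2"
  proof (intro norm_triangle_le_diff add_mono)
    have "s = \<rho> * \<rho> + (y - x) \<bullet> x"
      unfolding s_def \<rho>_def power2_eq_square[symmetric] power2_norm_eq_inner by (simp add: algebra_simps)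
    then have "s / \<rho> - \<rho> = ((y - x) \<bullet> x) / \<rho>" using \<rho> by (simp add: field_simps)
    moreover have "\<bar>((y - x) \<bullet> x) / \<rho>\<bar> \<le> norm x"
      using Cauchy_Schwarz_ineq2[of "y - x" x] \<rho> by (simp add: \<rho>_def field_simps)
    ultimately have "\<bar>s / \<rho> - norm y\<bar> \<le> 2 * norm x" using diff by linarith
    then show "norm (\<i> * complex_of_real (\<kappa> * (s / \<rho> - norm y))) \<le> \<kappa> * (2 * norm x)"
      using assms by (simp add: norm_mult abs_mult del: of_real_mult of_real_diff of_real_divide)
    have "\<bar>s\<bar> \<le> \<rho> * norm y" unfolding s_def \<rho>_def by (rule Cauchy_Schwarz_ineq2)
    also have "\<dots> \<le> \<rho> * (2 * \<rho>)" using \<rho> by (intro mult_left_mono) auto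
    finally show "norm (complex_of_real (s / \<rho>\<^sup>2)) \<le> 2"
      using \<rho> by (simp add: power2_eq_square field_simps abs_mult del: of_real_divide)
  qed
  ultimately have "norm (fund_deriv \<kappa> x y y - \<i> * of_real (\<kappa> * norm y) * fund \<kappa> x y) \<le> 2 / norm y * (\<kappa> * (2 * norm x) + 2)"
    using F yp by (simp only: norm_mult) (intro mult_mono, auto)
  then show "norm (fund_deriv \<kappa> x y y - \<i> * of_real (\<kappa> * norm y) * fund \<kappa> x y) \<le> (4 * \<kappa> * norm x + 4) / norm y"
    by (simp add: algebra_simps add_divide_distrib)
qed

text \<open>The terms \<open>\<i> \<kappa> \<bar>y\<bar> u fund\<close> of the two radial
  derivatives cancel in the Wronskian, and what is left pairs each function with the radiation
  defect of the other. Pointwise decay of \<open>u\<close> is not at hand; the bound on its mean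
  square over shells takes its place.\<close>

lemma wronskian_fund_far:
  fixes u :: "real^3 \<Rightarrow> complex"
  assumes "\<kappa> > 0" "R0 > 0" and u: "helmholtz \<kappa> {y. norm y > R0} u u'" and rad: "radiating \<kappa> u u'"
    and "e > 0"
  obtains R1 where "R1 > R0" "R1 > norm x"
    "\<And>R. R \<ge> R1 \<Longrightarrow> integrable lborel (\<lambda>y. cutoff_weight 0 R y *\<^sub>R wronskian u u' (fund \<kappa> x) (fund_deriv \<kappa> x) y y)"
    "\<And>R. R \<ge> R1 \<Longrightarrow> (\<integral>y. norm (cutoff_weight 0 R y *\<^sub>R wronskian u u' (fund \<kappa> x) (fund_deriv \<kappa> x) y y) \<partial>lborel) \<le> e"
proof -
  let ?W = "wronskian u u' (fund \<kappa> x) (fund_deriv \<kappa> x)"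
  obtain C R2 where C: "R2 > R0" "C \<ge> 0"
    "\<And>R. R \<ge> R2 \<Longrightarrow> (\<integral>y. cutoff_weight 0 R y *\<^sub>R (norm y * (norm (u y))\<^sup>2) \<partial>lborel) \<le> C"
    by (rule radiating_L2_bound[OF assms(1-4)], rule that, assumption+)
  define A where "A = 4 * \<kappa> * norm x + 4"
  have A: "A \<ge> 0" using assms by (simp add: A_def)
  \<comment> \<open>The defect of \<open>u\<close> over a shell will give
    \<open>2 * \<epsilon> * weight_const\<close> and the remainder another
    \<open>\<epsilon>\<close>, which add up to \<open>e\<close>. The last entry of \<open>R1\<close>
    below makes the remainder that small.\<close>
  define \<epsilon> where "\<epsilon> = e / (2 * weight_const + 1)"
  have \<epsilon>: "\<epsilon> > 0" using \<open>e > 0\<close> weight_const_nonneg by (simp add: \<epsilon>_def)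
  obtain R3 where R3: "\<And>y. norm y \<ge> R3 \<Longrightarrow> norm (u' y y - \<i> * of_real (\<kappa> * norm y) * u y) \<le> \<epsilon>"
    using rad \<epsilon> unfolding radiating_def by meson
  define R1 where "R1 = Max {R2, R3, 2 * norm x + 1, A * (C + weight_const) / \<epsilon>}"
  have R1: "R1 \<ge> R2" "R1 \<ge> R3" "R1 \<ge> 2 * norm x + 1" "R1 \<ge> A * (C + weight_const) / \<epsilon>"
    by (auto simp: R1_def)
  have main: "integrable lborel (\<lambda>y. cutoff_weight 0 R y *\<^sub>R ?W y y) \<and>
     (\<integral>y. norm (cutoff_weight 0 R y *\<^sub>R ?W y y) \<partial>lborel) \<le> e" if R: "R \<ge> R1" for R
  proof
    have Rx: "R \<ge> 2 * norm x + 1" "R > norm x" using R R1 norm_ge_zero[of x] by linarith+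
    have Rp: "R > R0" "R > 0" using R R1 C assms by linarith+
    define R' where "R' = max R0 (norm x)"
    have R': "R' > 0" "R > R'" using assms Rp Rx by (auto simp: R'_def)
    have u': "helmholtz \<kappa> {y. norm y > R'} u u'" by (rule helmholtz_subset[OF u]) (auto simp: R'_def)
    have v': "helmholtz \<kappa> {y. norm y > R'} (fund \<kappa> x) (fund_deriv \<kappa> x)"
      by (rule helmholtz_subset[OF helmholtz_fund]) (auto simp: R'_def)
    have "continuous_on {y. norm y > R'} (\<lambda>y. ?W y y)"
      by (intro wronskian_continuous[OF u' v'] continuous_intros) auto
    from weight_integrable[OF this R']
    show intW: "integrable lborel (\<lambda>y. cutoff_weight 0 R y *\<^sub>R ?W y y)" .
    have intu: "integrable lborel (\<lambda>y. cutoff_weight 0 R y *\<^sub>R (norm y * (norm (u y))\<^sup>2))"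
      by (intro weight_integrable[OF _ assms(2) Rp(1)] continuous_intros helmholtz_continuous[OF u])
    have le: "norm (cutoff_weight 0 R y *\<^sub>R ?W y y) \<le> (2 * \<epsilon> / R + A / R\<^sup>2) *\<^sub>R cutoff_weight 0 R y
        + (A / R) *\<^sub>R (cutoff_weight 0 R y *\<^sub>R (norm y * (norm (u y))\<^sup>2))" for y
    proof (cases "cutoff_weight 0 R y = 0")
      case False
      have y: "norm y > R" using cutoff_weight_annulus[OF Rp(2) False] by simp
      define n where "n = norm y"
      have n: "n > R" "n > 0" using y Rp by (auto simp: n_def)
      have yx: "norm y \<ge> 2 * norm x + 1" using y Rx by linarith
      define \<eta> where "\<eta> = u' y y - \<i> * of_real (\<kappa> * norm y) * u y"
      define \<zeta> where "\<zeta> = fund_deriv \<kappa> x y y - \<i> * of_real (\<kappa> * norm y) * fund \<kappa> x y"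
      have \<eta>: "norm \<eta> \<le> \<epsilon>" unfolding \<eta>_def using R3 y R R1 by simp
      have \<zeta>: "norm \<zeta> \<le> A / n" and F: "norm (fund \<kappa> x y) \<le> 2 / n"
        unfolding \<zeta>_def A_def n_def using fund_radial_defect[OF assms(1) yx] by auto
      have "?W y y = fund \<kappa> x y * \<eta> - u y * \<zeta>"
        unfolding wronskian_def \<eta>_def \<zeta>_def by (simp add: algebra_simps)
      then have "norm (?W y y) \<le> norm (fund \<kappa> x y) * norm \<eta> + norm (u y) * norm \<zeta>"
        by (metis norm_mult norm_triangle_ineq4)
      also have "\<dots> \<le> 2 / n * \<epsilon> + norm (u y) * (A / n)"
        using \<eta> \<zeta> F n by (intro add_mono mult_mono) auto
      also have "2 / n * \<epsilon> \<le> 2 * \<epsilon> / R" using n Rp \<epsilon> by (simp add: field_simps)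
      also have "norm (u y) * (A / n) \<le> A * (n * (norm (u y))\<^sup>2 / R + 1 / R\<^sup>2)"
      proof -
        define t where "t = norm (u y)"
        \<comment> \<open>The bound on the mean square does not control a term linear in
          \<open>u\<close> directly. Where \<open>t\<close> is at most \<open>1 / R\<close> the
          second summand suffices; elsewhere the factor \<open>R * t \<ge> 1\<close> makes the term
          quadratic.\<close>
        have "t / n \<le> n * t\<^sup>2 / R + 1 / R\<^sup>2"
        proof (cases "t \<le> 1 / R")
          case True
          have "t / n \<le> (1 / R) / R" using True n Rp by (intro frac_le) (auto simp: t_def)
          then show ?thesis using n Rp by (simp add: power2_eq_square add_increasing)
        next
          case False
          have "1 / n \<le> n * t / R"
          proof -
            have "1 \<le> R * t" using False Rp by (simp add: field_simps)
            moreover have "R * R \<le> n * n" using n Rp by (intro mult_mono) auto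
            ultimately have "R * 1 \<le> R * (R * t)" "R * R * t \<le> n * n * t"
              using Rp by (auto intro!: mult_left_mono mult_right_mono simp: t_def)
            then have "R \<le> n * n * t" by (simp add: mult_ac)
            then show ?thesis using n Rp by (simp add: field_simps)
          qed
          from mult_left_mono[OF this, of t] have "t / n \<le> n * t\<^sup>2 / R"
            by (simp add: t_def power2_eq_square mult_ac)
          then show ?thesis using Rp by (simp add: add_increasing2)
        qed
        from mult_left_mono[OF this A] show ?thesis by (simp add: t_def mult_ac)
      qed
      finally have "norm (?W y y) \<le> 2 * \<epsilon> / R + A * (n * (norm (u y))\<^sup>2 / R + 1 / R\<^sup>2)" by simp
      from mult_left_mono[OF this cutoff_bounds(3)[of 0 R y]]
      show ?thesis using cutoff_bounds(3)[of 0 R y] by (simp add: n_def algebra_simps)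
    qed simp
    have "(\<integral>y. norm (cutoff_weight 0 R y *\<^sub>R ?W y y) \<partial>lborel)
      \<le> (\<integral>y. (2 * \<epsilon> / R + A / R\<^sup>2) *\<^sub>R cutoff_weight 0 R y
        + (A / R) *\<^sub>R (cutoff_weight 0 R y *\<^sub>R (norm y * (norm (u y))\<^sup>2)) \<partial>lborel)"
      using le intW intu weight_integral(1)[OF Rp(2)]
      by (intro integral_mono Bochner_Integration.integrable_add integrable_scaleR_right integrable_norm) auto
    also have "\<dots> = (2 * \<epsilon> / R + A / R\<^sup>2) * (R * weight_const)
        + (A / R) * (\<integral>y. cutoff_weight 0 R y *\<^sub>R (norm y * (norm (u y))\<^sup>2) \<partial>lborel)"
      using intu weight_integral[OF Rp(2)]
      by (subst Bochner_Integration.integral_add) (auto simp del: scaleR_conv_of_real)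
    also have "\<dots> \<le> (2 * \<epsilon> / R + A / R\<^sup>2) * (R * weight_const) + (A / R) * C"
      using C(3)[of R] R R1 A Rp by (intro add_left_mono mult_left_mono) auto
    also have "\<dots> = 2 * \<epsilon> * weight_const + A * (C + weight_const) / R"
      using Rp by (simp add: field_simps power2_eq_square)
    also have "A * (C + weight_const) / R \<le> \<epsilon>"
      using order_trans[OF R1(4) R] Rp \<epsilon> by (simp add: field_simps)
    also have "2 * \<epsilon> * weight_const + \<epsilon> = e"
    proof -
      have "2 * \<epsilon> * weight_const + \<epsilon> = \<epsilon> * (2 * weight_const + 1)" by (simp add: algebra_simps)
      then show ?thesis using weight_const_nonneg by (simp add: \<epsilon>_def)
    qed
    finally show "(\<integral>y. norm (cutoff_weight 0 R y *\<^sub>R ?W y y) \<partial>lborel) \<le> e" by simp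
  qed
  show ?thesis
  proof (rule that[of R1])
    show "R1 > R0" using R1 C by linarith
    show "R1 > norm x" using R1 norm_ge_zero[of x] by linarith
  qed (use main in blast)+
qed

text \<open>A difference of two cutoffs equals 1 around \<open>x\<close>, because \<open>x\<close>
  lies beyond \<open>2 * R1\<close> and inside the radius of the outer one. Of the two shells that
  carry its gradient, the outer one, moved far enough out, contributes at most any given
  \<open>e\<close>; only the inner one is left.\<close>

lemma exterior_representation:
  fixes u :: "real^3 \<Rightarrow> complex"
  assumes "\<kappa> > 0" "R0 > 0" and u: "helmholtz \<kappa> {y. norm y > R0} u u'" and rad: "radiating \<kappa> u u'"
    and "R1 > R0" "norm x > 2 * R1"
  shows "(\<integral>y. cutoff_weight 0 R1 y *\<^sub>R wronskian u u' (fund \<kappa> x) (fund_deriv \<kappa> x) y y \<partial>lborel)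
    = - of_real rep_const * u x" (is "?I = ?u")
proof -
  let ?W = "wronskian u u' (fund \<kappa> x) (fund_deriv \<kappa> x)"
  have R1: "R1 > 0" using assms by simp
  have v: "helmholtz \<kappa> {y. R0 < norm y \<and> norm y < norm x} (fund \<kappa> x) (fund_deriv \<kappa> x)"
    by (rule helmholtz_subset[OF helmholtz_fund]) auto
  have int1: "integrable lborel (\<lambda>y. cutoff_weight 0 R1 y *\<^sub>R ?W y y)"
  proof (rule integrable_compact_support[of "{y. R0 < norm y \<and> norm y < norm x}" _ "cball 0 (2 * R1) - ball 0 R1"])
    have "helmholtz \<kappa> {y. R0 < norm y \<and> norm y < norm x} u u'" using u by (rule helmholtz_subset) auto
    from wronskian_continuous[OF this v]
    show "continuous_on {y. R0 < norm y \<and> norm y < norm x} (\<lambda>y. cutoff_weight 0 R1 y *\<^sub>R ?W y y)"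
      by (intro continuous_intros continuous_cutoff_weight) auto
    show "cutoff_weight 0 R1 y *\<^sub>R ?W y y = 0" if "y \<notin> cball 0 (2 * R1) - ball 0 R1" for y
      using that cutoff_weight_annulus[of R1 y] R1 by fastforce
  qed (use assms in \<open>auto simp: compact_diff\<close>)
  have "norm (?I - ?u) \<le> e" if e: "e > 0" for e
  proof -
    obtain R2 where R2: "R2 > R0" "R2 > norm x"
      "\<And>R. R \<ge> R2 \<Longrightarrow> integrable lborel (\<lambda>y. cutoff_weight 0 R y *\<^sub>R ?W y y)"
      "\<And>R. R \<ge> R2 \<Longrightarrow> (\<integral>y. norm (cutoff_weight 0 R y *\<^sub>R ?W y y) \<partial>lborel) \<le> e"
      by (rule wronskian_fund_far[OF assms(1-4) e, of x], rule that, assumption+)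
    have R2p: "R2 > 0" using R2 assms by simp
    have "(\<integral>y. (\<Sum>b\<in>Basis. (cutoff_weight 0 R1 y * ((y - 0) \<bullet> b) - cutoff_weight 0 R2 y * ((y - 0) \<bullet> b)) *\<^sub>R ?W y b) \<partial>lborel) = ?u"
    proof (rule fund_representation[OF open_exterior_ball u, where \<phi>="\<lambda>y. cutoff 0 R1 y - cutoff 0 R2 y"
        and \<phi>' = "\<lambda>y h. cutoff_weight 0 R1 y * ((y - 0) \<bullet> h) - cutoff_weight 0 R2 y * ((y - 0) \<bullet> h)"
        and K="cball 0 (2 * R2) - ball 0 R1" and r = "min (norm x - 2 * R1) (R2 - norm x)"])
      show "((\<lambda>y. cutoff 0 R1 y - cutoff 0 R2 y) has_derivative
        (\<lambda>h. cutoff_weight 0 R1 y * ((y - 0) \<bullet> h) - cutoff_weight 0 R2 y * ((y - 0) \<bullet> h))) (at y)" for y :: "real^3"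
        by (intro has_derivative_diff cutoff_has_derivative)
      show "continuous_on UNIV (\<lambda>y. cutoff_weight 0 R1 y * ((y - 0) \<bullet> b) - cutoff_weight 0 R2 y * ((y - 0) \<bullet> b))" for b :: "real^3"
        by (intro continuous_on_diff continuous_cutoff_gradient)
      show "cutoff 0 R1 y - cutoff 0 R2 y = 0" if "y \<notin> cball 0 (2 * R2) - ball 0 R1" for y :: "real^3"
        using that cutoff_inside(1)[of R1 y 0] cutoff_inside(1)[of R2 y 0] cutoff_outside(1)[of R1 y 0] cutoff_outside(1)[of R2 y 0] assms R2
        by auto
      show "cutoff 0 R1 y - cutoff 0 R2 y = 1" if "y \<in> ball x (min (norm x - 2 * R1) (R2 - norm x))" for y
      proof -
        have "norm (x - y) < norm x - 2 * R1" "norm (x - y) < R2 - norm x" using that by (auto simp: dist_norm)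
        then have "norm y \<ge> 2 * R1" "norm y \<le> R2"
          using norm_triangle_ineq2[of x y] norm_triangle_ineq2[of y x] by (auto simp: norm_minus_commute)
        then show ?thesis using cutoff_outside(1)[of R1 y 0] cutoff_inside(1)[of R2 y 0] R1 R2p by simp
      qed
    qed (use assms R2 in \<open>auto simp: compact_diff\<close>)
    also have "(\<lambda>y. \<Sum>b\<in>Basis. (cutoff_weight 0 R1 y * ((y - 0) \<bullet> b) - cutoff_weight 0 R2 y * ((y - 0) \<bullet> b)) *\<^sub>R ?W y b)
      = (\<lambda>y. cutoff_weight 0 R1 y *\<^sub>R ?W y y - cutoff_weight 0 R2 y *\<^sub>R ?W y y)"
    proof -
      have "y \<in> - {x}" if "cutoff_weight 0 R1 y \<noteq> 0 \<or> cutoff_weight 0 R2 y \<noteq> 0" for y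
        using that cutoff_weight_annulus[of R1 y] cutoff_weight_annulus[of R2 y] R1 R2p R2 assms by auto
      then show ?thesis
        using cutoff_weight_pairing[OF assms(5,2) u helmholtz_fund[of \<kappa> x]]
          cutoff_weight_pairing[OF R2(1) assms(2) u helmholtz_fund[of \<kappa> x]]
        by (intro ext) (simp add: scaleR_left_diff_distrib sum_subtractf)
    qed
    finally have "?I - (\<integral>y. cutoff_weight 0 R2 y *\<^sub>R ?W y y \<partial>lborel) = ?u"
      using int1 R2(3)[OF order_refl] by (simp add: Bochner_Integration.integral_diff)
    then have "?I - ?u = (\<integral>y. cutoff_weight 0 R2 y *\<^sub>R ?W y y \<partial>lborel)" by (simp add: algebra_simps)
    also have "norm \<dots> \<le> (\<integral>y. norm (cutoff_weight 0 R2 y *\<^sub>R ?W y y) \<partial>lborel)"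
      by (rule integral_norm_bound)
    also have "\<dots> \<le> e" using R2(4) by simp
    finally show ?thesis .
  qed
  then have "norm (?I - ?u) \<le> 0" by (rule field_le_epsilon[of _ 0, simplified])
  then show ?thesis by (simp only: norm_le_zero_iff right_minus_eq)
qed

section \<open>Uniqueness in a half-space\<close>

definition mirror :: "'a::real_inner \<Rightarrow> real \<Rightarrow> 'a \<Rightarrow> 'a" where
  "mirror n b x = x - (2 * (x \<bullet> n - b)) *\<^sub>R n"

lemma mirror_inner: "norm n = 1 \<Longrightarrow> mirror n b x \<bullet> n = 2 * b - x \<bullet> n"
  by (simp add: mirror_def inner_diff_left dot_square_norm algebra_simps)

lemma norm_diff_mirror:
  assumes "norm n = 1" "y \<bullet> n = b"
  shows "norm (y - mirror n b x) = norm (y - x)"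
proof -
  define t where "t = x \<bullet> n - b"
  define w where "w = y - x"
  have "n \<bullet> n = 1" using assms by (simp add: dot_square_norm)
  moreover have "w \<bullet> n = - t" using assms by (simp add: t_def w_def inner_diff_left)
  moreover have "y - mirror n b x = w + (2 * t) *\<^sub>R n" by (simp add: mirror_def t_def w_def)
  moreover have "(w + (2 * t) *\<^sub>R n) \<bullet> (w + (2 * t) *\<^sub>R n) = w \<bullet> w + 4 * t * (w \<bullet> n) + 4 * t * t * (n \<bullet> n)"
    by (simp add: inner_add_left inner_add_right inner_commute[of n w] distrib_left)
  ultimately have "(y - mirror n b x) \<bullet> (y - mirror n b x) = w \<bullet> w" by simp
  then show ?thesis unfolding norm_eq_sqrt_inner w_def by (rule arg_cong)
qed

text \<open>Green's function \<open>fund x - fund (mirror x)\<close> and the solution both vanish on the boundary plane,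
  hence so does their Wronskian, and a cutoff at distance of order \<open>\<epsilon>\<close> from the plane contributes nothing
  in the limit.\<close>

lemma halfspace_uniqueness:
  fixes u :: "real^3 \<Rightarrow> complex"
  assumes "\<kappa> > 0" "R0 > 0" and ext: "{y. norm y > R0} \<subseteq> U" and "open U"
    and u: "helmholtz \<kappa> U u u'" and rad: "radiating \<kappa> u u'"
    and n: "norm n = 1" and half: "{y. y \<bullet> n \<ge> b} \<subseteq> U"
    and bdry: "\<And>y. y \<bullet> n = b \<Longrightarrow> u y = 0" and x: "x \<bullet> n > b"
  shows "u x = 0"
proof -
  define xm where "xm = mirror n b x"
  define W where "W p = wronskian u u' (fund \<kappa> p) (fund_deriv \<kappa> p)" for p
  have nn: "n \<bullet> n = 1" using n by (simp add: dot_square_norm)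
  have xm: "xm \<bullet> n < b" using mirror_inner[OF n] x by (simp add: xm_def)
  define \<Omega> where "\<Omega> = {y. y \<bullet> n > b}"
  have \<Omega>: "open \<Omega>" "\<Omega> \<subseteq> U" unfolding \<Omega>_def using half
    by (auto intro!: open_Collect_less continuous_intros)
  note uext = helmholtz_subset[OF u ext] and u\<Omega> = helmholtz_subset[OF u \<Omega>(2)]
  have vsub: "helmholtz \<kappa> S (fund \<kappa> p) (fund_deriv \<kappa> p)" if "p \<notin> S" for p S
    by (rule helmholtz_subset[OF helmholtz_fund]) (use that in auto)
  have Wcont: "continuous_on S (\<lambda>y. W p y (h y))" if "S \<subseteq> U" "p \<notin> S" "continuous_on S h" for S p h
    unfolding W_def by (rule wronskian_continuous[OF helmholtz_subset[OF u that(1)] vsub[OF that(2)] that(3) order_refl])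
  have Wlin: "linear (W p y)" if "y \<in> U" "y \<noteq> p" for p y
    unfolding W_def by (rule wronskian_linear[OF helmholtz_subset[OF u, of "{y}"] vsub[of p "{y}"]]) (use that in auto)
  \<comment> \<open>One \<open>e\<close> is spent on the outer shell for each of the poles
    \<open>x\<close> and \<open>xm\<close>, and one on the layer along the plane.\<close>
  have bound: "norm (of_real rep_const * u x) \<le> 3 * e" if e: "e > 0" for e
  proof -
    note far = wronskian_fund_far[OF assms(1,2) uext rad e, folded W_def]
    obtain R1 where R1: "R1 > R0" "R1 > norm x"
      "\<And>R. R \<ge> R1 \<Longrightarrow> integrable lborel (\<lambda>y. cutoff_weight 0 R y *\<^sub>R W x y y)"
      "\<And>R. R \<ge> R1 \<Longrightarrow> (\<integral>y. norm (cutoff_weight 0 R y *\<^sub>R W x y y) \<partial>lborel) \<le> e"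
      by (rule far[of x], rule that, assumption+)
    obtain R2 where R2: "R2 > R0" "R2 > norm xm"
      "\<And>R. R \<ge> R2 \<Longrightarrow> integrable lborel (\<lambda>y. cutoff_weight 0 R y *\<^sub>R W xm y y)"
      "\<And>R. R \<ge> R2 \<Longrightarrow> (\<integral>y. norm (cutoff_weight 0 R y *\<^sub>R W xm y y) \<partial>lborel) \<le> e"
      by (rule far[of xm], rule that, assumption+)
    define R where "R = max R1 R2"
    have R: "R \<ge> R1" "R \<ge> R2" "R > 0" "R > norm x" "R > R0" using R1 R2 assms by (auto simp: R_def)
    \<comment> \<open>Half the height of \<open>x\<close> above the plane: a layer of this thickness
      contains neither pole, so both Wronskians are continuous on the compact set
      \<open>S\<close>.\<close>
    define \<delta> where "\<delta> = (x \<bullet> n - b) / 2"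
    have \<delta>: "\<delta> > 0" using x by (simp add: \<delta>_def)
    define D where "D y = W x y n - W xm y n" for y
    define S where "S = cball 0 (2 * R + 1) \<inter> {y. b \<le> y \<bullet> n} \<inter> {y. y \<bullet> n \<le> b + \<delta>}"
    have "compact S" unfolding S_def
      by (intro compact_Int_closed compact_cball closed_Collect_le continuous_intros)
    moreover have "continuous_on S D"
      unfolding D_def using half x xm by (intro continuous_intros Wcont) (auto simp: S_def \<delta>_def field_simps)
    ultimately have "uniformly_continuous_on S D" by (rule compact_uniformly_continuous[rotated])
    \<comment> \<open>Apart from the 1 that keeps it positive, the denominator is the bound on the
      mass of the layer weight \<open>t\<close> proved in \<open>tint\<close>, which does not depend
      on the thickness of the layer.\<close>
    moreover define \<eta> where "\<eta> = e / (2 * R * (R * weight_const) + 1)"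
    have pos: "2 * R * (R * weight_const) \<ge> 0" using R weight_const_nonneg by simp
    then have \<eta>: "\<eta> > 0" "\<eta> * (2 * R * (R * weight_const)) \<le> e"
      using e by (auto simp: \<eta>_def field_simps add_nonneg_pos)
    ultimately obtain d where d: "d > 0" "\<And>y z. y \<in> S \<Longrightarrow> z \<in> S \<Longrightarrow> dist z y < d \<Longrightarrow> dist (D z) (D y) < \<eta>"
      unfolding uniformly_continuous_on_def by meson
    \<comment> \<open>\<open>smooth_step\<close> is complete at argument 4, so the layer ends at
      height \<open>4 * \<epsilon>\<close>. This must be below the modulus \<open>d\<close>, below
      \<open>\<delta>\<close>, and below 1, since \<open>S\<close> exceeds the ball of radius
      \<open>2 * R\<close> only by 1.\<close>
    define \<epsilon> where "\<epsilon> = min (min d \<delta>) 1 / 8"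
    have \<epsilon>: "\<epsilon> > 0" "4 * \<epsilon> < d" "4 * \<epsilon> < \<delta>" "4 * \<epsilon> < 1" using d \<delta> by (auto simp: \<epsilon>_def)
    define st where "st y = smooth_step ((y \<bullet> n - b) / \<epsilon>)" for y
    define t where "t y = (1 - cutoff 0 R y) * (step_deriv ((y \<bullet> n - b) / \<epsilon>) / \<epsilon>)" for y
    define \<phi>' where "\<phi>' y h = t y * (n \<bullet> h) - cutoff_weight 0 R y * (y \<bullet> h) * st y" for y h
    have st_der: "(st has_derivative (\<lambda>h. step_deriv ((y \<bullet> n - b) / \<epsilon>) / \<epsilon> * (n \<bullet> h))) (at y)" for y
    proof -
      have "((\<lambda>y. (y \<bullet> n - b) / \<epsilon>) has_derivative (\<lambda>h. (h \<bullet> n) / \<epsilon>)) (at y)"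
        using \<epsilon> by (auto intro!: derivative_eq_intros)
      from has_derivative_compose[OF this smooth_step_deriv[unfolded has_field_derivative_def]]
      show ?thesis unfolding st_def by (simp add: inner_commute mult_ac)
    qed
    have contc: "continuous_on A (cutoff 0 R)" for A :: "(real^3) set"
      by (intro continuous_at_imp_continuous_on ballI has_derivative_continuous[OF cutoff_has_derivative])
    have contst: "continuous_on A st" for A
      by (intro continuous_at_imp_continuous_on ballI has_derivative_continuous[OF st_der])
    have contt: "continuous_on A t" for A
      unfolding t_def using \<epsilon> by (intro continuous_intros contc) auto
    have st0: "st y = 0" "t y = 0" if "y \<bullet> n \<le> b + \<epsilon>" for y
      using that \<epsilon> by (auto simp: st_def t_def smooth_step_simps)
    have st1: "st y = 1" "t y = 0" if "y \<bullet> n \<ge> b + 4 * \<epsilon>" for y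
    proof -
      have "(y \<bullet> n - b) / \<epsilon> \<ge> 4" using that \<epsilon> by (simp add: field_simps)
      then show "st y = 1" "t y = 0" by (auto simp: st_def t_def smooth_step_simps)
    qed
    have t0: "t y = 0" if "norm y \<ge> 2 * R" for y
      using that R cutoff_outside(1)[of R y 0] by (simp add: t_def)
    have tnn: "t y \<ge> 0" for y
      using \<epsilon> cutoff_bounds[of 0 R y] smooth_step_bounds by (simp add: t_def)
    have stb: "0 \<le> st y" "st y \<le> 1" for y using smooth_step_bounds by (auto simp: st_def)
    define \<phi> where "\<phi> y = (1 - cutoff 0 R y) * st y" for y
    have \<phi>_der: "(\<phi> has_derivative \<phi>' y) (at y)" for y
      using has_derivative_mult[OF has_derivative_diff[OF has_derivative_const[of 1] cutoff_has_derivative[of 0 R y]] st_der[of y]]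
      unfolding \<phi>_def[abs_def] \<phi>'_def[abs_def] t_def by (simp add: algebra_simps)
    have \<phi>_cont: "continuous_on UNIV (\<lambda>y. \<phi>' y h)" for h
      unfolding \<phi>'_def by (intro continuous_intros contt contst continuous_cutoff_weight)
    define K where "K = cball 0 (2 * R) \<inter> {y. b + \<epsilon> \<le> y \<bullet> n}"
    have K: "compact K" "K \<subseteq> \<Omega>"
      unfolding K_def \<Omega>_def using \<epsilon> by (auto intro!: compact_Int_closed closed_Collect_le continuous_intros)
    have \<phi>0: "\<phi> y = 0" if "y \<notin> K" for y
      using that st0[of y] cutoff_outside(1)[of R y 0] R by (auto simp: K_def \<phi>_def)
    have x\<Omega>: "x \<in> \<Omega>" and xm\<Omega>: "xm \<notin> \<Omega>" using x xm by (auto simp: \<Omega>_def)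
    have rep: "(\<integral>y. (\<Sum>c\<in>Basis. \<phi>' y c *\<^sub>R W x y c) \<partial>lborel) = - of_real rep_const * u x"
      unfolding W_def
    proof (rule fund_representation[OF \<Omega>(1) u\<Omega> x\<Omega> \<phi>_der \<phi>_cont K \<phi>0, where r="min (R - norm x) \<delta>"])
      show "\<phi> y = 1" if "y \<in> ball x (min (R - norm x) \<delta>)" for y
      proof -
        have "norm (x - y) < R - norm x" "norm (x - y) < \<delta>" using that by (auto simp: dist_norm)
        moreover have "\<bar>(x - y) \<bullet> n\<bar> \<le> norm (x - y)" using Cauchy_Schwarz_ineq2[of "x - y" n] n by simp
        ultimately have "norm y \<le> R" "y \<bullet> n \<ge> b + 4 * \<epsilon>"
          using norm_triangle_ineq2[of y x] \<epsilon>(3) by (auto simp: norm_minus_commute inner_diff_left \<delta>_def)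
        then show ?thesis using cutoff_inside(1)[of R y 0] st1 R by (simp add: \<phi>_def)
      qed
    qed (use R \<delta> in auto)
    \<comment> \<open>The mirror pole is outside \<open>\<Omega>\<close>, so its Wronskian has no
      singularity there. Subtracting this zero from \<open>rep\<close> brings in Green's function of
      the half-space.\<close>
    have gr: "(\<integral>y. (\<Sum>c\<in>Basis. \<phi>' y c *\<^sub>R W xm y c) \<partial>lborel) = 0"
      unfolding W_def by (rule green[OF \<Omega>(1) u\<Omega> vsub[OF xm\<Omega>] \<phi>_der \<phi>_cont K \<phi>0])
    define A where "A p y = (cutoff_weight 0 R y * st y) *\<^sub>R W p y y" for p y
    define B where "B p y = t y *\<^sub>R W p y n" for p y
    have intA: "integrable lborel (A p)" if "p = x \<or> p = xm" for p
    proof (rule integrable_compact_support[of "\<Omega> - {x}" _ "K - ball 0 R"])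
      show "continuous_on (\<Omega> - {x}) (A p)"
        unfolding A_def using that xm\<Omega> \<Omega> by (intro continuous_intros continuous_cutoff_weight contst Wcont) auto
      show "A p y = 0" if "y \<notin> K - ball 0 R" for y
        using that st0[of y] cutoff_inside(2)[of R y 0] cutoff_outside(2)[of R y 0] R by (auto simp: K_def A_def)
    qed (use K R in \<open>auto simp: compact_diff\<close>)
    have intB: "integrable lborel (B p)" if "p = x \<or> p = xm" for p
    proof (rule integrable_compact_support[of "\<Omega> - {x}" _ "K \<inter> {y. y \<bullet> n \<le> b + 4 * \<epsilon>}"])
      show "continuous_on (\<Omega> - {x}) (B p)"
        unfolding B_def using that xm\<Omega> \<Omega> by (intro continuous_intros contt Wcont) auto
      show "B p y = 0" if "y \<notin> K \<inter> {y. y \<bullet> n \<le> b + 4 * \<epsilon>}" for y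
        using that st0[of y] st1[of y] t0[of y] by (auto simp: K_def B_def)
      show "compact (K \<inter> {y. y \<bullet> n \<le> b + 4 * \<epsilon>})"
        using K by (intro compact_Int_closed closed_Collect_le continuous_intros)
      show "K \<inter> {y. y \<bullet> n \<le> b + 4 * \<epsilon>} \<subseteq> \<Omega> - {x}" using K \<epsilon> by (auto simp: \<delta>_def)
    qed
    have split: "(\<Sum>c\<in>Basis. \<phi>' y c *\<^sub>R W p y c) = B p y - A p y" if p: "p = x \<or> p = xm" for p y
    proof (cases "y \<in> K \<and> y \<noteq> x")
      case True
      then have lin: "linear (W p y)" using K \<Omega> p xm\<Omega> by (intro Wlin) auto
      have "(\<Sum>c\<in>Basis. \<phi>' y c *\<^sub>R W p y c) =
          t y *\<^sub>R (\<Sum>c\<in>Basis. (n \<bullet> c) *\<^sub>R W p y c) - (cutoff_weight 0 R y * st y) *\<^sub>R (\<Sum>c\<in>Basis. (y \<bullet> c) *\<^sub>R W p y c)"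
        unfolding \<phi>'_def by (simp add: scaleR_left_diff_distrib sum_subtractf scaleR_sum_right mult_ac)
      then show ?thesis unfolding linear_Basis_expansion[OF lin] A_def B_def .
    next
      case False
      have "t y = 0 \<and> cutoff_weight 0 R y * st y = 0"
      proof (cases "y = x")
        case True
        then show ?thesis using st1[of x] \<epsilon> R cutoff_inside(2)[of R x 0] by (simp add: \<delta>_def)
      next
        case False
        then show ?thesis using \<open>\<not> (y \<in> K \<and> y \<noteq> x)\<close> st0[of y] t0[of y] cutoff_outside(2)[of R y 0] R by (auto simp: K_def)
      qed
      then show ?thesis by (auto simp: A_def B_def \<phi>'_def)
    qed
    have I1: "integral\<^sup>L lborel (B x) - integral\<^sup>L lborel (A x) = - of_real rep_const * u x"
      using rep intA[of x] intB[of x] by (simp add: split Bochner_Integration.integral_diff)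
    have I2: "integral\<^sup>L lborel (B xm) - integral\<^sup>L lborel (A xm) = 0"
      using gr intA[of xm] intB[of xm] by (simp add: split Bochner_Integration.integral_diff)
    have Ale: "norm (A p y) \<le> norm (cutoff_weight 0 R y *\<^sub>R W p y y)" for p y
      using stb[of y] by (simp add: A_def abs_mult mult_le_one mult_right_mono mult_left_le)
    have A1: "norm (integral\<^sup>L lborel (A x)) \<le> e"
      using R1(3,4)[of R] R intA[of x] Ale
      by (intro order_trans[OF integral_norm_bound] order_trans[OF integral_mono R1(4)[of R]] integrable_norm) auto
    have A2: "norm (integral\<^sup>L lborel (A xm)) \<le> e"
      using R2(3,4)[of R] R intA[of xm] Ale
      by (intro order_trans[OF integral_norm_bound] order_trans[OF integral_mono R2(4)[of R]] integrable_norm) auto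
    have intt: "integrable lborel t"
      by (rule integrable_compact_support[of UNIV _ "K \<inter> {y. y \<bullet> n \<le> b + 4 * \<epsilon>}"])
        (use contt K st0 st1 t0 in \<open>auto intro!: compact_Int_closed closed_Collect_le continuous_intros simp: K_def not_le\<close>)
    \<comment> \<open>The weight \<open>t\<close> has height of order \<open>1 / \<epsilon>\<close>,
      so a bound uniform in \<open>\<epsilon>\<close> comes from an exact identity: the derivative
      of \<open>\<phi>\<close> in the direction \<open>n\<close> integrates to 0, which turns the
      mass of \<open>t\<close> into an integral over the outer shell with \<open>st\<close> between
      0 and 1.\<close>
    have tint: "integral\<^sup>L lborel t \<le> 2 * R * (R * weight_const)"
    proof -
      have "(\<integral>y. \<phi>' y n \<partial>lborel) = 0"
        by (rule integral_derivative_compact_support[OF \<phi>_der \<phi>_cont K(1) \<phi>0])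
      also have "(\<lambda>y. \<phi>' y n) = (\<lambda>y. t y - cutoff_weight 0 R y * ((y \<bullet> n) * st y))"
        by (simp add: \<phi>'_def nn mult_ac)
      finally have "(\<integral>y. t y - cutoff_weight 0 R y * ((y \<bullet> n) * st y) \<partial>lborel) = 0" .
      moreover have int2: "integrable lborel (\<lambda>y. cutoff_weight 0 R y * ((y \<bullet> n) * st y))"
        using weight_integrable[OF _ assms(2) R(5), of "\<lambda>y. (y \<bullet> n) * st y"] contst
        by (simp add: continuous_intros)
      ultimately have "integral\<^sup>L lborel t = (\<integral>y. cutoff_weight 0 R y * ((y \<bullet> n) * st y) \<partial>lborel)"
        using intt by (simp add: Bochner_Integration.integral_diff)
      also have "\<dots> \<le> (\<integral>y. (2 * R) * cutoff_weight (0::real^3) R y \<partial>lborel)"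
      proof (rule integral_mono[OF int2])
        show "integrable lborel (\<lambda>y. (2 * R) * cutoff_weight (0::real^3) R y)"
          using weight_integral(1)[OF R(3)] by simp
        show "cutoff_weight 0 R y * ((y \<bullet> n) * st y) \<le> (2 * R) * cutoff_weight 0 R y" for y
        proof (cases "cutoff_weight 0 R y = 0")
          case False
          then have "norm y < 2 * R" using cutoff_weight_annulus[OF R(3)] by blast
          then have "\<bar>y \<bullet> n\<bar> \<le> 2 * R" using Cauchy_Schwarz_ineq2[of y n] n by simp
          then have "\<bar>y \<bullet> n\<bar> * \<bar>st y\<bar> \<le> 2 * R * 1" using stb[of y] R by (intro mult_mono) auto
          then have "(y \<bullet> n) * st y \<le> 2 * R" by (simp add: abs_le_iff flip: abs_mult)
          from mult_left_mono[OF this cutoff_bounds(3)[of 0 R y]] show ?thesis by (simp add: mult_ac)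
        qed simp
      qed
      also have "\<dots> = 2 * R * (R * weight_const)" using weight_integral(2)[OF R(3)] by simp
      finally show ?thesis .
    qed
    have Dle: "norm (B x y - B xm y) \<le> \<eta> * t y" for y
    proof (cases "t y = 0")
      case False
      then have yb: "b + \<epsilon> < y \<bullet> n" "y \<bullet> n < b + 4 * \<epsilon>" "norm y < 2 * R"
        using st0[of y] st1[of y] t0[of y] by force+
      define s where "s = y \<bullet> n - b"
      \<comment> \<open>The foot of the perpendicular from \<open>y\<close> to the plane. There
        \<open>D\<close> vanishes, since \<open>u\<close> is 0 and the fundamental solutions with
        poles \<open>x\<close> and \<open>xm\<close> coincide.\<close>
      define z where "z = y - s *\<^sub>R n"
      have zn: "z \<bullet> n = b" by (simp add: z_def s_def inner_diff_left nn)
      have s: "0 < s" "s < 4 * \<epsilon>" using yb \<epsilon> by (auto simp: s_def)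
      have yS: "y \<in> S" using yb \<epsilon> by (auto simp: S_def)
      have "norm z \<le> norm y + s" unfolding z_def using norm_triangle_ineq4[of y "s *\<^sub>R n"] n s by simp
      then have zS: "z \<in> S" using yb \<epsilon> s zn \<delta> by (auto simp: S_def)
      have "norm (y - z) = s" using s n by (simp add: z_def)
      then have "dist (D y) (D z) < \<eta>" using s \<epsilon> by (intro d(2)[OF zS yS]) (simp add: dist_norm)
      moreover have "D z = 0"
      proof -
        have "fund \<kappa> xm z = fund \<kappa> x z" by (simp add: fund_def xm_def norm_diff_mirror[OF n zn])
        then show ?thesis unfolding D_def W_def wronskian_def bdry[OF zn] by simp
      qed
      ultimately have "norm (D y) \<le> \<eta>" by (simp add: dist_norm)
      from mult_right_mono[OF this tnn[of y]]
      show ?thesis using tnn[of y] by (simp add: B_def D_def mult_ac flip: scaleR_right_diff_distrib)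
    qed (simp add: B_def)
    have "norm (integral\<^sup>L lborel (B x) - integral\<^sup>L lborel (B xm)) = norm (\<integral>y. B x y - B xm y \<partial>lborel)"
      using intB by (simp add: Bochner_Integration.integral_diff)
    also have "\<dots> \<le> (\<integral>y. \<eta> * t y \<partial>lborel)"
      using intB intt Dle
      by (intro order_trans[OF integral_norm_bound] integral_mono integrable_norm Bochner_Integration.integrable_diff) auto
    also have "\<dots> \<le> \<eta> * (2 * R * (R * weight_const))" using tint \<eta> by simp
    also have "\<dots> \<le> e" by (rule \<eta>(2))
    finally have B12: "norm (integral\<^sup>L lborel (B x) - integral\<^sup>L lborel (B xm)) \<le> e" .
    have "of_real rep_const * u x = integral\<^sup>L lborel (A x) - integral\<^sup>L lborel (A xm)
        - (integral\<^sup>L lborel (B x) - integral\<^sup>L lborel (B xm))"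
      using I1 I2 by (simp add: algebra_simps)
    also have "norm \<dots> \<le> (e + e) + e"
      by (intro order_trans[OF norm_triangle_ineq4 add_mono[OF order_trans[OF norm_triangle_ineq4 add_mono[OF A1 A2]] B12]])
    finally show ?thesis by simp
  qed
  have "norm (of_real rep_const * u x) \<le> 0 + e" if "e > 0" for e
    using bound[of "e / 3"] that by simp
  then have "norm (of_real rep_const * u x) \<le> 0" by (rule field_le_epsilon)
  then show ?thesis using rep_const_nonzero by simp
qed

section \<open>Holomorphic extension along lines\<close>

text \<open>A form of holomorphic dependence on \<open>s\<close> that permits differentiation under
  the integral over \<open>K\<close> and is preserved by arithmetic and by composition with
  holomorphic functions, so that kernels can be checked by structural rules.\<close>

definition param_holo :: "complex set \<Rightarrow> 'a::euclidean_space set \<Rightarrow> (complex \<Rightarrow> 'a \<Rightarrow> complex) \<Rightarrow> bool" where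
  "param_holo V K P \<longleftrightarrow> (\<exists>P'. (\<forall>s\<in>V. \<forall>y\<in>K. ((\<lambda>s. P s y) has_field_derivative P' s y) (at s)) \<and>
     continuous_on (V \<times> K) (\<lambda>(s, y). P s y) \<and> continuous_on (V \<times> K) (\<lambda>(s, y). P' s y))"

named_theorems param_holo_intros

lemma param_holo_const [param_holo_intros]:
  assumes "continuous_on K f"
  shows "param_holo V K (\<lambda>s y. f y)"
  unfolding param_holo_def
  by (intro exI[of _ "\<lambda>s y. 0"])
     (auto simp: case_prod_unfold intro!: continuous_intros continuous_on_compose2[OF assms])

lemma param_holo_ident [param_holo_intros]: "param_holo V K (\<lambda>s y. s)"
  unfolding param_holo_def
  by (intro exI[of _ "\<lambda>s y. 1"]) (auto simp: case_prod_unfold intro!: continuous_intros)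

lemma param_holo_add [param_holo_intros]:
  assumes "param_holo V K P" "param_holo V K Q"
  shows "param_holo V K (\<lambda>s y. P s y + Q s y)"
proof -
  obtain P' where P': "\<forall>s\<in>V. \<forall>y\<in>K. ((\<lambda>s. P s y) has_field_derivative P' s y) (at s)"
     "continuous_on (V \<times> K) (\<lambda>(s, y). P s y)" "continuous_on (V \<times> K) (\<lambda>(s, y). P' s y)"
    using assms(1) unfolding param_holo_def by blast
  obtain Q' where Q': "\<forall>s\<in>V. \<forall>y\<in>K. ((\<lambda>s. Q s y) has_field_derivative Q' s y) (at s)"
     "continuous_on (V \<times> K) (\<lambda>(s, y). Q s y)" "continuous_on (V \<times> K) (\<lambda>(s, y). Q' s y)"
    using assms(2) unfolding param_holo_def by blast
  show ?thesis unfolding param_holo_def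
    by (intro exI[of _ "\<lambda>s y. P' s y + Q' s y"])
       (use P' Q' in \<open>auto simp: case_prod_unfold intro!: continuous_intros DERIV_add\<close>)
qed

lemma param_holo_mult [param_holo_intros]:
  assumes "param_holo V K P" "param_holo V K Q"
  shows "param_holo V K (\<lambda>s y. P s y * Q s y)"
proof -
  obtain P' where P': "\<forall>s\<in>V. \<forall>y\<in>K. ((\<lambda>s. P s y) has_field_derivative P' s y) (at s)"
     "continuous_on (V \<times> K) (\<lambda>(s, y). P s y)" "continuous_on (V \<times> K) (\<lambda>(s, y). P' s y)"
    using assms(1) unfolding param_holo_def by blast
  obtain Q' where Q': "\<forall>s\<in>V. \<forall>y\<in>K. ((\<lambda>s. Q s y) has_field_derivative Q' s y) (at s)"
     "continuous_on (V \<times> K) (\<lambda>(s, y). Q s y)" "continuous_on (V \<times> K) (\<lambda>(s, y). Q' s y)"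
    using assms(2) unfolding param_holo_def by blast
  show ?thesis unfolding param_holo_def
    by (intro exI[of _ "\<lambda>s y. P' s y * Q s y + Q' s y * P s y"])
       (use P' Q' in \<open>auto simp: case_prod_unfold intro!: continuous_intros DERIV_mult\<close>)
qed

lemma param_holo_compose:
  assumes "param_holo V K P" "g holomorphic_on A" "open A" "\<And>s y. s \<in> V \<Longrightarrow> y \<in> K \<Longrightarrow> P s y \<in> A"
  shows "param_holo V K (\<lambda>s y. g (P s y))"
proof -
  obtain P' where P': "\<forall>s\<in>V. \<forall>y\<in>K. ((\<lambda>s. P s y) has_field_derivative P' s y) (at s)"
     "continuous_on (V \<times> K) (\<lambda>(s, y). P s y)" "continuous_on (V \<times> K) (\<lambda>(s, y). P' s y)"
    using assms(1) unfolding param_holo_def by blast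
  have g: "continuous_on A g" "continuous_on A (deriv g)"
    using assms(2,3) by (auto intro: holomorphic_on_imp_continuous_on holomorphic_deriv)
  have "((\<lambda>s. g (P s y)) has_field_derivative deriv g (P s y) * P' s y) (at s)" if "s \<in> V" "y \<in> K" for s y
    using DERIV_chain2[where f=g and g="\<lambda>s. P s y", OF holomorphic_derivI[OF assms(2,3) assms(4)[OF that]]] P'(1) that
    by blast
  then show ?thesis unfolding param_holo_def
    by (intro exI[of _ "\<lambda>s y. deriv g (P s y) * P' s y"])
       (use P' assms(4) in \<open>auto simp: case_prod_unfold intro!: continuous_intros continuous_on_compose2[OF g(1)] continuous_on_compose2[OF g(2)]\<close>)
qed

lemma param_holo_uminus [param_holo_intros]: "param_holo V K P \<Longrightarrow> param_holo V K (\<lambda>s y. - P s y)"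
  by (rule param_holo_compose[where A=UNIV]) (auto intro: holomorphic_intros)

lemma param_holo_diff [param_holo_intros]:
  "param_holo V K P \<Longrightarrow> param_holo V K Q \<Longrightarrow> param_holo V K (\<lambda>s y. P s y - Q s y)"
  using param_holo_add[OF _ param_holo_uminus] by fastforce

lemma param_holo_exp [param_holo_intros]: "param_holo V K P \<Longrightarrow> param_holo V K (\<lambda>s y. exp (P s y))"
  by (rule param_holo_compose[where A=UNIV]) (auto intro: holomorphic_intros)

lemma param_holo_power [param_holo_intros]: "param_holo V K P \<Longrightarrow> param_holo V K (\<lambda>s y. P s y ^ n)"
  by (rule param_holo_compose[where A=UNIV and g="\<lambda>z. z ^ n"]) (auto intro: holomorphic_intros)

lemma param_holo_divide [param_holo_intros]:
  assumes "param_holo V K P" "param_holo V K Q" "\<And>s y. s \<in> V \<Longrightarrow> y \<in> K \<Longrightarrow> Q s y \<noteq> 0"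
  shows "param_holo V K (\<lambda>s y. P s y / Q s y)"
proof -
  have "param_holo V K (\<lambda>s y. inverse (Q s y))"
    by (rule param_holo_compose[where A="- {0}", OF assms(2)]) (use assms(3) in \<open>auto intro: holomorphic_intros\<close>)
  from param_holo_mult[OF assms(1) this] show ?thesis by (simp add: divide_inverse)
qed

lemma param_holo_csqrt [param_holo_intros]:
  assumes "param_holo V K P" "\<And>s y. s \<in> V \<Longrightarrow> y \<in> K \<Longrightarrow> Re (P s y) > 0"
  shows "param_holo V K (\<lambda>s y. csqrt (P s y))"
proof (rule param_holo_compose[where A="{z. Re z > 0}", OF assms(1)])
  show "csqrt holomorphic_on {z. Re z > 0}"
    by (intro holomorphic_intros) (auto simp: complex_nonpos_Reals_iff)
qed (use assms(2) open_halfspace_Re_gt in auto)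

lemma param_holo_continuous:
  assumes "param_holo V K P" "s \<in> V"
  shows "continuous_on K (P s)"
proof -
  have c: "continuous_on (V \<times> K) (\<lambda>(s, y). P s y)" using assms unfolding param_holo_def by blast
  have "continuous_on K (\<lambda>y. (s, y))" by (intro continuous_intros)
  from continuous_on_compose2[OF c this] assms(2) show ?thesis by (auto simp: image_subset_iff)
qed

lemma param_holo_integral:
  assumes "param_holo V (cbox a b) P" "convex V"
  shows "(\<lambda>s. integral (cbox a b) (P s)) holomorphic_on V"
proof -
  obtain P' where P': "\<forall>s\<in>V. \<forall>y\<in>cbox a b. ((\<lambda>s. P s y) has_field_derivative P' s y) (at s)"
     "continuous_on (V \<times> cbox a b) (\<lambda>(s, y). P' s y)"
    using assms(1) unfolding param_holo_def by blast
  show ?thesis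
  proof (rule leibniz_rule_holomorphic[where fx=P', OF _ _ P'(2) assms(2)])
    show "((\<lambda>s. P s t) has_field_derivative P' s t) (at s within V)" if "s \<in> V" "t \<in> cbox a b" for s t
      using P'(1) that has_field_derivative_at_within by blast
    show "P s integrable_on cbox a b" if "s \<in> V" for s
      by (rule integrable_continuous[OF param_holo_continuous[OF assms(1) that]])
  qed
qed

text \<open>The representation formulas integrate over the whole space, whereas parameters are
  differentiated on a box; this passes from one to the other.\<close>

lemma lborel_integral_eq_cbox:
  fixes f g :: "'a::euclidean_space \<Rightarrow> 'b::euclidean_space"
  assumes "\<And>y. y \<in> cbox a b \<Longrightarrow> f y = g y" "continuous_on (cbox a b) g" "\<And>y. y \<notin> cbox a b \<Longrightarrow> f y = 0"
  shows "(\<integral>y. f y \<partial>lborel) = integral (cbox a b) g"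
proof -
  have "set_integrable lborel (cbox a b) g"
    unfolding set_integrable_def using assms(2) by (intro borel_integrable_compact compact_cbox)
  from set_borel_integral_eq_integral(2)[OF this]
  have "(\<integral>y. indicator (cbox a b) y *\<^sub>R g y \<partial>lborel) = integral (cbox a b) g"
    by (simp add: set_lebesgue_integral_def)
  moreover have "(\<lambda>y. indicator (cbox a b) y *\<^sub>R g y) = f"
    by (rule ext) (use assms(1,3) in \<open>auto simp: indicator_def\<close>)
  ultimately show ?thesis by simp
qed

section \<open>Solutions on lines, near a point and at infinity\<close>

lemma norm_diff_line:
  fixes y x \<theta> :: "'a::real_inner"
  assumes "norm \<theta> = 1"
  shows "(norm (y - (x + t *\<^sub>R \<theta>)))\<^sup>2 = (norm (y - x))\<^sup>2 - 2 * t * (\<theta> \<bullet> (y - x)) + t\<^sup>2"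
proof -
  define w where "w = y - x"
  have "\<theta> \<bullet> \<theta> = 1" using assms by (simp add: dot_square_norm)
  then have "(norm (w - t *\<^sub>R \<theta>))\<^sup>2 = (norm w)\<^sup>2 - 2 * t * (\<theta> \<bullet> w) + t\<^sup>2"
    unfolding power2_norm_eq_inner
    by (simp add: inner_diff_left inner_diff_right inner_commute[of w \<theta>] power2_eq_square right_diff_distrib)
  then show ?thesis by (simp add: w_def diff_diff_eq)
qed

lemma helmholtz_local_extension:
  fixes u :: "real^3 \<Rightarrow> complex"
  assumes "open U" and u: "helmholtz \<kappa> U u u'" and r: "r > 0" "cball p (2 * r) \<subseteq> U" and \<theta>: "norm \<theta> = 1"
  obtains g where "g holomorphic_on ball 0 (r / 4)"
    "\<And>t. \<bar>t\<bar> < r / 4 \<Longrightarrow> u (p + t *\<^sub>R \<theta>) = g (complex_of_real t)"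
proof -
  define w where "w = cutoff_weight p r"
  define al where "al y = w y *\<^sub>R u' y (y - p)" for y
  define be where "be y = w y *\<^sub>R u y" for y
  \<comment> \<open>The maximum changes nothing where \<open>w y \<noteq> 0\<close>, and keeps \<open>\<rho>\<close> away from \<open>0\<close> on the whole box.\<close>
  define D where "D y = max ((norm (y - p))\<^sup>2) (r\<^sup>2)" for y
  define \<rho> where "\<rho> s y = csqrt (of_real (D y) - 2 * s * of_real (\<theta> \<bullet> (y - p)) + s\<^sup>2)" for s and y :: "real^3"
  define P where "P s y = exp (\<i> * of_real \<kappa> * \<rho> s y) / \<rho> s y * al y -
     be y * (exp (\<i> * of_real \<kappa> * \<rho> s y) * (\<i> * of_real \<kappa> / (\<rho> s y)\<^sup>2 - 1 / (\<rho> s y) ^ 3))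
       * (of_real ((y - p) \<bullet> (y - p)) - s * of_real (\<theta> \<bullet> (y - p)))" for s y
  obtain a where a: "cball p (2 * r) \<subseteq> cbox (- a) a"
    using bounded_subset_cbox_symmetric[OF bounded_cball] by blast
  have w0: "w y = 0" if "y \<notin> cball p (2 * r)" for y
    using that cutoff_outside(2)[of r y p] r by (simp add: w_def dist_norm norm_minus_commute)
  have cont_al: "continuous_on UNIV al"
    by (rule continuous_on_UNIV_by_support[of U _ "cball p (2 * r)"])
       (use r w0 \<open>open U\<close> in \<open>auto simp: al_def w_def intro!: continuous_intros continuous_cutoff_weight helmholtz_continuous_deriv[OF u]\<close>)
  have cont_be: "continuous_on UNIV be"
    by (rule continuous_on_UNIV_by_support[of U _ "cball p (2 * r)"])
       (use r w0 \<open>open U\<close> in \<open>auto simp: be_def w_def intro!: continuous_intros continuous_cutoff_weight helmholtz_continuous[OF u]\<close>)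
  \<comment> \<open>Relative to \<open>d\<^sup>2\<close> the linear term is at most 1/2 and the
    quadratic one at most 1/16; this explains the radius \<open>r / 4\<close>.\<close>
  have Re_pos: "Re (of_real (D y) - 2 * s * of_real (\<theta> \<bullet> (y - p)) + s\<^sup>2) > 0" if "s \<in> ball 0 (r / 4)" for s y
  proof -
    define d where "d = max (norm (y - p)) r"
    have d: "d \<ge> r" "norm (y - p) \<le> d" by (auto simp: d_def)
    have Dd: "D y = d\<^sup>2" using r by (auto simp: D_def d_def max_def power_mono not_le intro!: antisym)
    have s: "norm s \<le> d / 4" using that d by auto
    have "norm (2 * s * of_real (\<theta> \<bullet> (y - p))) \<le> 2 * (d / 4) * d"
    proof -
      have "\<bar>\<theta> \<bullet> (y - p)\<bar> \<le> d" using Cauchy_Schwarz_ineq2[of \<theta> "y - p"] \<theta> d by simp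
      then show ?thesis unfolding norm_mult using s d r by (intro mult_mono) auto
    qed
    moreover have "norm (s\<^sup>2) \<le> (d / 4)\<^sup>2" unfolding norm_power using s by (intro power_mono) auto
    moreover have "(d / 4)\<^sup>2 + 2 * (d / 4) * d < d\<^sup>2" using d r by (simp add: power2_eq_square)
    ultimately show ?thesis
      using abs_Re_le_cmod[of "s\<^sup>2"] abs_Re_le_cmod[of "2 * s * of_real (\<theta> \<bullet> (y - p))"] unfolding Dd by simp
  qed
  have \<rho>0: "\<rho> s y \<noteq> 0" if "s \<in> ball 0 (r / 4)" for s y
  proof -
    have "of_real (D y) - 2 * s * of_real (\<theta> \<bullet> (y - p)) + s\<^sup>2 \<noteq> 0"
      using Re_pos[OF that, of y] by (metis less_irrefl zero_complex.sel(1))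
    then show ?thesis unfolding \<rho>_def csqrt_eq_0 .
  qed
  have \<rho>_holo: "param_holo (ball 0 (r / 4)) K \<rho>" for K
    unfolding \<rho>_def using Re_pos
    by (intro param_holo_intros) (auto simp: D_def intro!: continuous_intros)
  have P_holo: "param_holo (ball 0 (r / 4)) (cbox (- a) a) P"
    unfolding P_def using \<rho>0
    by (intro param_holo_intros \<rho>_holo continuous_on_subset[OF cont_al] continuous_on_subset[OF cont_be])
       (auto intro!: continuous_intros)
  define g where "g s = integral (cbox (- a) a) (P s) / of_real rep_const" for s
  have "g holomorphic_on ball 0 (r / 4)"
    unfolding g_def using rep_const_nonzero
    by (intro holomorphic_intros param_holo_integral[OF P_holo]) auto
  moreover have "u (p + t *\<^sub>R \<theta>) = g (complex_of_real t)" if t: "\<bar>t\<bar> < r / 4" for t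
  proof -
    define x where "x = p + t *\<^sub>R \<theta>"
    have xp: "norm (x - p) < r / 4" using t \<theta> by (simp add: x_def)
    have tb: "complex_of_real t \<in> ball 0 (r / 4)" using t by simp
    have xU: "x \<in> U" using xp r by (auto simp: subset_iff dist_norm norm_minus_commute)
    let ?W = "wronskian u u' (fund \<kappa> x) (fund_deriv \<kappa> x)"
    have "(\<integral>y. (\<Sum>b\<in>Basis. (0 - w y * ((y - p) \<bullet> b)) *\<^sub>R ?W y b) \<partial>lborel) = - of_real rep_const * u x"
    proof (rule fund_representation[OF \<open>open U\<close> u xU, where \<phi>="\<lambda>y. 1 - cutoff p r y" and K="cball p (2 * r)" and r="r / 2"
         and \<phi>'="\<lambda>y h. 0 - w y * ((y - p) \<bullet> h)"])
      show "((\<lambda>y. 1 - cutoff p r y) has_derivative (\<lambda>h. 0 - w y * ((y - p) \<bullet> h))) (at y)" for y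
        unfolding w_def by (intro has_derivative_diff has_derivative_const cutoff_has_derivative)
      show "continuous_on UNIV (\<lambda>y. 0 - w y * ((y - p) \<bullet> b))" for b
        unfolding w_def by (intro continuous_on_diff continuous_cutoff_gradient continuous_intros)
      show "1 - cutoff p r y = 0" if "y \<notin> cball p (2 * r)" for y
        using that cutoff_outside(1)[of r y p] r by (simp add: dist_norm norm_minus_commute)
      show "1 - cutoff p r y = 1" if "y \<in> ball x (r / 2)" for y
      proof -
        have "norm (y - p) \<le> norm (y - x) + norm (x - p)" by (rule norm_diff_triangle_ineq[of y x x p, simplified, THEN order_trans]) simp
        then have "norm (y - p) \<le> r" using that xp r by (simp add: dist_norm norm_minus_commute)
        then show ?thesis using cutoff_inside(1)[of r y p] r by simp
      qed
    qed (use r in auto)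
    also have "(\<lambda>y. \<Sum>b\<in>Basis. (0 - w y * ((y - p) \<bullet> b)) *\<^sub>R ?W y b) = (\<lambda>y. - P (of_real t) y)"
    proof (rule ext)
      fix y
      show "(\<Sum>b\<in>Basis. (0 - w y * ((y - p) \<bullet> b)) *\<^sub>R ?W y b) = - P (of_real t) y"
      proof (cases "w y = 0")
        case False
        then have yr: "norm (y - p) > r" "y \<in> U"
          using cutoff_inside(2)[of r y p] r w0[of y] by (force simp: w_def)+
        have yx: "y \<noteq> x" using yr xp r by auto
        have lin: "linear (?W y)"
          by (rule wronskian_linear[OF helmholtz_subset[OF u, of "{y}"] helmholtz_subset[OF helmholtz_fund, of "{y}"]]) (use yr yx in auto)
        have \<rho>eq: "\<rho> (of_real t) y = of_real (norm (y - x))"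
        proof -
          have "D y = (norm (y - p))\<^sup>2" using yr r by (simp add: D_def max_def power_mono)
          then have "of_real (D y) - 2 * of_real t * of_real (\<theta> \<bullet> (y - p)) + (of_real t)\<^sup>2 = complex_of_real ((norm (y - x))\<^sup>2)"
            unfolding x_def norm_diff_line[OF \<theta>] by simp
          then show ?thesis unfolding \<rho>_def by (simp only: csqrt_of_real zero_le_power2) simp
        qed
        have "(y - x) \<bullet> (y - p) = (y - p) \<bullet> (y - p) - t * (\<theta> \<bullet> (y - p))"
          unfolding x_def diff_add_eq_diff_diff_swap by (simp add: inner_diff_left algebra_simps)
        then have ieq: "of_real ((y - p) \<bullet> (y - p)) - of_real t * of_real (\<theta> \<bullet> (y - p)) = complex_of_real ((y - x) \<bullet> (y - p))"
          by simp
        have "w y *\<^sub>R ?W y (y - p) = P (of_real t) y"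
          unfolding wronskian_def fund_def fund_deriv_def wave0_def wave1_def P_def al_def be_def \<rho>eq ieq
          by (simp add: scaleR_right_diff_distrib mult.assoc)
        then show ?thesis using cutoff_pairing[OF lin, of "w y" y p] by (simp add: sum_negf)
      qed (simp add: P_def al_def be_def)
    qed
    finally have "(\<integral>y. P (of_real t) y \<partial>lborel) = of_real rep_const * u x" by simp
    moreover have "(\<integral>y. P (of_real t) y \<partial>lborel) = integral (cbox (- a) a) (P (of_real t))"
    proof (rule lborel_integral_eq_cbox)
      show "continuous_on (cbox (- a) a) (P (of_real t))" by (rule param_holo_continuous[OF P_holo tb])
      show "P (of_real t) y = 0" if "y \<notin> cbox (- a) a" for y
      proof -
        have "w y = 0" using w0 that a by blast
        then show ?thesis by (simp add: P_def al_def be_def)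
      qed
    qed simp
    ultimately show ?thesis using rep_const_nonzero by (simp add: g_def x_def)
  qed
  ultimately show ?thesis using that by blast
qed

text \<open>With \<open>s = 1/t\<close> the distance \<open>\<bar>x0 + t \<theta> - y\<bar>\<close> is \<open>S s y / s\<close>, and \<open>L s y\<close> is this distance minus \<open>t\<close>;
  both \<open>S\<close> and \<open>L\<close> are holomorphic at \<open>s = 0\<close>.\<close>

lemma radiating_ray_expansion:
  fixes u :: "real^3 \<Rightarrow> complex"
  assumes "\<kappa> > 0" "R0 > 0" and u: "helmholtz \<kappa> {y. norm y > R0} u u'" and rad: "radiating \<kappa> u u'"
    and \<theta>: "norm \<theta> = 1"
  obtains \<delta> H where "\<delta> > 0" "H holomorphic_on ball 0 \<delta>"
    "\<And>s. 0 < s \<Longrightarrow> s < \<delta> \<Longrightarrow> u (x0 + (1 / s) *\<^sub>R \<theta>) = exp (\<i> * of_real (\<kappa> / s)) * H (complex_of_real s)"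
proof -
  define R1 where "R1 = R0 + 1"
  have R1: "R1 > R0" "R1 > 0" using assms by (auto simp: R1_def)
  define w where "w = cutoff_weight (0 :: real^3) R1"
  define al where "al y = w y *\<^sub>R u' y y" for y
  define be where "be y = w y *\<^sub>R u y" for y
  define a where "a y = \<theta> \<bullet> (y - x0)" for y
  define m where "m y = (norm (y - x0))\<^sup>2" for y
  define S where "S s y = csqrt (1 - 2 * of_real (a y) * s + of_real (m y) * s\<^sup>2)" for s y
  \<comment> \<open>This is \<open>(S s y - 1) / s\<close> with the numerator rationalised; in this
    form nothing is divided by \<open>s\<close>.\<close>
  define L where "L s y = (of_real (m y) * s - 2 * of_real (a y)) / (S s y + 1)" for s y
  \<comment> \<open>The Wronskian kernel for the pole
    \<open>x0 + (1 / s) *\<^sub>R \<theta>\<close>, with distances written as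
    \<open>S s y / s\<close> and the phase \<open>exp (\<i> \<kappa> / s)\<close> taken out. All
    negative powers of \<open>s\<close> have cancelled.\<close>
  define P where "P s y = exp (\<i> * of_real \<kappa> * L s y) * (s / S s y * al y -
     be y * (\<i> * of_real \<kappa> * s / (S s y)\<^sup>2 - s\<^sup>2 / (S s y) ^ 3)
       * (s * of_real ((y - x0) \<bullet> y) - of_real (\<theta> \<bullet> y)))" for s y
  obtain c where c: "cball 0 (2 * R1) \<subseteq> cbox (- c) (c :: real^3)"
    using bounded_subset_cbox_symmetric[OF bounded_cball] by blast
  obtain M where M: "M > 0" "\<And>y. y \<in> cbox (- c) c \<Longrightarrow> norm (y - x0) \<le> M"
  proof -
    have "bounded ((\<lambda>y. y - x0) ` cbox (- c) c)"
      by (intro compact_imp_bounded compact_continuous_image compact_cbox continuous_intros)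
    then show ?thesis using that unfolding bounded_pos by auto
  qed
  \<comment> \<open>The first bound puts the point with parameter \<open>1 / s\<close> at norm above
    \<open>2 * R1\<close>, where the exterior representation holds. The second keeps the terms in
    \<open>s\<close> and \<open>s\<^sup>2\<close> under the root at most 1/4 and 1/64, away from the
    branch cut.\<close>
  define \<delta> where "\<delta> = min (1 / (2 * R1 + norm x0 + 1)) (1 / (8 * M))"
  have \<delta>: "\<delta> > 0" "\<delta> \<le> 1 / (2 * R1 + norm x0 + 1)" "\<delta> * M \<le> 1 / 8"
  proof -
    have "\<delta> * M \<le> 1 / (8 * M) * M" using M by (intro mult_right_mono) (auto simp: \<delta>_def)
    then show "\<delta> * M \<le> 1 / 8" using M by simp
    show "\<delta> > 0" using R1 M norm_ge_zero[of x0] by (auto simp: \<delta>_def intro!: divide_pos_pos add_pos_nonneg add_nonneg_pos)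
  qed (simp add: \<delta>_def)
  have w0: "w y = 0" if "y \<notin> cball 0 (2 * R1)" for y
    using that cutoff_outside(2)[of R1 y 0] R1 by (simp add: w_def)
  have supp: "w y = 0" if "y \<notin> cball 0 (2 * R1) - ball 0 R1" for y
    using that cutoff_weight_annulus[of R1 y] R1 unfolding w_def by fastforce
  have cont_al: "continuous_on UNIV al"
    by (rule continuous_on_UNIV_by_support[of "{y. norm y > R0}" _ "cball 0 (2 * R1) - ball 0 R1"])
       (use R1 supp open_exterior_ball in \<open>auto simp: al_def w_def intro!: continuous_intros continuous_cutoff_weight helmholtz_continuous_deriv[OF u]\<close>)
  have cont_be: "continuous_on UNIV be"
    by (rule continuous_on_UNIV_by_support[of "{y. norm y > R0}" _ "cball 0 (2 * R1) - ball 0 R1"])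
       (use R1 supp open_exterior_ball in \<open>auto simp: be_def w_def intro!: continuous_intros continuous_cutoff_weight helmholtz_continuous[OF u]\<close>)
  have Re_pos: "Re (1 - 2 * of_real (a y) * s + of_real (m y) * s\<^sup>2) > 0"
    if s: "s \<in> ball 0 \<delta>" and y: "y \<in> cbox (- c) c" for s y
  proof -
    have aM: "\<bar>a y\<bar> \<le> M" using Cauchy_Schwarz_ineq2[of \<theta> "y - x0"] \<theta> M(2)[OF y] by (simp add: a_def)
    have sM: "M * norm s \<le> 1 / 8"
    proof -
      have "M * norm s \<le> M * \<delta>" using s M by (intro mult_left_mono) auto
      then show ?thesis using \<delta>(3) by (simp add: mult.commute)
    qed
    have "norm (2 * of_real (a y) * s) \<le> 2 * (M * norm s)"
      using aM by (simp add: norm_mult mult_right_mono)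
    moreover have "norm (of_real (m y) * s\<^sup>2) \<le> (M * norm s)\<^sup>2"
      using M(2)[OF y] by (simp add: norm_mult norm_power m_def power_mult_distrib mult_right_mono power_mono)
    moreover have "(M * norm s)\<^sup>2 \<le> (1 / 8)\<^sup>2" using sM M by (intro power_mono) auto
    ultimately show ?thesis
      using sM abs_Re_le_cmod[of "2 * of_real (a y) * s"] abs_Re_le_cmod[of "of_real (m y) * s\<^sup>2"]
      by (simp add: power2_eq_square)
  qed
  have S_pos: "Re (S s y) > 0" if "s \<in> ball 0 \<delta>" "y \<in> cbox (- c) c" for s y
  proof -
    have "(S s y)\<^sup>2 = 1 - 2 * of_real (a y) * s + of_real (m y) * s\<^sup>2" by (simp add: S_def)
    then have "Re ((S s y)\<^sup>2) > 0" using Re_pos[OF that] by simp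
    then have "Re (S s y) \<noteq> 0" by (auto simp: Re_power2)
    moreover have "S s y \<noteq> 0" using calculation by auto
    ultimately show ?thesis
      using csqrt_principal[of "1 - 2 * of_real (a y) * s + of_real (m y) * s\<^sup>2"]
      unfolding S_def[symmetric] by (auto simp: less_le)
  qed
  have S0: "S s y \<noteq> 0" "S s y + 1 \<noteq> 0" if "s \<in> ball 0 \<delta>" "y \<in> cbox (- c) c" for s y
    using S_pos[OF that] by (auto simp: complex_eq_iff)
  have S_holo: "param_holo (ball 0 \<delta>) (cbox (- c) c) S"
    unfolding S_def using Re_pos
    by (intro param_holo_intros) (auto simp: a_def m_def intro!: continuous_intros)
  have L_holo: "param_holo (ball 0 \<delta>) (cbox (- c) c) L"
    unfolding L_def using S0
    by (intro param_holo_intros S_holo) (auto simp: a_def m_def intro!: continuous_intros)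
  have P_holo: "param_holo (ball 0 \<delta>) (cbox (- c) c) P"
    unfolding P_def using S0
    by (intro param_holo_intros S_holo L_holo continuous_on_subset[OF cont_al] continuous_on_subset[OF cont_be])
       (auto intro!: continuous_intros)
  define H where "H s = - integral (cbox (- c) c) (P s) / of_real rep_const" for s
  have H: "H holomorphic_on ball 0 \<delta>"
    unfolding H_def using rep_const_nonzero
    by (intro holomorphic_intros param_holo_integral[OF P_holo]) auto
  have "u (x0 + (1 / s) *\<^sub>R \<theta>) = exp (\<i> * of_real (\<kappa> / s)) * H (complex_of_real s)" if s: "0 < s" "s < \<delta>" for s
  proof -
    define x where "x = x0 + (1 / s) *\<^sub>R \<theta>"
    define E where "E = exp (\<i> * complex_of_real (\<kappa> / s))"
    have sb: "complex_of_real s \<in> ball 0 \<delta>" using s by simp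
    have "1 / s > 2 * R1 + norm x0"
    proof -
      have p: "2 * R1 + norm x0 + 1 > 0" using R1 norm_ge_zero[of x0] by linarith
      have "s < 1 / (2 * R1 + norm x0 + 1)" using s \<delta> by simp
      then have "2 * R1 + norm x0 + 1 < 1 / s" using p s by (simp add: field_simps)
      then show ?thesis by simp
    qed
    moreover have "norm ((1 / s) *\<^sub>R \<theta>) = 1 / s" using s \<theta> by simp
    ultimately have xR: "norm x > 2 * R1" unfolding x_def using norm_diff_ineq[of "(1 / s) *\<^sub>R \<theta>" x0] by (simp add: add.commute)
    let ?W = "wronskian u u' (fund \<kappa> x) (fund_deriv \<kappa> x)"
    have "(\<integral>y. w y *\<^sub>R ?W y y \<partial>lborel) = - of_real rep_const * u x"
      unfolding w_def by (rule exterior_representation[OF assms(1-4) R1(1) xR])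
    moreover have "(\<integral>y. w y *\<^sub>R ?W y y \<partial>lborel) = integral (cbox (- c) c) (\<lambda>y. E * P (of_real s) y)"
    proof (rule lborel_integral_eq_cbox)
      show "continuous_on (cbox (- c) c) (\<lambda>y. E * P (of_real s) y)"
        by (intro continuous_intros param_holo_continuous[OF P_holo sb])
      show "w y *\<^sub>R ?W y y = 0" if "y \<notin> cbox (- c) c" for y
      proof -
        have "w y = 0" using w0 that c by blast
        then show ?thesis by simp
      qed
      show "w y *\<^sub>R ?W y y = E * P (of_real s) y" if y: "y \<in> cbox (- c) c" for y
      proof (cases "w y = 0")
        case False
        define \<sigma> where "\<sigma> = complex_of_real s"
        have \<sigma>: "\<sigma> \<noteq> 0" using s by (simp add: \<sigma>_def)
        define q where "q = 1 - 2 * a y * s + m y * s\<^sup>2"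
        have nq: "(norm (y - x))\<^sup>2 = q / s\<^sup>2"
          unfolding x_def norm_diff_line[OF \<theta>] q_def a_def m_def using s by (simp add: field_simps power2_eq_square)
        have q: "q = (s * norm (y - x))\<^sup>2" using nq s by (simp add: power_mult_distrib)
        have "S \<sigma> y = csqrt (of_real q)" unfolding S_def q_def \<sigma>_def by simp
        also have "\<dots> = of_real (s * norm (y - x))"
          unfolding q using s by (simp only: csqrt_of_real zero_le_power2) simp
        finally have Seq: "complex_of_real (norm (y - x)) = S \<sigma> y / \<sigma>" using \<sigma> by (simp add: \<sigma>_def)
        note Snz = S0[OF sb y, folded \<sigma>_def]
        have "(S \<sigma> y)\<^sup>2 = 1 - 2 * of_real (a y) * \<sigma> + of_real (m y) * \<sigma>\<^sup>2" by (simp add: S_def)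
        then have "(S \<sigma> y - 1) * (S \<sigma> y + 1) = \<sigma> * (of_real (m y) * \<sigma> - 2 * of_real (a y))"
          by (simp add: algebra_simps power2_eq_square)
        then have "S \<sigma> y - 1 = \<sigma> * L \<sigma> y" unfolding L_def using Snz by (simp add: eq_divide_eq)
        then have Leq: "S \<sigma> y / \<sigma> = 1 / \<sigma> + L \<sigma> y" using \<sigma> by (simp add: field_simps)
        have expeq: "exp (\<i> * of_real \<kappa> * (S \<sigma> y / \<sigma>)) = E * exp (\<i> * of_real \<kappa> * L \<sigma> y)"
          unfolding Leq E_def by (simp add: distrib_left exp_add \<sigma>_def)
        have "(y - x) \<bullet> y = (s * ((y - x0) \<bullet> y) - \<theta> \<bullet> y) / s"
          unfolding x_def using s by (simp add: inner_diff_left inner_add_left field_simps)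
        then have ieq: "complex_of_real ((y - x) \<bullet> y) = (\<sigma> * of_real ((y - x0) \<bullet> y) - of_real (\<theta> \<bullet> y)) / \<sigma>"
          by (simp add: \<sigma>_def)
        define X where "X = \<sigma> * of_real ((y - x0) \<bullet> y) - complex_of_real (\<theta> \<bullet> y)"
        define e where "e = exp (\<i> * of_real \<kappa> * L \<sigma> y)"
        have "w y *\<^sub>R ?W y y = E * e / (S \<sigma> y / \<sigma>) * al y
            - be y * (E * e * (\<i> * of_real \<kappa> / (S \<sigma> y / \<sigma>)\<^sup>2 - 1 / (S \<sigma> y / \<sigma>) ^ 3) * (X / \<sigma>))"
          unfolding wronskian_def fund_def fund_deriv_def wave0_def wave1_def Seq expeq ieq al_def be_def X_def e_def
          by (simp add: scaleR_conv_of_real algebra_simps)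
        also have "\<dots> = E * P \<sigma> y"
          unfolding P_def X_def[symmetric] e_def[symmetric] using \<sigma> Snz
          by (simp add: field_simps power2_eq_square power3_eq_cube)
        finally show ?thesis by (simp add: \<sigma>_def)
      qed (simp add: P_def al_def be_def)
    qed
    ultimately have "of_real rep_const * u x = - E * integral (cbox (- c) c) (P (of_real s))"
      by (simp add: minus_equation_iff)
    then show ?thesis using rep_const_nonzero by (simp add: H_def x_def E_def field_simps)
  qed
  then show ?thesis using that \<delta>(1) H by blast
qed

section \<open>Unique continuation and determination from the imaginary part\<close>

text \<open>Local holomorphic extensions, rather than power series, are what the integral
  representations yield and what the identity theorem for holomorphic functions consumes. Agreement
  is required on a full real neighbourhood of \<open>t0\<close>, even where it leaves
  \<open>S\<close>.\<close>

definition real_analytic :: "real set \<Rightarrow> (real \<Rightarrow> complex) \<Rightarrow> bool" where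
  "real_analytic S f \<longleftrightarrow> (\<forall>t0\<in>S. \<exists>r>0. \<exists>g. g holomorphic_on ball (of_real t0) r \<and>
     (\<forall>t. \<bar>t - t0\<bar> < r \<longrightarrow> f t = g (of_real t)))"

lemma holomorphic_cnj_cnj_ball:
  assumes "g holomorphic_on ball (of_real t0) r"
  shows "(\<lambda>z. cnj (g (cnj z))) holomorphic_on ball (of_real t0) r"
proof -
  have "cnj ` ball (of_real t0) r = ball (of_real t0) r"
  proof -
    have d: "dist (complex_of_real t0) (cnj z) = dist (complex_of_real t0) z" for z
      by (metis complex_cnj_complex_of_real complex_cnj_diff complex_mod_cnj dist_norm)
    show ?thesis
    proof safe
      fix z assume "z \<in> ball (complex_of_real t0) r"
      then show "cnj z \<in> ball (complex_of_real t0) r" "z \<in> cnj ` ball (complex_of_real t0) r"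
        using d[of z] by (auto intro!: image_eqI[of _ _ "cnj z"])
    qed
  qed
  with holomorphic_on_compose_cnj_cnj[of g "ball (of_real t0) r"] assms
  show ?thesis by (simp add: o_def)
qed

text \<open>The imaginary part of \<open>g\<close> is not holomorphic, but on the real axis it
  agrees with \<open>(g z - cnj (g (cnj z))) / (2 * \<i>)\<close>, which is.\<close>

lemma real_analytic_Im:
  assumes "real_analytic S f"
  shows "real_analytic S (\<lambda>t. of_real (Im (f t)))"
  unfolding real_analytic_def
proof
  fix t0 assume "t0 \<in> S"
  with assms obtain r g where r: "r > 0" "g holomorphic_on ball (of_real t0) r"
    "\<And>t. \<bar>t - t0\<bar> < r \<Longrightarrow> f t = g (of_real t)"
    unfolding real_analytic_def by metis
  define h where "h z = (g z - cnj (g (cnj z))) / (2 * \<i>)" for z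
  have "h holomorphic_on ball (of_real t0) r"
    unfolding h_def by (intro holomorphic_intros r(2) holomorphic_cnj_cnj_ball) auto
  moreover have "of_real (Im (f t)) = h (of_real t)" if "\<bar>t - t0\<bar> < r" for t
    unfolding h_def using r(3)[OF that] by (simp add: complex_eq_iff)
  ultimately show "\<exists>r>0. \<exists>g. g holomorphic_on ball (of_real t0) r \<and>
     (\<forall>t. \<bar>t - t0\<bar> < r \<longrightarrow> complex_of_real (Im (f t)) = g (of_real t))"
    using r(1) by blast
qed

lemma islimpt_of_real_interval:
  assumes "e > 0"
  shows "complex_of_real a islimpt of_real ` {t. a < t \<and> t < a + e}"
  unfolding islimpt_approachable
proof (intro allI impI)
  fix \<epsilon> :: real assume "\<epsilon> > 0"
  define t where "t = a + min e \<epsilon> / 2"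
  have "t \<in> {t. a < t \<and> t < a + e}" "\<bar>t - a\<bar> < \<epsilon>" "t \<noteq> a" using assms \<open>\<epsilon> > 0\<close> by (auto simp: t_def min_def)
  moreover have "dist (complex_of_real t) (of_real a) = \<bar>t - a\<bar>"
    by (simp add: dist_norm flip: of_real_diff)
  ultimately show "\<exists>x'\<in>of_real ` {t. a < t \<and> t < a + e}. x' \<noteq> complex_of_real a \<and> dist x' (complex_of_real a) < \<epsilon>"
    by (intro bexI[of _ "of_real t"]) auto
qed

text \<open>Vanishing near a point spreads over \<open>S\<close> by connectedness: within one disc
  of holomorphy a real interval of zeros makes the extension vanish identically.\<close>

lemma real_analytic_identity:
  assumes "real_analytic S f" "connected S" "a \<in> S" "b \<in> S"
    and "e > 0" "\<And>t. \<bar>t - a\<bar> < e \<Longrightarrow> f t = 0"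
  shows "f b = 0"
proof -
  define P where "P t \<longleftrightarrow> (\<exists>e>0. \<forall>t'. \<bar>t' - t\<bar> < e \<longrightarrow> f t' = 0)" for t
  have "P b"
  proof (rule connected_induction_simple[OF assms(2,3,4)])
    show "P a" unfolding P_def using assms(5,6) by blast
    fix c assume "c \<in> S"
    with assms(1) obtain r g where r: "r > 0" "g holomorphic_on ball (of_real c) r"
      "\<And>t. \<bar>t - c\<bar> < r \<Longrightarrow> f t = g (of_real t)"
      unfolding real_analytic_def by metis
    have dc: "dist (complex_of_real c) (of_real t) = \<bar>t - c\<bar>" for t
      by (simp add: dist_norm abs_minus_commute flip: of_real_diff)
    have "P y" if x: "x \<in> ball c r" "P x" and y: "y \<in> ball c r" for x y
    proof -
      obtain d where d: "d > 0" "\<And>t'. \<bar>t' - x\<bar> < d \<Longrightarrow> f t' = 0"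
        using x(2) unfolding P_def by blast
      define d' where "d' = min d (r - \<bar>x - c\<bar>)"
      have d': "d' > 0" using d x by (simp add: d'_def dist_real_def abs_minus_commute)
      have g0: "g w = 0" if w: "w \<in> ball (of_real c) r" for w
      proof (rule analytic_continuation[OF r(2) open_ball connected_ball _ _ islimpt_of_real_interval[OF d', of x] _ w])
        have in_r: "\<bar>t - c\<bar> < r" if "x < t" "t < x + d'" for t
          using that by (simp add: d'_def)
        then show "of_real ` {t. x < t \<and> t < x + d'} \<subseteq> ball (complex_of_real c) r"
          by (auto simp: dist_real_def abs_minus_commute)
        show "complex_of_real x \<in> ball (of_real c) r" using x by (simp add: dc dist_real_def abs_minus_commute)
        show "g z = 0" if "z \<in> of_real ` {t. x < t \<and> t < x + d'}" for z
        proof -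
          from that obtain t where t: "z = of_real t" "x < t" "t < x + d'" by auto
          then have "f t = 0" by (intro d(2)) (simp add: d'_def)
          then show ?thesis using r(3)[OF in_r[OF t(2,3)]] t(1) by simp
        qed
      qed
      have "f t' = 0" if "\<bar>t' - y\<bar> < r - \<bar>y - c\<bar>" for t'
      proof -
        have "\<bar>t' - c\<bar> < r" using that by linarith
        then show ?thesis using r(3)[of t'] g0[of "of_real t'"] by (simp add: dist_real_def abs_minus_commute)
      qed
      moreover have "r - \<bar>y - c\<bar> > 0" using y by (simp add: dist_real_def abs_minus_commute)
      ultimately show ?thesis unfolding P_def by blast
    qed
    moreover have "openin (top_of_set S) (S \<inter> ball c r)" by (rule openin_open_Int) simp
    moreover have "c \<in> S \<inter> ball c r" using \<open>c \<in> S\<close> \<open>r > 0\<close> by simp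
    ultimately show "\<exists>T. openin (top_of_set S) T \<and> c \<in> T \<and> (\<forall>x\<in>T. \<forall>y\<in>T. P x \<longrightarrow> P y)"
      by blast
  qed
  then obtain d where "d > 0" "\<And>t. \<bar>t - b\<bar> < d \<Longrightarrow> f t = 0" unfolding P_def by blast
  then show ?thesis by simp
qed

lemma helmholtz_real_analytic:
  fixes u :: "real^3 \<Rightarrow> complex"
  assumes "open U" and u: "helmholtz \<kappa> U u u'" and \<theta>: "norm \<theta> = 1" and S: "\<And>t. t \<in> S \<Longrightarrow> p + t *\<^sub>R \<theta> \<in> U"
  shows "real_analytic S (\<lambda>t. u (p + t *\<^sub>R \<theta>))"
  unfolding real_analytic_def
proof
  fix t0 assume "t0 \<in> S"
  then obtain e where e: "e > 0" "cball (p + t0 *\<^sub>R \<theta>) e \<subseteq> U"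
    using S \<open>open U\<close> open_contains_cball by blast
  define r where "r = e / 2"
  have r: "r > 0" "cball (p + t0 *\<^sub>R \<theta>) (2 * r) \<subseteq> U" using e by (auto simp: r_def)
  obtain g where g: "g holomorphic_on ball 0 (r / 4)"
      "\<And>t. \<bar>t\<bar> < r / 4 \<Longrightarrow> u (p + t0 *\<^sub>R \<theta> + t *\<^sub>R \<theta>) = g (complex_of_real t)"
    by (rule helmholtz_local_extension[OF assms(1) u r \<theta>], rule that, assumption+)
  have "(g \<circ> (\<lambda>z. z - of_real t0)) holomorphic_on ball (of_real t0) (r / 4)"
    by (rule holomorphic_on_compose_gen[OF _ g(1)]) (auto intro!: holomorphic_intros simp: dist_norm norm_minus_commute)
  moreover have "u (p + t *\<^sub>R \<theta>) = (g \<circ> (\<lambda>z. z - of_real t0)) (of_real t)" if "\<bar>t - t0\<bar> < r / 4" for t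
    using g(2)[OF that] by (simp add: algebra_simps)
  ultimately show "\<exists>r>0. \<exists>g. g holomorphic_on ball (of_real t0) r \<and>
     (\<forall>t. \<bar>t - t0\<bar> < r \<longrightarrow> u (p + t *\<^sub>R \<theta>) = g (of_real t))"
    using r(1) by (intro exI[of _ "r / 4"]) auto
qed

text \<open>Analyticity along lines is enough: within a ball contained in \<open>U\<close> each
  point is joined by a segment to a point around which \<open>u\<close> vanishes, and connectedness
  of \<open>U\<close> carries this from ball to ball.\<close>

lemma helmholtz_unique_continuation:
  fixes u :: "real^3 \<Rightarrow> complex"
  assumes "open U" "connected U" and u: "helmholtz \<kappa> U u u'"
    and c: "c \<in> U" "e > 0" "\<And>y. y \<in> ball c e \<Longrightarrow> u y = 0" and "x \<in> U"
  shows "u x = 0"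
proof -
  define P where "P x \<longleftrightarrow> (\<exists>e>0. \<forall>y\<in>ball x e. u y = 0)" for x
  have "P x"
  proof (rule connected_induction_simple[OF assms(2) c(1) \<open>x \<in> U\<close>])
    show "P c" using c unfolding P_def by blast
    fix a assume "a \<in> U"
    then obtain r where r: "r > 0" "ball a r \<subseteq> U" using \<open>open U\<close> open_contains_ball by blast
    have "P y" if x: "x \<in> ball a r" "P x" and y: "y \<in> ball a r" for x y
    proof -
      obtain d where d: "d > 0" "\<And>y. y \<in> ball x d \<Longrightarrow> u y = 0"
        using x(2) unfolding P_def by blast
      have "u z = 0" if z: "z \<in> ball a r" for z
      proof (cases "z = x")
        case False
        define l where "l = norm (z - x)"
        define \<theta> where "\<theta> = (1 / l) *\<^sub>R (z - x)"
        have l: "l > 0" using False by (simp add: l_def)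
        have \<theta>: "norm \<theta> = 1" using l by (simp add: \<theta>_def l_def)
        have zl: "x + l *\<^sub>R \<theta> = z" using l by (simp add: \<theta>_def)
        have "x + t *\<^sub>R \<theta> \<in> U" if "t \<in> {0..l}" for t
        proof -
          have "x + t *\<^sub>R \<theta> = (1 - t / l) *\<^sub>R x + (t / l) *\<^sub>R z"
            by (simp add: \<theta>_def algebra_simps)
          also have "\<dots> \<in> ball a r"
            using that l by (intro convexD[OF convex_ball x(1) z]) auto
          finally show ?thesis using r by blast
        qed
        from helmholtz_real_analytic[OF \<open>open U\<close> u \<theta> this]
        have "real_analytic {0..l} (\<lambda>t. u (x + t *\<^sub>R \<theta>))" .
        then have "u (x + l *\<^sub>R \<theta>) = 0"
          by (rule real_analytic_identity[where a=0 and e=d and b=l])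
             (use l d \<theta> in \<open>auto simp: dist_norm\<close>)
        then show ?thesis using zl by simp
      qed (use d in simp)
      moreover have "ball y (r - dist a y) \<subseteq> ball a r"
      proof
        fix z assume "z \<in> ball y (r - dist a y)"
        then show "z \<in> ball a r" using dist_triangle[of a z y] by simp
      qed
      ultimately show ?thesis unfolding P_def using y by (intro exI[of _ "r - dist a y"]) auto
    qed
    moreover have "openin (top_of_set U) (ball a r)" using r \<open>open U\<close> by (simp add: openin_open_eq)
    moreover have "a \<in> ball a r" using r by simp
    ultimately show "\<exists>T. openin (top_of_set U) T \<and> a \<in> T \<and> (\<forall>x\<in>T. \<forall>y\<in>T. P x \<longrightarrow> P y)"
      by blast
  qed
  then show ?thesis unfolding P_def by (meson centre_in_ball)
qed

text \<open>If \<open>exp (\<i> \<kappa> / s) * H s\<close> is real for small \<open>s > 0\<close> then \<open>H z = exp (- 2 \<i> \<kappa> / z) * cnj (H (cnj z))\<close>,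
  which makes \<open>H\<close> decay exponentially as \<open>z \<rightarrow> 0\<close> along the positive imaginary axis.\<close>

lemma real_phase_imp_zero:
  assumes "\<kappa> > 0" "\<delta> > 0" and H: "H holomorphic_on ball 0 \<delta>"
    and real: "\<And>s. 0 < s \<Longrightarrow> s < \<delta> \<Longrightarrow> Im (exp (\<i> * of_real (\<kappa> / s)) * H (complex_of_real s)) = 0"
    and z: "z \<in> ball 0 \<delta>"
  shows "H z = 0"
proof -
  define Hs where "Hs z = cnj (H (cnj z))" for z
  have Hs: "Hs holomorphic_on ball 0 \<delta>"
    unfolding Hs_def using holomorphic_cnj_cnj_ball[of H 0 \<delta>] H by simp
  define F where "F z = H z - exp (- 2 * \<i> * of_real \<kappa> / z) * Hs z" for z
  have F_holo: "F holomorphic_on ball 0 \<delta> - {0}"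
    unfolding F_def by (intro holomorphic_intros holomorphic_on_subset[OF H] holomorphic_on_subset[OF Hs]) auto
  \<comment> \<open>Reality of the phase times \<open>H\<close> gives \<open>F = 0\<close> on a real
    interval away from the essential singularity at 0. The punctured disc is connected, so the
    equation reaches the imaginary axis.\<close>
  have F0: "F w = 0" if w: "w \<in> ball 0 \<delta> - {0}" for w
  proof (rule analytic_continuation[OF F_holo _ _ _ _ islimpt_of_real_interval[of "\<delta> / 4" "\<delta> / 2"] _ w])
    show "open (ball 0 \<delta> - {0 :: complex})" by (intro open_Diff) auto
    show "connected (ball 0 \<delta> - {0 :: complex})" by (intro connected_open_diff_countable) auto
    show "F v = 0" if "v \<in> of_real ` {t. \<delta> / 2 < t \<and> t < \<delta> / 2 + \<delta> / 4}" for v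
    proof -
      from that obtain s where s: "v = of_real s" "\<delta> / 2 < s" "s < \<delta> / 2 + \<delta> / 4" by auto
      then have s': "0 < s" "s < \<delta>" using assms(2) by linarith+
      define E where "E = exp (\<i> * complex_of_real (\<kappa> / s))"
      have "Im (E * H v) = 0" using real[OF s'] unfolding E_def s(1) .
      moreover have "cnj z = z" if "Im z = 0" for z using that by (simp add: complex_eq_iff)
      ultimately have "cnj (E * H v) = E * H v" by blast
      moreover have "cnj E = inverse E" by (simp add: E_def exp_cnj exp_minus)
      ultimately have "inverse E * cnj (H v) = E * H v" by simp
      then have "inverse E * inverse E * cnj (H v) = H v"
        by (simp add: E_def field_simps)
      moreover have "inverse E * inverse E = exp (- 2 * \<i> * of_real \<kappa> / v)"
        by (simp add: E_def s(1) algebra_simps flip: exp_minus exp_add)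
      ultimately show ?thesis using s(1) by (simp add: F_def Hs_def)
    qed
  qed (use assms(2) in auto)
  have "compact (Hs ` cball 0 (\<delta> / 2))"
    by (intro compact_continuous_image continuous_on_subset[OF holomorphic_on_imp_continuous_on[OF Hs]])
       (use assms(2) in auto)
  then have "bounded (Hs ` cball 0 (\<delta> / 2))" by (rule compact_imp_bounded)
  then obtain B where B: "B > 0" "\<And>w. w \<in> cball 0 (\<delta> / 2) \<Longrightarrow> norm (Hs w) \<le> B"
    unfolding bounded_pos by auto
  have decay: "norm (H (\<i> * of_real \<tau>)) \<le> B * exp (- (2 * \<kappa> / \<tau>))" if \<tau>: "0 < \<tau>" "\<tau> \<le> \<delta> / 2" for \<tau>
  proof -
    have "F (\<i> * of_real \<tau>) = 0" using \<tau> assms(2) by (intro F0) (auto simp: norm_mult)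
    moreover have "- 2 * \<i> * of_real \<kappa> / (\<i> * of_real \<tau>) = complex_of_real (- (2 * \<kappa> / \<tau>))"
      using \<tau> by (simp add: field_simps)
    ultimately have "H (\<i> * of_real \<tau>) = of_real (exp (- (2 * \<kappa> / \<tau>))) * Hs (\<i> * of_real \<tau>)"
      unfolding F_def by (simp only: exp_of_real right_minus_eq)
    then have "norm (H (\<i> * of_real \<tau>)) = exp (- (2 * \<kappa> / \<tau>)) * norm (Hs (\<i> * of_real \<tau>))"
      by (simp add: norm_mult)
    also have "\<dots> \<le> exp (- (2 * \<kappa> / \<tau>)) * B"
      using \<tau> by (intro mult_left_mono B) (auto simp: norm_mult)
    finally show ?thesis by (simp add: mult.commute)
  qed
  \<comment> \<open>Along the points \<open>\<i> / (m + 1)\<close> the exponential decay beats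
    division by any power, so no local factorisation \<open>w ^ n * g w\<close> of \<open>H\<close>
    can have \<open>g 0 \<noteq> 0\<close>. The case \<open>n = 0\<close> gives
    \<open>H 0 = 0\<close>.\<close>
  have flat: "g 0 = 0" if g: "g holomorphic_on ball 0 r" "r > 0" and Hg: "\<And>w. w \<in> ball 0 r \<Longrightarrow> H w = w ^ n * g w" for g r n
  proof -
    define \<tau> where "\<tau> m = inverse (real (Suc m))" for m
    have \<tau>0: "\<tau> \<longlonglongrightarrow> 0" unfolding \<tau>_def by (rule LIMSEQ_inverse_real_of_nat)
    have \<tau>p: "\<tau> m > 0" for m by (simp add: \<tau>_def)
    have "(\<lambda>m. \<i> * complex_of_real (\<tau> m)) \<longlonglongrightarrow> \<i> * of_real 0" by (intro tendsto_intros \<tau>0)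
    then have lim0: "(\<lambda>m. \<i> * complex_of_real (\<tau> m)) \<longlonglongrightarrow> 0" by simp
    have "isCont g 0"
      using holomorphic_on_imp_continuous_on[OF g(1)] g(2) by (simp add: continuous_on_eq_continuous_at)
    from isCont_tendsto_compose[OF this lim0]
    have lim1: "(\<lambda>m. g (\<i> * complex_of_real (\<tau> m))) \<longlonglongrightarrow> g 0" .
    have "filterlim (\<lambda>m. 2 * \<kappa> * real (Suc m)) at_top sequentially"
      by (rule filterlim_tendsto_pos_mult_at_top[OF tendsto_const _
          filterlim_compose[OF filterlim_real_sequentially filterlim_Suc]]) (use assms(1) in simp)
    from filterlim_compose[OF tendsto_power_div_exp_0 this]
    have "(\<lambda>m. (2 * \<kappa> * real (Suc m)) ^ n / exp (2 * \<kappa> * real (Suc m))) \<longlonglongrightarrow> 0" .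
    from tendsto_mult_right_zero[OF this, of "B / (2 * \<kappa>) ^ n"]
    have lim2: "(\<lambda>m. B / (2 * \<kappa>) ^ n * ((2 * \<kappa> * real (Suc m)) ^ n / exp (2 * \<kappa> * real (Suc m)))) \<longlonglongrightarrow> 0" .
    have "eventually (\<lambda>m. \<tau> m < min r (\<delta> / 2)) sequentially"
      by (rule order_tendstoD(2)[OF \<tau>0]) (use g(2) assms(2) in simp)
    then have "eventually (\<lambda>m. norm (g (\<i> * complex_of_real (\<tau> m)))
       \<le> B / (2 * \<kappa>) ^ n * ((2 * \<kappa> * real (Suc m)) ^ n / exp (2 * \<kappa> * real (Suc m)))) sequentially"
    proof (rule eventually_mono)
      fix m assume m: "\<tau> m < min r (\<delta> / 2)"
      have "norm (H (\<i> * of_real (\<tau> m))) = \<tau> m ^ n * norm (g (\<i> * of_real (\<tau> m)))"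
        using Hg[of "\<i> * of_real (\<tau> m)"] m \<tau>p[of m] by (simp add: norm_mult norm_power)
      with decay[of "\<tau> m"] m \<tau>p[of m]
      have "\<tau> m ^ n * norm (g (\<i> * of_real (\<tau> m))) \<le> B * exp (- (2 * \<kappa> / \<tau> m))" by simp
      then have "norm (g (\<i> * of_real (\<tau> m))) \<le> B * exp (- (2 * \<kappa> / \<tau> m)) / \<tau> m ^ n"
        using \<tau>p[of m] by (simp add: field_simps)
      also have "\<dots> = B / (2 * \<kappa>) ^ n * ((2 * \<kappa> * real (Suc m)) ^ n / exp (2 * \<kappa> * real (Suc m)))"
      proof -
        define k where "k = (2 * \<kappa>) ^ n"
        define N where "N = real (Suc m)"
        have k: "k \<noteq> 0" using assms(1) by (simp add: k_def)
        have "(2 * \<kappa> * N) ^ n = k * N ^ n" unfolding k_def by (rule power_mult_distrib)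
        then show ?thesis
          unfolding \<tau>_def N_def[symmetric] k_def[symmetric] power_inverse using k
          by (simp add: exp_minus divide_inverse)
      qed
      finally show "norm (g (\<i> * complex_of_real (\<tau> m)))
       \<le> B / (2 * \<kappa>) ^ n * ((2 * \<kappa> * real (Suc m)) ^ n / exp (2 * \<kappa> * real (Suc m)))" .
    qed
    from Lim_null_comparison[OF this lim2] lim1 show ?thesis by (simp add: LIMSEQ_unique)
  qed
  have H0: "H 0 = 0" using flat[of H \<delta> 0] H assms(2) by simp
  show ?thesis
  proof (rule ccontr)
    assume "H z \<noteq> 0"
    then have nc: "\<not> H constant_on ball 0 \<delta>" using H0 z assms(2) unfolding constant_on_def by force
    have z0: "0 \<in> ball (0::complex) \<delta>" using assms(2) by simp
    obtain g r n where g: "0 < n" "0 < r" "ball (0::complex) r \<subseteq> ball 0 \<delta>" "g holomorphic_on ball 0 r"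
       "\<And>w. w \<in> ball 0 r \<Longrightarrow> H w = (w - 0) ^ n * g w" "\<And>w. w \<in> ball 0 r \<Longrightarrow> g w \<noteq> 0"
      by (rule holomorphic_factor_zero_nonconstant[OF H open_ball connected_ball z0 H0 nc], rule that, assumption+)
    then have "g 0 = 0" by (intro flat[of g r n]) auto
    then show False using g(2,6) by simp
  qed
qed

lemma real_on_line_imp_zero:
  fixes u :: "real^3 \<Rightarrow> complex"
  assumes "\<kappa> > 0" "R0 > 0" and ext: "{y. norm y > R0} \<subseteq> U" and "open U"
    and u: "helmholtz \<kappa> U u u'" and rad: "radiating \<kappa> u u'"
    and \<theta>: "norm \<theta> = 1" and line: "\<And>t. p + t *\<^sub>R \<theta> \<in> U"
    and e: "e > 0" "\<And>t. \<bar>t\<bar> < e \<Longrightarrow> Im (u (p + t *\<^sub>R \<theta>)) = 0"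
  shows "u (p + t *\<^sub>R \<theta>) = 0"
proof -
  define f where "f t = u (p + t *\<^sub>R \<theta>)" for t
  have f: "real_analytic UNIV f"
    unfolding f_def by (rule helmholtz_real_analytic[OF \<open>open U\<close> u \<theta> line])
  have "complex_of_real (Im (f t)) = 0" for t
    by (rule real_analytic_identity[OF real_analytic_Im[OF f] connected_UNIV _ _ e(1), of 0]) (use e(2) in \<open>auto simp: f_def\<close>)
  then have Im: "Im (f t) = 0" for t by simp
  obtain \<delta> H where H: "\<delta> > 0" "H holomorphic_on ball 0 \<delta>"
    "\<And>s. 0 < s \<Longrightarrow> s < \<delta> \<Longrightarrow> u (p + (1 / s) *\<^sub>R \<theta>) = exp (\<i> * of_real (\<kappa> / s)) * H (complex_of_real s)"
    by (rule radiating_ray_expansion[OF assms(1,2) helmholtz_subset[OF u ext] rad \<theta>, of p], rule that, assumption+)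
  have H0: "H z = 0" if "z \<in> ball 0 \<delta>" for z
    by (rule real_phase_imp_zero[OF assms(1) H(1,2) _ that]) (use Im H(3) in \<open>metis f_def\<close>)
  have far: "f t = 0" if "t > 1 / \<delta>" for t
  proof -
    have "1 / \<delta> > 0" using H(1) by simp
    then have t: "t > 0" using that by linarith
    have "1 / t < \<delta>" using that t H(1) by (simp add: field_simps)
    then show ?thesis using H(3)[of "1 / t"] H0[of "of_real (1 / t)"] t by (simp add: f_def norm_divide)
  qed
  \<comment> \<open>The interval of radius \<open>1 / \<delta>\<close> about
    \<open>2 / \<delta>\<close> lies in the range where \<open>far\<close> applies.\<close>
  have "f t = 0"
    by (rule real_analytic_identity[OF f connected_UNIV, of "2 / \<delta>" _ "1 / \<delta>"]) (use H(1) far in \<open>auto simp: abs_less_iff\<close>)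
  then show ?thesis by (simp add: f_def)
qed

section \<open>From the definitions to the working form, and the position of the surface\<close>

lemma radiation_solution_helmholtz:
  assumes "radiation_solution \<kappa> U \<psi>" "open U" and ext: "{y. norm y > R0} \<subseteq> U"
  obtains \<psi>' where "helmholtz \<kappa> U \<psi> \<psi>'" "radiating \<kappa> \<psi> \<psi>'"
proof -
  obtain f' f'' where f': "\<And>x. x \<in> U \<Longrightarrow> (\<psi> has_derivative blinfun_apply (f' x)) (at x)"
    and f'': "\<And>x. x \<in> U \<Longrightarrow> (f' has_derivative blinfun_apply (f'' x)) (at x)"
    and cont: "continuous_on (closure U) f''"
    using assms(1) unfolding radiation_solution_def C2_on_closure_def by blast
  have eq: "- laplacian \<psi> x = of_real (\<kappa>\<^sup>2) * \<psi> x" if "x \<in> U" for x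
    using assms(1) that unfolding radiation_solution_def by blast
  define \<psi>' where "\<psi>' x = blinfun_apply (f' x)" for x
  define \<psi>'' where "\<psi>'' b x h = blinfun_apply (blinfun_apply (f'' x) h) b" for b x h
  have d2: "((\<lambda>y. \<psi>' y b) has_derivative \<psi>'' b x) (at x)" if "x \<in> U" for b x
    unfolding \<psi>'_def \<psi>''_def
    by (rule bounded_linear.has_derivative[OF blinfun.bounded_linear_left f''[OF that]])
  have shift: "((\<lambda>t. x + t *\<^sub>R b) has_derivative (\<lambda>t. t *\<^sub>R b)) (at t)" for x b :: "real^3" and t
    by (auto intro!: derivative_eq_intros)
  have line: "((\<lambda>t. F (x + t *\<^sub>R b)) has_vector_derivative D b) (at 0)"
    if "(F has_derivative D) (at x)" for F :: "real^3 \<Rightarrow> complex" and D x b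
  proof -
    have "(F has_derivative D) (at (x + 0 *\<^sub>R b))" using that by simp
    from has_derivative_compose[OF shift this]
    show ?thesis unfolding has_vector_derivative_def
      by (simp add: linear_scale[OF has_derivative_linear[OF that]])
  qed
  have p1: "partial_deriv b \<psi> x = \<psi>' x b" if "x \<in> U" for x b
    unfolding partial_deriv_def \<psi>'_def by (intro vector_derivative_at line f' that)
  \<comment> \<open>\<open>partial_deriv b \<psi>\<close> is known to equal \<open>\<psi>'\<close>
    only inside \<open>U\<close>, so the derivative along the line is compared on the open set of
    parameters that stay in \<open>U\<close>.\<close>
  have p2: "partial_deriv b (partial_deriv b \<psi>) x = \<psi>'' b x b" if x: "x \<in> U" for x b
  proof -
    have "open {t. x + t *\<^sub>R b \<in> U}"
      using continuous_open_preimage[of UNIV "\<lambda>t. x + t *\<^sub>R b" U] \<open>open U\<close>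
      by (simp add: vimage_def continuous_intros)
    then have "((\<lambda>t. partial_deriv b \<psi> (x + t *\<^sub>R b)) has_vector_derivative \<psi>'' b x b) (at 0)"
      by (rule has_vector_derivative_transform_within_open[OF line[OF d2[OF x]]]) (use x p1 in auto)
    then show ?thesis unfolding partial_deriv_def[of b "partial_deriv b \<psi>"] by (rule vector_derivative_at)
  qed
  have "(\<Sum>b\<in>Basis. \<psi>'' b x b) = - of_real (\<kappa>\<^sup>2) * \<psi> x" if "x \<in> U" for x
  proof -
    have "(\<Sum>b\<in>Basis. \<psi>'' b x b) = laplacian \<psi> x" using p2[OF that] by (simp add: laplacian_def)
    then show ?thesis using arg_cong[OF eq[OF that], of uminus] by simp
  qed
  moreover have "continuous_on U (\<lambda>x. \<psi>'' b x b)" for b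
    unfolding \<psi>''_def by (intro continuous_intros continuous_on_subset[OF cont] closure_subset)
  ultimately have helm: "helmholtz \<kappa> U \<psi> \<psi>'"
    unfolding helmholtz_def using d2 f' by (intro exI[of _ \<psi>'']) (auto simp: \<psi>'_def)
  have "radiating \<kappa> \<psi> \<psi>'"
    unfolding radiating_def
  proof (intro allI impI)
    fix e :: real assume "e > 0"
    have "uniform_limit (sphere 0 1)
      (\<lambda>r \<theta>. of_real r * (vector_derivative (\<lambda>s. \<psi> (s *\<^sub>R \<theta>)) (at r) - \<i> * of_real \<kappa> * \<psi> (r *\<^sub>R \<theta>))) (\<lambda>_. 0) at_top"
      using assms(1) unfolding radiation_solution_def sommerfeld_radiation_def by blast
    from uniform_limitD[OF this \<open>e > 0\<close>] obtain R where
      "\<forall>r\<ge>R. \<forall>\<theta>\<in>sphere 0 1.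
         norm (of_real r * (vector_derivative (\<lambda>s. \<psi> (s *\<^sub>R \<theta>)) (at r) - \<i> * of_real \<kappa> * \<psi> (r *\<^sub>R \<theta>))) < e"
      unfolding eventually_at_top_linorder dist_norm diff_zero by blast
    then have R: "norm (of_real r * (vector_derivative (\<lambda>s. \<psi> (s *\<^sub>R \<theta>)) (at r) - \<i> * of_real \<kappa> * \<psi> (r *\<^sub>R \<theta>))) < e"
      if "r \<ge> R" "\<theta> \<in> sphere 0 1" for r \<theta>
      using that by blast
    \<comment> \<open>The entry \<open>max R0 0 + 1\<close> makes \<open>y\<close> nonzero, so that
      it has polar coordinates, and puts it into \<open>U\<close>.\<close>
    have "norm (\<psi>' y y - \<i> * of_real (\<kappa> * norm y) * \<psi> y) \<le> e" if y: "norm y \<ge> max R (max R0 0 + 1)" for y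
    proof -
      define r where "r = norm y"
      define \<theta> where "\<theta> = (1 / r) *\<^sub>R y"
      have r: "r > 0" "r > R0" "r \<ge> R" using y by (auto simp: r_def)
      have \<theta>: "\<theta> \<in> sphere 0 1" using r by (simp add: \<theta>_def r_def)
      have yr: "r *\<^sub>R \<theta> = y" using r by (simp add: \<theta>_def)
      have yU: "y \<in> U" using ext r by (auto simp: r_def)
      have "((\<lambda>s. s *\<^sub>R \<theta>) has_derivative (\<lambda>s. s *\<^sub>R \<theta>)) (at r)" by (auto intro!: derivative_eq_intros)
      moreover have "(\<psi> has_derivative \<psi>' y) (at (r *\<^sub>R \<theta>))" unfolding yr \<psi>'_def by (rule f'[OF yU])
      ultimately have "((\<lambda>s. \<psi> (s *\<^sub>R \<theta>)) has_vector_derivative \<psi>' y \<theta>) (at r)"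
        unfolding has_vector_derivative_def using has_derivative_compose linear_scale[OF helmholtz_linear[OF helm yU]] by fastforce
      then have vd: "vector_derivative (\<lambda>s. \<psi> (s *\<^sub>R \<theta>)) (at r) = \<psi>' y \<theta>" by (rule vector_derivative_at)
      have "\<psi>' y y = of_real r * \<psi>' y \<theta>"
        using linear_scale[OF helmholtz_linear[OF helm yU], of r \<theta>] yr by (simp add: scaleR_conv_of_real)
      then have "\<psi>' y y - \<i> * of_real (\<kappa> * norm y) * \<psi> y
          = of_real r * (vector_derivative (\<lambda>s. \<psi> (s *\<^sub>R \<theta>)) (at r) - \<i> * of_real \<kappa> * \<psi> (r *\<^sub>R \<theta>))"
        unfolding vd yr by (simp add: r_def algebra_simps)
      then show ?thesis using R[OF r(3) \<theta>] by simp
    qed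
    then show "\<exists>R. \<forall>y. R \<le> norm y \<longrightarrow> norm (\<psi>' y y - \<i> * of_real (\<kappa> * norm y) * \<psi> y) \<le> e" by blast
  qed
  with helm that show ?thesis by blast
qed

text \<open>A closed half-space is convex and unbounded; if it misses \<open>S\<close> it lies in a
  single component of the complement, which is then unbounded.\<close>

lemma halfspace_subset_outside:
  fixes S :: "'a::euclidean_space set"
  assumes "norm n = 1" "S \<subseteq> {y. y \<bullet> n < b}"
  shows "{y. y \<bullet> n \<ge> b} \<subseteq> outside S"
proof
  fix y assume y: "y \<in> {y. y \<bullet> n \<ge> b}"
  have nn: "n \<bullet> n = 1" using assms by (simp add: dot_square_norm)
  have "convex {y. y \<bullet> n \<ge> b}" using convex_halfspace_ge[of b n] by (simp add: inner_commute)
  then have sub: "{y. y \<bullet> n \<ge> b} \<subseteq> connected_component_set (- S) y"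
    using y assms(2) by (intro connected_component_maximal convex_connected) auto
  have "\<not> bounded {y. y \<bullet> n \<ge> b}"
  proof
    assume "bounded {y. y \<bullet> n \<ge> b}"
    then obtain B where B: "\<And>z. z \<bullet> n \<ge> b \<Longrightarrow> norm z \<le> B" unfolding bounded_iff by blast
    define t where "t = \<bar>B\<bar> + \<bar>b\<bar> + 1"
    have "(t *\<^sub>R n) \<bullet> n \<ge> b" using nn by (simp add: t_def)
    from B[OF this] show False using assms(1) by (simp add: t_def)
  qed
  then have "\<not> bounded (connected_component_set (- S) y)" using sub bounded_subset by blast
  then show "y \<in> outside S" by (simp add: outside)
qed

text \<open>The plane misses the surface, so by an intermediate value argument the connected surface
  lies strictly on one side. The normal is oriented to point away from it.\<close>

lemma plane_bounds_halfspace: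
  fixes X U :: "(real^3) set"
  assumes "exterior_region U" "affine X" "aff_dim X = 2" "X \<subseteq> U"
  obtains n b where "norm n = 1" "X = {y. y \<bullet> n = b}" "{y. y \<bullet> n \<ge> b} \<subseteq> U"
proof -
  obtain S where S: "connected S" "U = outside S"
    using assms(1) unfolding exterior_region_def by blast
  have "aff_dim X = int (DIM(real^3) - 1)" using assms(3) by simp
  then have "\<exists>a c. a \<noteq> 0 \<and> affine hull X = {x. a \<bullet> x = c}"
    by (rule iffD1[OF aff_dim_eq_hyperplane])
  then obtain a c where ac: "a \<noteq> 0" "affine hull X = {x. a \<bullet> x = c}" by (elim exE conjE)
  then have X: "X = {x. a \<bullet> x = c}" using assms(2) by (simp add: hull_same)
  define n where "n = (1 / norm a) *\<^sub>R a"
  define b where "b = c / norm a"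
  have n: "norm n = 1" using ac by (simp add: n_def)
  have Xn: "X = {y. y \<bullet> n = b}" unfolding X n_def b_def using ac by (auto simp: inner_commute)
  have disj: "y \<bullet> n \<noteq> b" if "y \<in> S" for y
    using that assms(4) S outside_no_overlap[of S] Xn by blast
  have "S \<subseteq> {y. y \<bullet> n < b} \<or> S \<subseteq> {y. y \<bullet> n > b}"
  proof (rule ccontr)
    assume "\<not> (S \<subseteq> {y. y \<bullet> n < b} \<or> S \<subseteq> {y. y \<bullet> n > b})"
    then obtain y z where yz: "y \<in> S" "\<not> y \<bullet> n < b" "z \<in> S" "\<not> z \<bullet> n > b" by blast
    then have "n \<bullet> z \<le> b" "b \<le> n \<bullet> y" by (simp_all add: inner_commute)
    then obtain w where "w \<in> S" "n \<bullet> w = b" using connected_ivt_hyperplane[OF S(1) yz(3,1)] by blast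
    then show False using disj[of w] inner_commute[of n w] by simp
  qed
  then show ?thesis
  proof
    assume "S \<subseteq> {y. y \<bullet> n < b}"
    from halfspace_subset_outside[OF n this] show ?thesis using that[OF n Xn] S by simp
  next
    assume "S \<subseteq> {y. y \<bullet> n > b}"
    then have "S \<subseteq> {y. y \<bullet> (- n) < - b}" by auto
    from halfspace_subset_outside[OF _ this] n have "{y. y \<bullet> (- n) \<ge> - b} \<subseteq> U" using S by simp
    moreover have "X = {y. y \<bullet> (- n) = - b}" using Xn by auto
    ultimately show ?thesis using that[of "- n" "- b"] n by simp
  qed
qed

theorem corollary1:
  fixes \<kappa> :: real and U X D :: "(real ^ 3) set" and \<psi>\<^sub>1 \<psi>\<^sub>2 :: "real ^ 3 \<Rightarrow> complex"
  assumes "\<kappa> > 0"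
    and "exterior_region U"
    and "affine X" and "aff_dim X = 2" and "X \<subseteq> U"
    and "openin (top_of_set X) D" and "D \<noteq> {}"
    and "radiation_solution \<kappa> U \<psi>\<^sub>1" and "radiation_solution \<kappa> U \<psi>\<^sub>2"
    and "\<forall>x\<in>D. Im (\<psi>\<^sub>1 x) = Im (\<psi>\<^sub>2 x)"
  shows "\<forall>x\<in>U. \<psi>\<^sub>1 x = \<psi>\<^sub>2 x"
proof -
  have U: "open U" "connected U" using assms(2) by (auto simp: exterior_region_def)
  have "bounded (- U)"
    using assms(2) cobounded_outside unfolding exterior_region_def by blast
  then obtain R0 where R0: "R0 > 0" "{y. norm y > R0} \<subseteq> U"
    unfolding bounded_pos by (force simp: not_less)
  obtain u1' where u1: "helmholtz \<kappa> U \<psi>\<^sub>1 u1'" "radiating \<kappa> \<psi>\<^sub>1 u1'"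
    by (rule radiation_solution_helmholtz[OF assms(8) U(1) R0(2)])
  obtain u2' where u2: "helmholtz \<kappa> U \<psi>\<^sub>2 u2'" "radiating \<kappa> \<psi>\<^sub>2 u2'"
    by (rule radiation_solution_helmholtz[OF assms(9) U(1) R0(2)])
  define u where "u x = \<psi>\<^sub>1 x - \<psi>\<^sub>2 x" for x
  define u' where "u' x h = u1' x h - u2' x h" for x h
  have helm: "helmholtz \<kappa> U u u'" and rad: "radiating \<kappa> u u'"
    unfolding u_def u'_def using helmholtz_diff[OF u1(1) u2(1)] radiating_diff[OF u1(2) u2(2)] by auto
  obtain n b where n: "norm n = 1" "X = {y. y \<bullet> n = b}" "{y. y \<bullet> n \<ge> b} \<subseteq> U"
    by (rule plane_bounds_halfspace[OF assms(2-5)])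
  have nn: "n \<bullet> n = 1" using n by (simp add: dot_square_norm)
  obtain p where p: "p \<in> D" using assms(7) by blast
  obtain e where e: "e > 0" "ball p e \<inter> X \<subseteq> D"
    using assms(6) p unfolding openin_contains_ball by blast
  have pX: "p \<bullet> n = b" using p openin_imp_subset[OF assms(6)] n by blast
  \<comment> \<open>The whole line through \<open>p\<close> and another point \<open>x\<close> of
    the plane lies in \<open>X\<close>, hence in \<open>U\<close>, and near \<open>p\<close> it
    stays in \<open>D\<close>.\<close>
  have ray: "u (p + t *\<^sub>R ((1 / norm (x - p)) *\<^sub>R (x - p))) = 0" if x: "x \<in> X" "x \<noteq> p" for x t
  proof (rule real_on_line_imp_zero[OF assms(1) R0 U(1) helm rad _ _ e(1)])
    define \<theta> where "\<theta> = (1 / norm (x - p)) *\<^sub>R (x - p)"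
    show \<theta>: "norm ((1 / norm (x - p)) *\<^sub>R (x - p)) = 1" using x by simp
    have inX: "p + t *\<^sub>R \<theta> \<in> X" for t
      using x pX n(2) by (simp add: \<theta>_def inner_add_left inner_diff_left)
    then show "p + t *\<^sub>R ((1 / norm (x - p)) *\<^sub>R (x - p)) \<in> U" for t
      using assms(5) by (auto simp: \<theta>_def)
    show "Im (u (p + t *\<^sub>R ((1 / norm (x - p)) *\<^sub>R (x - p)))) = 0" if "\<bar>t\<bar> < e" for t
    proof -
      have "norm \<theta> = 1" using x by (simp add: \<theta>_def)
      then have "dist p (p + t *\<^sub>R \<theta>) < e" using that by (simp add: dist_norm)
      then have "p + t *\<^sub>R \<theta> \<in> D" using e(2) inX[of t] by auto
      then show ?thesis using assms(10) by (simp add: u_def \<theta>_def)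
    qed
  qed
  have uX: "u x = 0" if x: "x \<bullet> n = b" for x
  proof (cases "x = p")
    case False
    then show ?thesis using ray[of x "norm (x - p)"] x n(2) by simp
  next
    case True
    \<comment> \<open>A plane has points other than \<open>p\<close>, so \<open>p\<close> itself
      lies on one of the lines already treated, at parameter 0.\<close>
    have "X \<noteq> {p}" using assms(4) by auto
    then obtain y where "y \<in> X" "y \<noteq> p" using pX n(2) by blast
    then show ?thesis using ray[of y 0] True by simp
  qed
  have half: "u x = 0" if "x \<bullet> n > b" for x
    by (rule halfspace_uniqueness[OF assms(1) R0 U(1) helm rad n(1,3) uX that])
  \<comment> \<open>The unit ball about this point, at height 2 above the plane, lies in the open
    half-space and gives unique continuation a ball to start from.\<close>
  define c where "c = p + 2 *\<^sub>R n"
  have cn: "c \<bullet> n = b + 2" using pX nn by (simp add: c_def inner_add_left)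
  have "u x = 0" if "x \<in> U" for x
  proof (rule helmholtz_unique_continuation[OF U helm _ zero_less_one _ that])
    show "c \<in> U" using n(3) cn by auto
    show "u y = 0" if "y \<in> ball c 1" for y
    proof (rule half)
      have "\<bar>(c - y) \<bullet> n\<bar> < 1"
        using that Cauchy_Schwarz_ineq2[of "c - y" n] n(1) by (simp add: dist_norm)
      then show "y \<bullet> n > b" using cn by (simp add: inner_diff_left)
    qed
  qed
  then show ?thesis by (simp add: u_def)
qed

end
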